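(* Let the true system be minimal with lag $\ell_{\mathrm{true}}\leq L$ and state-space dimension $n_{\mathrm{true}}\leq N$, and let its initial state $x(0)=x_0\in\mathbb{R}^{n_{\mathrm{true}}}$ be arbitrary. Then the procedure OnlineExperiment$(L,N)$ (specified in the context) terminates and returns input-output data $(u_{[0,t-1]},y_{[0,t-1]})$ that are informative for system identification. Moreover, the length $t$ of the returned data satisfies $t=T$, where $$T=L^a+(L^a+1)m+n_{\mathrm{true}},\qquad L^a=\min(L,\,N-n_{\mathrm{true}}+\ell_{\mathrm{true}}).$$
   Context: Systems. Let $m,p\geq1$. A system $\left[\begin{smallmatrix}A&B\\ C&D\end{smallmatrix}\right]$ with $n\geq 0$ states consists of $A\in\mathbb{R}^{n\times n}$, $B\in\mathbb{R}^{n\times m}$, $C\in\mathbb{R}^{p\times n}$, $D\in\mathbb{R}^{p\times m}$ and represents $x(t+1)=Ax(t)+Bu(t)$, $y(t)=Cx(t)+Du(t)$. With $\Omega_{-1}$ the void $0\times n$ matrix (rank $0$) and $\Omega_k=\begin{bmatrix}\Omega_{k-1}\\ C A^k\end{bmatrix}$ for $k\geq0$, the lag $\ell(C,A)$ is the smallest integer $k\geq0$ with $\operatorname{rank}\Omega_k=\operatorname{rank}\Omega_{k-1}$. Let $\mathcal{S}(\ell,n)$ be the set of systems with $n$ states and lag $\ell$, and $\mathcal{S}(n)=\bigcup_{\ell\in[0,n]}\mathcal{S}(\ell,n)$. Let $\mathcal{M}$ be the set of all systems (any $n\geq0$) with $(A,B)$ controllable and $(C,A)$ observable (minimal systems). Let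 $\mathcal{S}_{L,N}=\bigcup_{\ell\in[0,L],\,n\in[0,N]}\mathcal{S}(\ell,n)$. Two systems in $\mathcal{S}(n)$ are isomorphic if $D_1=D_2$ and there is a nonsingular $S\in\mathbb{R}^{n\times n}$ with $A_1=S^{-1}A_2S$, $B_1=S^{-1}B_2$, $C_1=C_2S$. A subset of $\mathcal{S}(n)$ has the isomorphism property if any two of its members are isomorphic (the empty set has it by convention). True system. The data are generated by a system $(A_{\mathrm{true}},B_{\mathrm{true}},C_{\mathrm{true}},D_{\mathrm{true}})$ with $n_{\mathrm{true}}\geq0$ states and lag $\ell_{\mathrm{true}}=\ell(C_{\mathrm{true}},A_{\mathrm{true}})$. The output $y(t)$ is the one resulting from the initial state $x_0$ and the inputs $u(0),\dots,u(t)$. Hankel matrices. For vectors $f(i),\dots,f(j)\in\mathbb{R}^q$ with $i\leq j$, write $f_{[i,j]}=[f(i)\ \cdots\ f(j)]$, and for $0\leq k\leq j-i$ let $$H_k(f_{[i,j]})=\begin{bmatrix} f(i)&\cdots&f(j-k)\\ \vdots&&\vdots\\ f(i+k)&\cdots&f(j)\end{bmatrix}.$$ For $k\in[0,t-1]$ let $H_{k,t}=\begin{bmatrix}H_k(y_{[0,t-1]})\\ H_k(u_{[0,t-1]})\end{bmatrix}$, and for $1\leq k\leq t-1$ let $G_{k,t}=\begin{bmatrix}H_{k-1}(y_{[0,t-2]})\\ H_k(u_{[0,t-1]})\end{bmatrix}$. Explaining systems. A system with $n$ states explains $(u_{[0,t-1]},y_{[0,t-1]})$ if there exist $x(0),\dots,x(t)\in\mathbb{R}^n$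 with $x(s+1)=Ax(s)+Bu(s)$ and $y(s)=Cx(s)+Du(s)$ for all $s\in[0,t-1]$. Let $\mathcal{E}_t$ be the set of all explaining systems, $\mathcal{E}_t(\ell,n)=\mathcal{E}_t\cap\mathcal{S}(\ell,n)$ and $\mathcal{E}_t(n)=\mathcal{E}_t\cap\mathcal{S}(n)$. Define $$\ell_{\mathrm{min},t}=\min\{\ell\geq0\mid \mathcal{E}_t(\ell,n)\neq\emptyset\text{ for some }n\geq0\},\qquad n_{\mathrm{min},t}=\min\{n\geq0\mid\mathcal{E}_t(n)\neq\emptyset\},$$ $$L_t^a=\min(L,\,N-n_{\mathrm{min},t}+\ell_{\mathrm{min},t}).$$ Informativity. The data $(u_{[0,t-1]},y_{[0,t-1]})$ are informative for system identification if (i) $\mathcal{E}_t\cap\mathcal{M}\cap\mathcal{S}_{L,N}=\mathcal{E}_t(n_{\mathrm{true}})\cap\mathcal{M}\cap\mathcal{S}_{L,N}$, and (ii) $\mathcal{E}_t\cap\mathcal{M}\cap\mathcal{S}_{L,N}$ has the isomorphism property. Sets $\mathcal{A}_t$. A set $\mathcal{A}\subseteq\mathbb{R}^m$ is affine of dimension $d$ if $\mathcal{A}=\{x\}+\mathcal{S}$ with $x\in\mathbb{R}^m$ and $\mathcal{S}$ a $d$-dimensional subspace. Whenever $t\geq2$, $1\leq k\leq t-1$ and $\operatorname{rank}G_{k,t}<m+\operatorname{rank}H_{k-1,t}$, $\mathcal{A}_t\subseteq\mathbb{R}^m$ denotes an $(m-1)$-dimensional affine set such that $\operatorname{rank}H_{k,t+1}=\operatorname{rank}H_{k,t}+1$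 whenever $u(t)\notin\mathcal{A}_t$ (such a set exists under these conditions). Procedure OnlineExperiment$(L,N)$: 1. Choose $u_{[0,m-1]}\in\mathbb{R}^{m\times m}$ nonsingular, apply these inputs and measure $y_{[0,m-1]}$. Set $t\gets m$, $k\gets0$. 2. While $k\neq L_t^a$ do: (i) set $k\gets k+1$; (ii) if $t=k$, choose $u(t)\in\mathbb{R}^m$ arbitrarily, measure $y(t)$, and set $t\gets t+1$; (iii) while $\operatorname{rank}G_{k,t}<m+\operatorname{rank}H_{k-1,t}$: choose any $u(t)\notin\mathcal{A}_t$, measure $y(t)$, and set $t\gets t+1$. 3. Return $(u_{[0,t-1]},y_{[0,t-1]})$. The procedure allows arbitrary choices subject to the stated constraints, and the theorem concerns every execution. *)

theory Defs
  imports "Jordan_Normal_Form.DL_Rank"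
begin

text \<open>The number of states is not a component of the tuple: it is \<open>dim_row A\<close>, and the dimensions
  \<open>m\<close>, \<open>p\<close> of inputs and outputs are explicit parameters below.\<close>

type_synonym lin_system = "real mat \<times> real mat \<times> real mat \<times> real mat"

definition mat_rank :: "real mat \<Rightarrow> nat" where
  "mat_rank M = vec_space.rank (dim_row M) M"

text \<open>Index shift: \<open>obs_mat C A k\<close> has the \<open>k\<close> block rows \<open>C, CA, \<dots>, CA^(k-1)\<close>,
  i.e. it is the matrix usually written \<open>\<Omega>\<close> with index \<open>k - 1\<close>.\<close>

fun obs_mat :: "real mat \<Rightarrow> real mat \<Rightarrow> nat \<Rightarrow> real mat" where
  "obs_mat C A 0 = 0\<^sub>m 0 (dim_col C)"
| "obs_mat C A (Suc k) = obs_mat C A k @\<^sub>r (C * (A ^\<^sub>m k))"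

text \<open>\<open>[B, AB, \<dots>, A^(k-1)B]\<close>; the four-block matrix with lower blocks of height \<open>0\<close> is
  the juxtaposition of the upper ones.\<close>

fun ctrb_mat :: "real mat \<Rightarrow> real mat \<Rightarrow> nat \<Rightarrow> real mat" where
  "ctrb_mat A B 0 = 0\<^sub>m (dim_row B) 0"
| "ctrb_mat A B (Suc k) =
     four_block_mat (ctrb_mat A B k) (A ^\<^sub>m k * B)
       (0\<^sub>m 0 (dim_col (ctrb_mat A B k))) (0\<^sub>m 0 (dim_col B))"

definition lag :: "real mat \<Rightarrow> real mat \<Rightarrow> nat" where
  "lag C A = (LEAST k. mat_rank (obs_mat C A (Suc k)) = mat_rank (obs_mat C A k))"

definition controllable :: "real mat \<Rightarrow> real mat \<Rightarrow> bool" where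
  "controllable A B \<longleftrightarrow> mat_rank (ctrb_mat A B (dim_row A)) = dim_row A"

definition observable :: "real mat \<Rightarrow> real mat \<Rightarrow> bool" where
  "observable C A \<longleftrightarrow> mat_rank (obs_mat C A (dim_row A)) = dim_row A"

definition systems_lag :: "nat \<Rightarrow> nat \<Rightarrow> nat \<Rightarrow> nat \<Rightarrow> lin_system set" where
  "systems_lag m p l n = {(A, B, C, D).
     A \<in> carrier_mat n n \<and> B \<in> carrier_mat n m \<and> C \<in> carrier_mat p n \<and> D \<in> carrier_mat p m \<and>
     lag C A = l}"

definition systems :: "nat \<Rightarrow> nat \<Rightarrow> nat \<Rightarrow> lin_system set" where
  "systems m p n = (\<Union>l\<in>{0..n}. systems_lag m p l n)"

definition minimal_systems :: "nat \<Rightarrow> nat \<Rightarrow> lin_system set" where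
  "minimal_systems m p =
     {(A, B, C, D). (\<exists>n. (A, B, C, D) \<in> systems m p n) \<and> controllable A B \<and> observable C A}"

definition bounded_systems :: "nat \<Rightarrow> nat \<Rightarrow> nat \<Rightarrow> nat \<Rightarrow> lin_system set" where
  "bounded_systems m p L N = (\<Union>l\<in>{0..L}. \<Union>n\<in>{0..N}. systems_lag m p l n)"

fun isomorphic_systems :: "nat \<Rightarrow> lin_system \<Rightarrow> lin_system \<Rightarrow> bool" where
  "isomorphic_systems n (A1, B1, C1, D1) (A2, B2, C2, D2) \<longleftrightarrow>
     D1 = D2 \<and>
     (\<exists>S\<in>carrier_mat n n. \<exists>Si\<in>carrier_mat n n. inverts_mat S Si \<and> inverts_mat Si S \<and>
        A1 = Si * A2 * S \<and> B1 = Si * B2 \<and> C1 = C2 * S)"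

definition isomorphism_property :: "nat \<Rightarrow> nat \<Rightarrow> lin_system set \<Rightarrow> bool" where
  "isomorphism_property m p X \<longleftrightarrow>
     (\<exists>n. X \<subseteq> systems m p n \<and> (\<forall>s1\<in>X. \<forall>s2\<in>X. isomorphic_systems n s1 s2))"

text \<open>Input-output data of length \<open>t\<close> are two lists \<open>us\<close>, \<open>ys\<close> of length \<open>t\<close>.\<close>

text \<open>For \<open>k \<le> j - i\<close>, the matrix of a signal with values in dimension \<open>q\<close> with
  block \<open>(a, c)\<close> equal to \<open>f (i + a + c)\<close>, for \<open>a \<le> k\<close> and \<open>c \<le> j - k - i\<close>.\<close>

definition hankel :: "nat \<Rightarrow> nat \<Rightarrow> (nat \<Rightarrow> real vec) \<Rightarrow> nat \<Rightarrow> nat \<Rightarrow> real mat" where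
  "hankel q k f i j =
     mat ((k + 1) * q) (j - k - i + 1) (\<lambda>(r, c). f (i + r div q + c) $ (r mod q))"

definition H_mat :: "nat \<Rightarrow> nat \<Rightarrow> nat \<Rightarrow> real vec list \<Rightarrow> real vec list \<Rightarrow> real mat" where
  "H_mat m p k us ys =
     (let t = length us in hankel p k ((!) ys) 0 (t - 1) @\<^sub>r hankel m k ((!) us) 0 (t - 1))"

definition G_mat :: "nat \<Rightarrow> nat \<Rightarrow> nat \<Rightarrow> real vec list \<Rightarrow> real vec list \<Rightarrow> real mat" where
  "G_mat m p k us ys =
     (let t = length us in hankel p (k - 1) ((!) ys) 0 (t - 2) @\<^sub>r hankel m k ((!) us) 0 (t - 1))"

definition explaining :: "nat \<Rightarrow> nat \<Rightarrow> real vec list \<Rightarrow> real vec list \<Rightarrow> lin_system set" where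
  "explaining m p us ys = {(A, B, C, D). \<exists>n. (A, B, C, D) \<in> systems m p n \<and>
     (\<exists>x. (\<forall>s\<le>length us. x s \<in> carrier_vec n) \<and>
       (\<forall>s<length us. x (Suc s) = A *\<^sub>v x s + B *\<^sub>v (us ! s) \<and>
                      ys ! s = C *\<^sub>v x s + D *\<^sub>v (us ! s)))}"

definition l_min :: "nat \<Rightarrow> nat \<Rightarrow> real vec list \<Rightarrow> real vec list \<Rightarrow> nat" where
  "l_min m p us ys = (LEAST l. \<exists>n. explaining m p us ys \<inter> systems_lag m p l n \<noteq> {})"

definition n_min :: "nat \<Rightarrow> nat \<Rightarrow> real vec list \<Rightarrow> real vec list \<Rightarrow> nat" where
  "n_min m p us ys = (LEAST n. explaining m p us ys \<inter> systems m p n \<noteq> {})"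

definition L_act :: "nat \<Rightarrow> nat \<Rightarrow> nat \<Rightarrow> nat \<Rightarrow> real vec list \<Rightarrow> real vec list \<Rightarrow> int" where
  "L_act m p L N us ys = min (int L) (int N - int (n_min m p us ys) + int (l_min m p us ys))"

definition informative ::
  "nat \<Rightarrow> nat \<Rightarrow> nat \<Rightarrow> nat \<Rightarrow> nat \<Rightarrow> real vec list \<Rightarrow> real vec list \<Rightarrow> bool" where
  "informative m p L N n_true us ys \<longleftrightarrow>
     (let E = explaining m p us ys; M = minimal_systems m p; S = bounded_systems m p L N in
        E \<inter> M \<inter> S = (E \<inter> systems m p n_true) \<inter> M \<inter> S \<and>
        isomorphism_property m p (E \<inter> M \<inter> S))"

fun state_at :: "lin_system \<Rightarrow> real vec \<Rightarrow> real vec list \<Rightarrow> nat \<Rightarrow> real vec" where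
  "state_at (A, B, C, D) x0 us 0 = x0"
| "state_at (A, B, C, D) x0 us (Suc s) = A *\<^sub>v state_at (A, B, C, D) x0 us s + B *\<^sub>v (us ! s)"

fun output_at :: "lin_system \<Rightarrow> real vec \<Rightarrow> real vec list \<Rightarrow> nat \<Rightarrow> real vec" where
  "output_at (A, B, C, D) x0 us s = C *\<^sub>v state_at (A, B, C, D) x0 us s + D *\<^sub>v (us ! s)"

text \<open>The output measured at time \<open>length us\<close> when \<open>v\<close> is applied after the inputs \<open>us\<close>.\<close>

definition measured :: "lin_system \<Rightarrow> real vec \<Rightarrow> real vec list \<Rightarrow> real vec \<Rightarrow> real vec" where
  "measured sys x0 us v = output_at sys x0 (us @ [v]) (length us)"

definition affine_of_dim :: "nat \<Rightarrow> nat \<Rightarrow> real vec set \<Rightarrow> bool" where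
  "affine_of_dim m d X \<longleftrightarrow>
     (\<exists>x\<in>carrier_vec m. \<exists>W. subspace class_ring W (module_vec TYPE(real) m) \<and>
        vectorspace.dim class_ring ((module_vec TYPE(real) m)\<lparr>carrier := W\<rparr>) = d \<and>
        X = {x + w |w. w \<in> W})"

text \<open>The exceptional sets are only determined up to choice; this predicate collects all
  admissible ones for the data collected so far.\<close>

definition exceptional_set ::
  "nat \<Rightarrow> nat \<Rightarrow> lin_system \<Rightarrow> real vec \<Rightarrow> nat \<Rightarrow> real vec list \<Rightarrow> real vec list \<Rightarrow> real vec set \<Rightarrow> bool"
where
  "exceptional_set m p sys x0 k us ys X \<longleftrightarrow>
     affine_of_dim m (m - 1) X \<and>
     (\<forall>v\<in>carrier_vec m. v \<notin> X \<longrightarrow>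
        mat_rank (H_mat m p k (us @ [v]) (ys @ [measured sys x0 us v])) =
        mat_rank (H_mat m p k us ys) + 1)"

text \<open>\<open>Outer k us ys\<close>: about to test the guard of the outer loop;
  \<open>Inner k us ys\<close>: about to test the guard of the inner loop.
  The time \<open>t\<close> is \<open>length us\<close> throughout.\<close>

datatype config =
    Start
  | Outer nat "real vec list" "real vec list"
  | Inner nat "real vec list" "real vec list"
  | Returned "real vec list" "real vec list"

inductive oe_step ::
  "nat \<Rightarrow> nat \<Rightarrow> nat \<Rightarrow> nat \<Rightarrow> lin_system \<Rightarrow> real vec \<Rightarrow> config \<Rightarrow> config \<Rightarrow> bool"
  for m p L N :: nat and sys :: lin_system and x0 :: "real vec" where
  init:
    "\<lbrakk>length us = m; set us \<subseteq> carrier_vec m; invertible_mat (mat_of_cols m us)\<rbrakk> \<Longrightarrow>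
     oe_step m p L N sys x0 Start (Outer 0 us (map (output_at sys x0 us) [0..<m]))"
| ret:
    "int k = L_act m p L N us ys \<Longrightarrow>
     oe_step m p L N sys x0 (Outer k us ys) (Returned us ys)"
| enter_extend:
    "\<lbrakk>int k \<noteq> L_act m p L N us ys; length us = k + 1; v \<in> carrier_vec m\<rbrakk> \<Longrightarrow>
     oe_step m p L N sys x0 (Outer k us ys)
       (Inner (k + 1) (us @ [v]) (ys @ [measured sys x0 us v]))"
| enter:
    "\<lbrakk>int k \<noteq> L_act m p L N us ys; length us \<noteq> k + 1\<rbrakk> \<Longrightarrow>
     oe_step m p L N sys x0 (Outer k us ys) (Inner (k + 1) us ys)"
| extend:
    "\<lbrakk>mat_rank (G_mat m p k us ys) < m + mat_rank (H_mat m p (k - 1) us ys);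
      exceptional_set m p sys x0 k us ys X; v \<in> carrier_vec m; v \<notin> X\<rbrakk> \<Longrightarrow>
     oe_step m p L N sys x0 (Inner k us ys)
       (Inner k (us @ [v]) (ys @ [measured sys x0 us v]))"
| leave:
    "\<not> mat_rank (G_mat m p k us ys) < m + mat_rank (H_mat m p (k - 1) us ys) \<Longrightarrow>
     oe_step m p L N sys x0 (Inner k us ys) (Outer k us ys)"

end

theory Submission
  imports Defs "Jordan_Normal_Form.Matrix_Kernel"
begin

text \<open>Every combination of columns of a Hankel matrix of the data is again a piece of trajectory of every
system that explains the data, because systems are linear and time-invariant. The proof therefore
argues about such superposed windows. The
exit test of the inner loop at depth \<open>k\<close> says exactly that every superposed window of length \<open>k\<close> can be
prolonged, inside the span of the data, by any prescribed next input (\<open>saturated_if_rank\<close>); the data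
are then called saturated at depth \<open>k\<close>.

Suppose the data are saturated at depth \<open>k\<close> and let a minimal explaining system have lag at most \<open>k\<close>.
Its state at the start of a window is a function of the window, so prolonging a window and dropping
its first entry moves the system along a trajectory of our choice. Starting at rest and using
controllability, all combinations of states and inputs occur among the superposed windows
(\<open>saturated_full\<close>). Hence the Hankel matrix of depth \<open>k\<close> has rank \<open>(k + 1) m + n\<close> (\<open>rank_H_mat_eq\<close>),
any two such systems are isomorphic (\<open>isomorphic_if_saturated\<close>), and every explaining system
with \<open>n'\<close> states and lag \<open>l'\<close> satisfies \<open>n + l' \<le> n' + l\<close> (\<open>lag_excess_le\<close>). By the last inequality all
minimal competitors within the bounds \<open>L\<close>, \<open>N\<close> have lag at most \<open>min L (N - n + l)\<close>, so at that depth they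
have the order of the true system and are isomorphic to it: the data are informative.

The outer loop stops exactly at that depth. Once \<open>k\<close> has reached the true lag \<open>l\<close>, the minimal order and
the minimal lag that the data allow are the true ones. While \<open>k < l\<close>, the computed depth exceeds \<open>k\<close>: either
some superposed windows have the same past and present input but different outputs, and then no explaining
system has lag at most \<open>k\<close>; or outputs are determined by the past from some depth \<open>q \<le> k\<close> on, and then the data have
a realisation whose order is the rank of \<open>q\<close> block rows of the true observability matrix (\<open>realization\<close>).
This rank grows by at least one per further block row up to the lag, so the order drops at least as
much as the lag does (\<open>L_act_greater_if_less_lag\<close>).

The length is obtained by counting. The columns of the Hankel matrix of the current depth stay linearly
independent throughout: entering a greater depth adds rows and at most drops a column, and in the inner
loop every input raises the rank by one. So \<open>t - k\<close> equals a rank that is at most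
\<open>(k + 1) m + n\<close>, which bounds the run, and equality holds at the end. A run never gets stuck: if the data
are not saturated, some linear relation holds for all old columns and fails for the new
column unless the next input lies on a hyperplane (\<open>exceptional_set_exists\<close>).\<close>

section \<open>Rank factorisation of real matrices\<close>

lemma mult_mat_vec_assoc:
  assumes "dim_col A = dim_row B" "dim_col B = dim_vec v"
  shows "(A * B) *\<^sub>v v = A *\<^sub>v (B *\<^sub>v v :: real vec)"
  using assms by (intro assoc_mult_mat_vec[of _ "dim_row A" "dim_row B" _ "dim_col B"]) (auto intro: carrier_matI carrier_vecI)

lemma mult_unit_vec:
  "(A :: real mat) \<in> carrier_mat a b \<Longrightarrow> i < b \<Longrightarrow> A *\<^sub>v unit_vec b i = col A i"
  by (intro eq_vecI) (auto simp: scalar_prod_right_unit)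

lemma mult_zero_vec: "dim_col (A :: real mat) = b \<Longrightarrow> A *\<^sub>v 0\<^sub>v b = 0\<^sub>v (dim_row A)"
  by (intro eq_vecI) auto

lemma eq_if_minus_eq_zero:
  fixes x y :: "real vec"
  assumes "x \<in> carrier_vec a" "y \<in> carrier_vec a" "x - y = 0\<^sub>v a"
  shows "x = y"
proof (rule eq_vecI)
  fix i assume "i < dim_vec y"
  hence i: "i < a" using assms by simp
  have "(x - y) $ i = x $ i - y $ i" using i assms(2) by simp
  hence "x $ i - y $ i = 0" using i by (simp only: assms(3) index_zero_vec)
  thus "x $ i = y $ i" by simp
qed (use assms in auto)

lemma mat_eq_if_vec_eq:
  fixes A B :: "real mat"
  assumes A: "A \<in> carrier_mat a b" and B: "B \<in> carrier_mat a b"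
    and eq: "\<And>v. v \<in> carrier_vec b \<Longrightarrow> A *\<^sub>v v = B *\<^sub>v v"
  shows "A = B"
proof (rule mat_col_eqI)
  fix i assume "i < dim_col B"
  hence i: "i < b" using B by auto
  have "A *\<^sub>v unit_vec b i = B *\<^sub>v unit_vec b i" by (rule eq) simp
  thus "col A i = col B i" using A B i by (simp add: mult_unit_vec)
qed (use A B in auto)

lemma exists_preimages:
  fixes M N :: "real mat"
  assumes M: "M \<in> carrier_mat a b" and N: "N \<in> carrier_mat a c"
    and ex: "\<And>i. i < c \<Longrightarrow> \<exists>x\<in>carrier_vec b. M *\<^sub>v x = col N i"
  shows "\<exists>Y\<in>carrier_mat b c. N = M * Y"
proof -
  from ex obtain x where x: "\<And>i. i < c \<Longrightarrow> x i \<in> carrier_vec b" "\<And>i. i < c \<Longrightarrow> M *\<^sub>v x i = col N i"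
    by metis
  let ?Y = "mat_of_cols b (map x [0..<c])"
  have Y: "?Y \<in> carrier_mat b c" by (metis diff_zero length_map length_upt mat_of_cols_carrier(1))
  have "N = M * ?Y"
  proof (rule mat_col_eqI)
    fix i assume "i < dim_col (M * ?Y)"
    hence i: "i < c" using Y by simp
    have "col ?Y i = x i" using i x(1)[OF i] by (subst col_mat_of_cols) auto
    thus "col N i = col (M * ?Y) i" using col_mult2[OF M Y i] x(2)[OF i] by simp
  qed (use M N Y in auto)
  with Y show ?thesis by blast
qed

text \<open>Over the reals the Gram matrix of linearly independent columns is invertible, so \<open>inverse (transpose E * E) * transpose E\<close> is
a left inverse.\<close>

lemma left_inverse_of_injective:
  fixes E :: "real mat"
  assumes E: "E \<in> carrier_mat a r"
    and inj: "\<And>v. v \<in> carrier_vec r \<Longrightarrow> E *\<^sub>v v = 0\<^sub>v a \<Longrightarrow> v = 0\<^sub>v r"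
  shows "\<exists>F \<in> carrier_mat r a. F * E = 1\<^sub>m r"
proof -
  let ?G = "E\<^sup>T * E"
  have G: "?G \<in> carrier_mat r r" using E by auto
  have "det ?G \<noteq> 0"
  proof
    assume "det ?G = 0"
    then obtain v where v: "v \<in> carrier_vec r" "v \<noteq> 0\<^sub>v r" "?G *\<^sub>v v = 0\<^sub>v r"
      using det_0_iff_vec_prod_zero[OF G] by auto
    have Ev: "E *\<^sub>v v \<in> carrier_vec a" using E v by auto
    have "(E *\<^sub>v v) \<bullet> (E *\<^sub>v v) = (E\<^sup>T *\<^sub>v (E *\<^sub>v v)) \<bullet> v"
      using transpose_vec_mult_scalar[OF E v(1) Ev] by simp
    also have "E\<^sup>T *\<^sub>v (E *\<^sub>v v) = 0\<^sub>v r" using v E by (simp add: mult_mat_vec_assoc)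
    finally have "(E *\<^sub>v v) \<bullet> (E *\<^sub>v v) = 0" using v by simp
    hence "E *\<^sub>v v = 0\<^sub>v a" using conjugate_square_eq_0_vec[OF Ev] by simp
    with inj v show False by auto
  qed
  then obtain H where H: "H \<in> carrier_mat r r" "H * ?G = 1\<^sub>m r"
    using det_non_zero_imp_unit[OF G, of "()"] unfolding Units_def ring_mat_def by auto
  have "(H * E\<^sup>T) * E = 1\<^sub>m r" using H E by (simp add: assoc_mult_mat[of _ r r _ a _ r])
  moreover have "H * E\<^sup>T \<in> carrier_mat r a" using H E by auto
  ultimately show ?thesis by blast
qed

text \<open>\<open>M = E (F M)\<close> with \<open>F E = 1\<close> and \<open>E = M J\<close>: the columns of \<open>E\<close> are a basis of the column space, \<open>F\<close> reads off
coordinates and \<open>J\<close> selects the basis among the columns of \<open>M\<close>. All facts about ranks below reduce to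
products of such matrices, which avoids dimension arguments about subspaces.\<close>

definition rank_factors :: "nat \<Rightarrow> nat \<Rightarrow> real mat \<Rightarrow> real mat \<Rightarrow> real mat \<Rightarrow> real mat \<Rightarrow> bool" where
  "rank_factors a b M E F J \<longleftrightarrow>
     E \<in> carrier_mat a (mat_rank M) \<and> F \<in> carrier_mat (mat_rank M) a \<and> J \<in> carrier_mat b (mat_rank M) \<and>
     (\<forall>v\<in>carrier_vec (mat_rank M). F *\<^sub>v (E *\<^sub>v v) = v \<and> M *\<^sub>v (J *\<^sub>v v) = E *\<^sub>v v) \<and>
     (\<forall>v\<in>carrier_vec b. E *\<^sub>v (F *\<^sub>v (M *\<^sub>v v)) = M *\<^sub>v v)"

lemma rank_factorsD:
  assumes "rank_factors a b M E F J"
  shows "E \<in> carrier_mat a (mat_rank M)" "F \<in> carrier_mat (mat_rank M) a" "J \<in> carrier_mat b (mat_rank M)"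
    "\<And>v. v \<in> carrier_vec (mat_rank M) \<Longrightarrow> F *\<^sub>v (E *\<^sub>v v) = v"
    "\<And>v. v \<in> carrier_vec b \<Longrightarrow> E *\<^sub>v (F *\<^sub>v (M *\<^sub>v v)) = M *\<^sub>v v"
    "\<And>v. v \<in> carrier_vec (mat_rank M) \<Longrightarrow> M *\<^sub>v (J *\<^sub>v v) = E *\<^sub>v v"
  using assms unfolding rank_factors_def by auto

text \<open>The basis is a maximal linearly independent set of columns.\<close>

lemma rank_factorization:
  fixes M :: "real mat"
  assumes M: "M \<in> carrier_mat a b"
  obtains E F J where "rank_factors a b M E F J"
proof -
  interpret vec_space "TYPE(real)" a .
  have cM: "set (cols M) \<subseteq> carrier_vec a" using M cols_dim[of M] by simp
  obtain S where S: "finite S" "maximal S (\<lambda>T. T \<subseteq> set (cols M) \<and> lin_indpt T)"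
    using maximal_exists_superset[of "set (cols M)" "\<lambda>T. T \<subseteq> set (cols M) \<and> lin_indpt T" "{}"]
      finite_lin_indpt2[of "{}"] by auto
  have r: "mat_rank M = card S"
    using rank_card_indpt[OF M S(2)] M by (simp add: mat_rank_def)
  from S(2) have SM: "S \<subseteq> set (cols M)" and li: "lin_indpt S"
    and mx: "\<And>B. S \<subseteq> B \<Longrightarrow> B \<subseteq> set (cols M) \<Longrightarrow> lin_indpt B \<Longrightarrow> B = S"
    by (auto simp: maximal_def)
  obtain es where es: "set es = S" "distinct es" using finite_distinct_list[OF S(1)] by auto
  have len: "length es = mat_rank M" using r es distinct_card by metis
  define E where "E = mat_of_cols a es"
  have E: "E \<in> carrier_mat a (mat_rank M)" unfolding E_def using mat_of_cols_carrier(1)[of a es] len by simp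
  have cE: "cols E = es" unfolding E_def using es SM cM by (intro cols_mat_of_cols) auto
  have Sc: "S \<subseteq> carrier_vec a" using SM cM by auto
  have inj: "v = 0\<^sub>v (mat_rank M)" if "v \<in> carrier_vec (mat_rank M)" "E *\<^sub>v v = 0\<^sub>v a" for v
    using lin_depI[OF E that(1) _ that(2)] li cE es by auto
  obtain F where F: "F \<in> carrier_mat (mat_rank M) a" "F * E = 1\<^sub>m (mat_rank M)"
    using left_inverse_of_injective[OF E inj] by auto
  have "\<exists>x\<in>carrier_vec b. M *\<^sub>v x = col E i" if i: "i < mat_rank M" for i
  proof -
    have "col E i = es ! i" using cE i E by (metis carrier_matD(2) cols_nth)
    hence "col E i \<in> set (cols M)" using es SM i len by (metis nth_mem subsetD)
    then obtain j where j: "j < b" "col E i = col M j"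
      using M by (auto simp: cols_def)
    have "M *\<^sub>v unit_vec b j = col M j" using M j by (simp add: mult_unit_vec)
    thus ?thesis using j by (intro bexI[of _ "unit_vec b j"]) auto
  qed
  then obtain J where J: "J \<in> carrier_mat b (mat_rank M)" "E = M * J"
    using exists_preimages[OF M E] by blast
  have "\<exists>x\<in>carrier_vec (mat_rank M). E *\<^sub>v x = col M i" if i: "i < b" for i
  proof -
    have cin: "col M i \<in> set (cols M)" using i M by (auto simp: cols_def)
    have "col M i \<in> span S"
    proof (cases "col M i \<in> S")
      case True thus ?thesis using in_own_span[OF Sc] by auto
    next
      case False
      hence "lin_dep (S \<union> {col M i})" using mx[of "S \<union> {col M i}"] cin SM by auto
      thus ?thesis using lin_dep_iff_in_span[OF Sc li _ False] cin cM by auto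
    qed
    hence "col M i \<in> col_space E" unfolding col_space_def cE es .
    thus ?thesis unfolding col_space_eq[OF E] using E by auto
  qed
  then obtain K where K: "K \<in> carrier_mat (mat_rank M) b" "M = E * K"
    using exists_preimages[OF E M] by blast
  have FE: "F *\<^sub>v (E *\<^sub>v v) = v" if "v \<in> carrier_vec (mat_rank M)" for v
  proof -
    have "F *\<^sub>v (E *\<^sub>v v) = (F * E) *\<^sub>v v" using F(1) E that by (simp add: mult_mat_vec_assoc)
    thus ?thesis using F(2) that by simp
  qed
  have MK: "M *\<^sub>v v = E *\<^sub>v (K *\<^sub>v v)" if "v \<in> carrier_vec b" for v
    using K(1) E that by (subst K(2)) (simp add: mult_mat_vec_assoc)
  have EFM: "E *\<^sub>v (F *\<^sub>v (M *\<^sub>v v)) = M *\<^sub>v v" if "v \<in> carrier_vec b" for v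
    using FE[of "K *\<^sub>v v"] K(1) that by (simp add: MK)
  have "M *\<^sub>v (J *\<^sub>v v) = E *\<^sub>v v" if "v \<in> carrier_vec (mat_rank M)" for v
    using J(1) M that by (subst J(2)) (simp add: mult_mat_vec_assoc)
  thus thesis using that E F(1) J(1) FE EFM unfolding rank_factors_def by blast
qed

text \<open>If \<open>c < r\<close>, appending zero rows to \<open>Y\<close> gives a square singular matrix, so \<open>Y\<close> annihilates a nonzero vector,
which \<open>X\<close> cannot recover.\<close>

lemma inverse_pair_dim:
  fixes X Y :: "real mat"
  assumes X: "X \<in> carrier_mat r c" and Y: "Y \<in> carrier_mat c r"
    and XY: "\<And>v. v \<in> carrier_vec r \<Longrightarrow> X *\<^sub>v (Y *\<^sub>v v) = v"
  shows "r \<le> c" and "r = c \<Longrightarrow> v \<in> carrier_vec c \<Longrightarrow> Y *\<^sub>v (X *\<^sub>v v) = v"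
proof -
  show "r \<le> c"
  proof (rule ccontr)
    assume "\<not> r \<le> c"
    hence cr: "c < r" by simp
    \<comment> \<open>Zero rows are appended to make the matrix square.\<close>
    define W where "W = Y @\<^sub>r 0\<^sub>m (r - c) r"
    have W: "W \<in> carrier_mat r r" using carrier_append_rows[OF Y, of "0\<^sub>m (r-c) r" "r-c"] cr unfolding W_def by simp
    have last: "W $$ (r - 1, j) = 0" if "j < r" for j
      using that cr Y by (simp add: append_rows_def W_def)
    have Weq: "W = mat\<^sub>r r r (\<lambda>i. if i = r - 1 then 0\<^sub>v r else row W i)"
    proof (rule eq_matI, goal_cases)
      case (1 i j)
      thus ?case using W last[of j] by (cases "i = r - 1") simp_all
    qed (use W in simp_all)
    have "det (mat\<^sub>r r r (\<lambda>i. if i = r - 1 then 0\<^sub>v r else row W i)) = 0"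
      by (rule det_row_0) (use W cr in auto)
    hence "det W = 0" using arg_cong[OF Weq, of det] by metis
    then obtain v where v: "v \<in> carrier_vec r" "v \<noteq> 0\<^sub>v r" "W *\<^sub>v v = 0\<^sub>v r"
      using det_0_iff_vec_prod_zero[OF W] by auto
    have "W *\<^sub>v v = (Y *\<^sub>v v) @\<^sub>v (0\<^sub>m (r - c) r *\<^sub>v v)"
      unfolding W_def by (rule mat_mult_append[OF Y _ v(1)]) auto
    moreover have "0\<^sub>v r = 0\<^sub>v c @\<^sub>v (0\<^sub>v (r - c) :: real vec)" using cr by (intro eq_vecI) auto
    ultimately have eq: "(Y *\<^sub>v v) @\<^sub>v (0\<^sub>m (r - c) r *\<^sub>v v) = 0\<^sub>v c @\<^sub>v 0\<^sub>v (r - c)" using v(3) by simp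
    have "Y *\<^sub>v v = 0\<^sub>v c"
      using eq append_vec_eq[of "Y *\<^sub>v v" c "0\<^sub>v c"] Y v(1) by simp
    hence "v = X *\<^sub>v 0\<^sub>v c" using XY[OF v(1)] by metis
    thus False using mult_zero_vec[of X c] X v(2) by auto
  qed
  assume rc: "r = c" and v: "v \<in> carrier_vec c"
  have "X * Y = 1\<^sub>m r"
    using X Y XY by (intro mat_eq_if_vec_eq[of _ r r]) (auto simp: mult_mat_vec_assoc)
  hence "Y * X = 1\<^sub>m r" using mat_mult_left_right_inverse[of X r Y] X Y rc by simp
  moreover have "Y *\<^sub>v (X *\<^sub>v v) = (Y * X) *\<^sub>v v" using X Y v by (simp add: mult_mat_vec_assoc)
  ultimately show "Y *\<^sub>v (X *\<^sub>v v) = v" using v rc by simp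
qed

lemma mat_rank_le_inner:
  fixes M :: "real mat"
  assumes M: "M \<in> carrier_mat a b" and P: "P \<in> carrier_mat a c" and Q: "Q \<in> carrier_mat c b"
    and eq: "\<And>v. v \<in> carrier_vec b \<Longrightarrow> M *\<^sub>v v = P *\<^sub>v (Q *\<^sub>v v)"
  shows "mat_rank M \<le> c"
proof -
  obtain E F J where "rank_factors a b M E F J"
    using rank_factorization[OF M] .
  note R = rank_factorsD[OF this]
  show ?thesis
  proof (rule inverse_pair_dim(1)[of "F * P" _ _ "Q * J"])
    show "F * P \<in> carrier_mat (mat_rank M) c" "Q * J \<in> carrier_mat c (mat_rank M)" using R P Q by auto
    fix v :: "real vec" assume v: "v \<in> carrier_vec (mat_rank M)"
    have "P *\<^sub>v (Q *\<^sub>v (J *\<^sub>v v)) = E *\<^sub>v v" using eq[of "J *\<^sub>v v"] R(3,6) v by simp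
    thus "(F * P) *\<^sub>v ((Q * J) *\<^sub>v v) = v" using R P Q v by (simp add: mult_mat_vec_assoc)
  qed
qed

lemma mat_rank_ge_inner:
  fixes M :: "real mat"
  assumes M: "M \<in> carrier_mat a b" and X: "X \<in> carrier_mat s a" and Y: "Y \<in> carrier_mat b s"
    and eq: "\<And>v. v \<in> carrier_vec s \<Longrightarrow> X *\<^sub>v (M *\<^sub>v (Y *\<^sub>v v)) = v"
  shows "s \<le> mat_rank M"
proof -
  obtain E F J where "rank_factors a b M E F J"
    using rank_factorization[OF M] .
  note R = rank_factorsD[OF this]
  show ?thesis
  proof (rule inverse_pair_dim(1)[of "X * E" _ _ "F * M * Y"])
    show "X * E \<in> carrier_mat s (mat_rank M)" "F * M * Y \<in> carrier_mat (mat_rank M) s" using R M X Y by auto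
    fix v :: "real vec" assume v: "v \<in> carrier_vec s"
    thus "(X * E) *\<^sub>v ((F * M * Y) *\<^sub>v v) = v"
      using R(1-3) R(5)[of "Y *\<^sub>v v"] M X Y eq[of v] by (simp add: mult_mat_vec_assoc)
  qed
qed

lemma mat_rank_le_cols: "(M :: real mat) \<in> carrier_mat a b \<Longrightarrow> mat_rank M \<le> b"
  by (rule mat_rank_le_inner[of M a b M b "1\<^sub>m b"]) auto

lemma mat_rank_le_rows: "(M :: real mat) \<in> carrier_mat a b \<Longrightarrow> mat_rank M \<le> a"
  by (rule mat_rank_le_inner[of M a b "1\<^sub>m a" a M]) auto

text \<open>A vector and its projection \<open>J F Q\<close> have the same image under \<open>Q\<close>, hence under \<open>M\<close>. This turns
an inclusion of kernels into a matrix identity, and is the source of all system matrices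
constructed below.\<close>

lemma factor_through_kernel:
  fixes M Q :: "real mat"
  assumes M: "M \<in> carrier_mat a b" and Q: "Q \<in> carrier_mat c b"
    and ker: "\<And>v. v \<in> carrier_vec b \<Longrightarrow> Q *\<^sub>v v = 0\<^sub>v c \<Longrightarrow> M *\<^sub>v v = 0\<^sub>v a"
  shows "\<exists>K\<in>carrier_mat a c. \<forall>v\<in>carrier_vec b. M *\<^sub>v v = K *\<^sub>v (Q *\<^sub>v v)" (is ?fac)
    and "mat_rank M \<le> mat_rank Q"
proof -
  obtain E F J where "rank_factors c b Q E F J"
    using rank_factorization[OF Q] .
  note R = rank_factorsD[OF this]
  have key: "M *\<^sub>v (J *\<^sub>v (F *\<^sub>v (Q *\<^sub>v v))) = M *\<^sub>v v" if v: "v \<in> carrier_vec b" for v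
  proof -
    define w where "w = J *\<^sub>v (F *\<^sub>v (Q *\<^sub>v v))"
    have FQ: "F *\<^sub>v (Q *\<^sub>v v) \<in> carrier_vec (mat_rank Q)" using R(2) Q v by auto
    have w: "w \<in> carrier_vec b" using FQ R(3) unfolding w_def by auto
    have Qw: "Q *\<^sub>v w = Q *\<^sub>v v" unfolding w_def R(6)[OF FQ] R(5)[OF v] ..
    have vw: "v - w \<in> carrier_vec b" using v w by simp
    have Qv: "Q *\<^sub>v v \<in> carrier_vec c" using Q v by simp
    have "Q *\<^sub>v (v - w) = 0\<^sub>v c"
      unfolding mult_minus_distrib_mat_vec[OF Q v w] Qw by (rule minus_cancel_vec[OF Qv])
    from ker[OF vw this] have "M *\<^sub>v v - M *\<^sub>v w = 0\<^sub>v a"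
      unfolding mult_minus_distrib_mat_vec[OF M v w] .
    hence "M *\<^sub>v v = M *\<^sub>v w"
      by (rule eq_if_minus_eq_zero[rotated 2]) (use M v w in auto)
    thus ?thesis unfolding w_def by (rule sym)
  qed
  show ?fac
  proof (intro bexI ballI)
    show "M * J * F \<in> carrier_mat a c" using R(1-3) M Q by auto
    show "M *\<^sub>v v = (M * J * F) *\<^sub>v (Q *\<^sub>v v)" if v: "v \<in> carrier_vec b" for v
      using R(2,3) M Q key[OF v] v by (simp add: mult_mat_vec_assoc)
  qed
  show "mat_rank M \<le> mat_rank Q"
  proof (rule mat_rank_le_inner[OF M])
    show "M * J \<in> carrier_mat a (mat_rank Q)" "F * Q \<in> carrier_mat (mat_rank Q) b" using R(2,3) M Q by auto
    show "M *\<^sub>v v = (M * J) *\<^sub>v ((F * Q) *\<^sub>v v)" if v: "v \<in> carrier_vec b" for v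
      using R(2,3) M Q key[OF v] v by (simp add: mult_mat_vec_assoc)
  qed
qed

lemma kernel_eq_if_rank_le:
  fixes M Q :: "real mat"
  assumes M: "M \<in> carrier_mat a b" and Q: "Q \<in> carrier_mat c b"
    and ker: "\<And>v. v \<in> carrier_vec b \<Longrightarrow> M *\<^sub>v v = 0\<^sub>v a \<Longrightarrow> Q *\<^sub>v v = 0\<^sub>v c"
    and rk: "mat_rank M \<le> mat_rank Q"
    and v: "v \<in> carrier_vec b" "Q *\<^sub>v v = 0\<^sub>v c"
  shows "M *\<^sub>v v = 0\<^sub>v a"
proof -
  obtain Z where Z: "Z \<in> carrier_mat c a" "\<And>v. v \<in> carrier_vec b \<Longrightarrow> Q *\<^sub>v v = Z *\<^sub>v (M *\<^sub>v v)"
    using factor_through_kernel(1)[OF Q M ker] by auto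
  obtain E F J where "rank_factors a b M E F J"
    using rank_factorization[OF M] .
  note R = rank_factorsD[OF this]
  obtain E' F' J' where "rank_factors c b Q E' F' J'"
    using rank_factorization[OF Q] .
  note R' = rank_factorsD[OF this]
  let ?X = "F' * Z * E" and ?Y = "F * M * J'"
  have X: "?X \<in> carrier_mat (mat_rank Q) (mat_rank M)" and Y: "?Y \<in> carrier_mat (mat_rank M) (mat_rank Q)"
    using R R' Z M by auto
  have XY: "?X *\<^sub>v (?Y *\<^sub>v w) = w" if w: "w \<in> carrier_vec (mat_rank Q)" for w
    using R(1-3) R(5)[of "J' *\<^sub>v w"] R'(1-3) R'(4,6)[OF w] Z(1) Z(2)[of "J' *\<^sub>v w"] M w
    by (simp add: mult_mat_vec_assoc)
  have eq: "mat_rank Q = mat_rank M" using inverse_pair_dim(1)[OF X Y XY] rk by simp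
  have Fv: "F *\<^sub>v (M *\<^sub>v v) \<in> carrier_vec (mat_rank M)" using R M v by auto
  have "?X *\<^sub>v (F *\<^sub>v (M *\<^sub>v v)) = F' *\<^sub>v (Q *\<^sub>v v)"
    using R(1-3) R(5)[of v] R'(1-3) Z(1) Z(2)[of v] M v by (simp add: mult_mat_vec_assoc)
  also have "\<dots> = 0\<^sub>v (mat_rank Q)" using v R'(2) by (simp add: mult_zero_vec)
  finally have "?Y *\<^sub>v 0\<^sub>v (mat_rank Q) = F *\<^sub>v (M *\<^sub>v v)"
    using inverse_pair_dim(2)[OF X Y XY eq Fv] by simp
  hence "F *\<^sub>v (M *\<^sub>v v) = 0\<^sub>v (mat_rank M)" using Y mult_zero_vec[of ?Y] by (metis carrier_matD)
  thus ?thesis using mult_zero_vec[of E] R(1) R(5)[OF v(1)] by simp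
qed

lemma image_eq_if_rank_le:
  fixes M G :: "real mat"
  assumes M: "M \<in> carrier_mat a b" and G: "G \<in> carrier_mat a c"
    and img: "\<And>v. v \<in> carrier_vec c \<Longrightarrow> \<exists>w\<in>carrier_vec b. M *\<^sub>v w = G *\<^sub>v v"
    and rk: "mat_rank M \<le> mat_rank G"
    and w: "w \<in> carrier_vec b"
  shows "\<exists>v\<in>carrier_vec c. G *\<^sub>v v = M *\<^sub>v w"
proof -
  have "\<exists>x\<in>carrier_vec b. M *\<^sub>v x = col G i" if "i < c" for i
    using img[of "unit_vec c i"] G that by (simp add: mult_unit_vec)
  then obtain Z where Z: "Z \<in> carrier_mat b c" "G = M * Z"
    using exists_preimages[OF M G] by blast
  have GZ: "G *\<^sub>v v = M *\<^sub>v (Z *\<^sub>v v)" if "v \<in> carrier_vec c" for v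
    using Z(1) M that by (subst Z(2)) (simp add: mult_mat_vec_assoc)
  obtain E F J where "rank_factors a b M E F J"
    using rank_factorization[OF M] .
  note R = rank_factorsD[OF this]
  obtain E' F' J' where "rank_factors a c G E' F' J'"
    using rank_factorization[OF G] .
  note R' = rank_factorsD[OF this]
  let ?X = "F' * E" and ?Y = "F * G * J'"
  have X: "?X \<in> carrier_mat (mat_rank G) (mat_rank M)" and Y: "?Y \<in> carrier_mat (mat_rank M) (mat_rank G)"
    using R R' G by auto
  have EFG: "E *\<^sub>v (F *\<^sub>v (G *\<^sub>v v)) = G *\<^sub>v v" if "v \<in> carrier_vec c" for v
    using R(5)[of "Z *\<^sub>v v"] Z(1) that by (simp add: GZ)
  have XY: "?X *\<^sub>v (?Y *\<^sub>v v) = v" if v: "v \<in> carrier_vec (mat_rank G)" for v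
    using R(1-3) EFG[of "J' *\<^sub>v v"] R'(1-3) R'(4,6)[OF v] G v
    by (simp add: mult_mat_vec_assoc)
  have eq: "mat_rank G = mat_rank M" using inverse_pair_dim(1)[OF X Y XY] rk by simp
  have Fw: "F *\<^sub>v (M *\<^sub>v w) \<in> carrier_vec (mat_rank M)" using R M w by auto
  let ?v = "J' *\<^sub>v (?X *\<^sub>v (F *\<^sub>v (M *\<^sub>v w)))"
  have v: "?v \<in> carrier_vec c" using R' X Fw by auto
  have "F *\<^sub>v (M *\<^sub>v w) = F *\<^sub>v (G *\<^sub>v ?v)"
    using inverse_pair_dim(2)[OF X Y XY eq Fw] R(1-3) R'(1-3) G Fw by (simp add: mult_mat_vec_assoc)
  hence "M *\<^sub>v w = G *\<^sub>v ?v" using EFG[OF v] R(5)[OF w] by simp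
  thus ?thesis using v by (intro bexI[of _ ?v]) simp_all
qed

text \<open>The functional is a row of the projection \<open>1 - E F\<close> along the column space of \<open>G\<close>; if all rows vanished on \<open>M\<close>, then
\<open>M\<close> would factor through \<open>E\<close>.\<close>

lemma separating_functional:
  fixes M G :: "real mat"
  assumes M: "M \<in> carrier_mat a b" and G: "G \<in> carrier_mat a c"
    and rk: "mat_rank G < mat_rank M"
  shows "\<exists>f\<in>carrier_vec a. (\<forall>v\<in>carrier_vec c. f \<bullet> (G *\<^sub>v v) = 0) \<and> (\<exists>w\<in>carrier_vec b. f \<bullet> (M *\<^sub>v w) \<noteq> 0)"
proof (rule ccontr)
  assume no: "\<not> ?thesis"
  obtain E F J where "rank_factors a c G E F J"
    using rank_factorization[OF G] .
  note R = rank_factorsD[OF this]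
  let ?P = "1\<^sub>m a - E * F"
  have P: "?P \<in> carrier_mat a a" using R by auto
  have Pv: "?P *\<^sub>v x = x - E *\<^sub>v (F *\<^sub>v x)" if "x \<in> carrier_vec a" for x
    using R that by (subst minus_mult_distrib_mat_vec[of _ a a]) (auto simp: mult_mat_vec_assoc)
  have idx: "row ?P i \<bullet> x = (x - E *\<^sub>v (F *\<^sub>v x)) $ i" if "i < a" "x \<in> carrier_vec a" for i x
    using Pv[OF that(2)] P that by (metis carrier_matD(1) index_mult_mat_vec)
  have "M *\<^sub>v w = E *\<^sub>v (F *\<^sub>v (M *\<^sub>v w))" if w: "w \<in> carrier_vec b" for w
  proof (rule eq_vecI)
    fix i assume "i < dim_vec (E *\<^sub>v (F *\<^sub>v (M *\<^sub>v w)))"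
    hence i: "i < a" using R by simp
    have Mw: "M *\<^sub>v w \<in> carrier_vec a" using M w by auto
    have "row ?P i \<bullet> (G *\<^sub>v v) = 0" if v: "v \<in> carrier_vec c" for v
      using idx[OF i, of "G *\<^sub>v v"] R(5)[OF v] G v i by simp
    moreover have "row ?P i \<in> carrier_vec a" using P i by auto
    ultimately have "row ?P i \<bullet> (M *\<^sub>v w) = 0" using no w by blast
    thus "(M *\<^sub>v w) $ i = (E *\<^sub>v (F *\<^sub>v (M *\<^sub>v w))) $ i" using idx[OF i Mw] R(1) i Mw by simp
  qed (use R M in auto)
  hence "mat_rank M \<le> mat_rank G"
    using R M by (intro mat_rank_le_inner[of M a b E _ "F * M"]) (auto simp: mult_mat_vec_assoc)
  thus False using rk by simp
qed

lemma mat_rank_eq_cols_iff_injective: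
  fixes M :: "real mat"
  assumes M: "M \<in> carrier_mat a b"
  shows "mat_rank M = b \<longleftrightarrow> (\<forall>v\<in>carrier_vec b. M *\<^sub>v v = 0\<^sub>v a \<longrightarrow> v = 0\<^sub>v b)"
proof
  have one: "mat_rank (1\<^sub>m b :: real mat) = b"
    using mat_rank_le_cols[of "1\<^sub>m b" b b] mat_rank_ge_inner[of "1\<^sub>m b" b b "1\<^sub>m b" b "1\<^sub>m b"] by auto
  {
    assume "mat_rank M = b"
    hence rk: "mat_rank (1\<^sub>m b :: real mat) \<le> mat_rank M" using one by simp
    show "\<forall>v\<in>carrier_vec b. M *\<^sub>v v = 0\<^sub>v a \<longrightarrow> v = 0\<^sub>v b"
    proof (intro ballI impI)
      fix v assume v: "v \<in> carrier_vec b" "M *\<^sub>v v = 0\<^sub>v a"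
      have "1\<^sub>m b *\<^sub>v v = 0\<^sub>v b"
        by (rule kernel_eq_if_rank_le[OF _ M _ rk v]) (use M mult_zero_vec in auto)
      thus "v = 0\<^sub>v b" using v by simp
    qed
  next
    assume inj: "\<forall>v\<in>carrier_vec b. M *\<^sub>v v = 0\<^sub>v a \<longrightarrow> v = 0\<^sub>v b"
    have "mat_rank (1\<^sub>m b :: real mat) \<le> mat_rank M"
      using inj M by (intro factor_through_kernel(2)[of _ b b _ a]) auto
    thus "mat_rank M = b" using one mat_rank_le_cols[OF M] by simp
  }
qed

lemma mat_rank_eq_rows_if_surjective:
  fixes M :: "real mat"
  assumes M: "M \<in> carrier_mat a b"
    and sur: "\<And>y. y \<in> carrier_vec a \<Longrightarrow> \<exists>x\<in>carrier_vec b. M *\<^sub>v x = y"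
  shows "mat_rank M = a"
proof -
  obtain Y where Y: "Y \<in> carrier_mat b a" "1\<^sub>m a = M * Y"
    using exists_preimages[OF M, of "1\<^sub>m a" a] sur by auto
  have "a \<le> mat_rank M"
  proof (rule mat_rank_ge_inner[OF M _ Y(1), of "1\<^sub>m a"])
    fix v :: "real vec" assume v: "v \<in> carrier_vec a"
    have "M *\<^sub>v (Y *\<^sub>v v) = (M * Y) *\<^sub>v v" using M Y(1) v by (simp add: mult_mat_vec_assoc)
    thus "1\<^sub>m a *\<^sub>v (M *\<^sub>v (Y *\<^sub>v v)) = v" using v Y(2)[symmetric] by simp
  qed auto
  thus ?thesis using mat_rank_le_rows[OF M] by simp
qed

lemma surjective_if_mat_rank_eq_rows:
  fixes M :: "real mat"
  assumes M: "M \<in> carrier_mat a b" and rk: "mat_rank M = a" and y: "y \<in> carrier_vec a"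
  shows "\<exists>x\<in>carrier_vec b. M *\<^sub>v x = y"
proof -
  have one: "mat_rank (1\<^sub>m a :: real mat) = a"
    by (rule mat_rank_eq_rows_if_surjective) auto
  show ?thesis
    using image_eq_if_rank_le[of "1\<^sub>m a" a a M b y] M rk y one by auto
qed

text \<open>Reduces a redundant description of a state, such as the stacked free outputs, to a coordinate
vector of minimal length.\<close>

lemma same_kernel_with_rank_rows:
  fixes M :: "real mat"
  assumes M: "M \<in> carrier_mat a b"
  shows "\<exists>L\<in>carrier_mat (mat_rank M) b. \<forall>v\<in>carrier_vec b. L *\<^sub>v v = 0\<^sub>v (mat_rank M) \<longleftrightarrow> M *\<^sub>v v = 0\<^sub>v a"
proof -
  obtain E F J where "rank_factors a b M E F J"
    using rank_factorization[OF M] .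
  note R = rank_factorsD[OF this]
  have "F *\<^sub>v (M *\<^sub>v v) = 0\<^sub>v (mat_rank M) \<longleftrightarrow> M *\<^sub>v v = 0\<^sub>v a" if "v \<in> carrier_vec b" for v
    using R(1,2) R(5)[OF that] mult_zero_vec[of E] mult_zero_vec[of F] by auto
  thus ?thesis using R(1,2) M by (intro bexI[of _ "F * M"]) (auto simp: mult_mat_vec_assoc)
qed

lemma mat_rank_mult_le:
  fixes P Q :: "real mat"
  assumes P: "P \<in> carrier_mat a b" and Q: "Q \<in> carrier_mat b c"
  shows "mat_rank (P * Q) \<le> mat_rank P"
proof -
  obtain E F J where "rank_factors a b P E F J"
    using rank_factorization[OF P] .
  note R = rank_factorsD[OF this]
  have "E *\<^sub>v (F *\<^sub>v (P *\<^sub>v (Q *\<^sub>v v))) = P *\<^sub>v (Q *\<^sub>v v)" if "v \<in> carrier_vec c" for v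
    using R(5)[of "Q *\<^sub>v v"] Q that by simp
  thus ?thesis
    using R P Q by (intro mat_rank_le_inner[of _ a c E _ "F * P * Q"]) (auto simp: mult_mat_vec_assoc)
qed

lemma mat_rank_diag_one:
  fixes H :: "real mat"
  assumes H: "H \<in> carrier_mat a b"
  shows "mat_rank (four_block_mat H (0\<^sub>m a m) (0\<^sub>m m b) (1\<^sub>m m)) = mat_rank H + m" (is "mat_rank ?M = ?r + m")
proof -
  have M: "?M \<in> carrier_mat (a + m) (b + m)" using H by auto
  have mv: "four_block_mat X (0\<^sub>m p m) (0\<^sub>m m q) (1\<^sub>m m) *\<^sub>v (x @\<^sub>v y) = (X *\<^sub>v x) @\<^sub>v y"
    if "X \<in> carrier_mat p q" "x \<in> carrier_vec q" "y \<in> carrier_vec m" for X :: "real mat" and p q x y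
    using that by (subst four_block_mat_mult_vec[of _ p q _ m _ m]) auto
  have split: "\<exists>x\<in>carrier_vec q. \<exists>y\<in>carrier_vec m. v = x @\<^sub>v y" if "v \<in> carrier_vec (q + m)" for v :: "real vec" and q
    using that vec_first_last_append[of v q m] by (intro bexI[of _ "vec_first v q"] bexI[of _ "vec_last v m"]) auto
  obtain E F J where "rank_factors a b H E F J"
    using rank_factorization[OF H] .
  note R = rank_factorsD[OF this]
  let ?D = "\<lambda>X p q. four_block_mat X (0\<^sub>m p m) (0\<^sub>m m q) (1\<^sub>m m)"
  have "mat_rank ?M \<le> ?r + m"
  proof (rule mat_rank_le_inner[OF M, of "?D E a ?r" _ "?D (F * H) ?r b"])
    fix v :: "real vec" assume "v \<in> carrier_vec (b + m)"
    then obtain x y where "x \<in> carrier_vec b" "y \<in> carrier_vec m" "v = x @\<^sub>v y" using split by blast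
    thus "?M *\<^sub>v v = ?D E a ?r *\<^sub>v (?D (F * H) ?r b *\<^sub>v v)"
      using R H by (simp add: mv mult_mat_vec_assoc)
  qed (use R H in auto)
  moreover have "?r + m \<le> mat_rank ?M"
  proof (rule mat_rank_ge_inner[OF M, of "?D F ?r a" _ "?D J b ?r"])
    fix v :: "real vec" assume "v \<in> carrier_vec (?r + m)"
    then obtain x y where "x \<in> carrier_vec ?r" "y \<in> carrier_vec m" "v = x @\<^sub>v y" using split by blast
    thus "?D F ?r a *\<^sub>v (?M *\<^sub>v (?D J b ?r *\<^sub>v v)) = v"
      using R H by (simp add: mv)
  qed (use R H in auto)
  ultimately show ?thesis by simp
qed

section \<open>Superpositions of data columns\<close>

text \<open>The combination of the columns \<open>f 0, \<dots>, f (N - 1)\<close> with coefficients \<open>a\<close>; coefficients are functions so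
that they can be shifted and extended by zero freely.\<close>

definition comb :: "nat \<Rightarrow> nat \<Rightarrow> (nat \<Rightarrow> real) \<Rightarrow> (nat \<Rightarrow> real vec) \<Rightarrow> real vec" where
  "comb q N a f = vec q (\<lambda>i. \<Sum>s<N. a s * f s $ i)"

lemma comb_carrier [simp]: "comb q N a f \<in> carrier_vec q"
  and comb_dim [simp]: "dim_vec (comb q N a f) = q"
  and comb_index [simp]: "i < q \<Longrightarrow> comb q N a f $ i = (\<Sum>s<N. a s * f s $ i)"
  by (simp_all add: comb_def)

lemma comb_cong:
  assumes "\<And>s. s < N \<Longrightarrow> a s = b s" "\<And>s. s < N \<Longrightarrow> f s = g s"
  shows "comb q N a f = comb q N b g"
  using assms by (intro eq_vecI) (auto intro!: sum.cong)

lemma comb_zero: "(\<And>s. s < N \<Longrightarrow> a s = 0) \<Longrightarrow> comb q N a f = 0\<^sub>v q"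
  by (intro eq_vecI) (auto intro!: sum.neutral)

lemma comb_zero_signal: "(\<And>s. s < N \<Longrightarrow> f s = 0\<^sub>v q) \<Longrightarrow> comb q N a f = 0\<^sub>v q"
  by (intro eq_vecI) (auto intro!: sum.neutral)

lemma comb_unit:
  assumes "r < N" "f r \<in> carrier_vec q"
  shows "comb q N (\<lambda>s. if s = r then c else 0) f = c \<cdot>\<^sub>v f r"
proof (rule eq_vecI)
  fix i assume "i < dim_vec (c \<cdot>\<^sub>v f r)"
  hence i: "i < q" using assms by simp
  have "(\<Sum>s<N. (if s = r then c else 0) * f s $ i) = (\<Sum>s<N. if s = r then c * f r $ i else 0)"
    by (intro sum.cong) auto
  thus "comb q N (\<lambda>s. if s = r then c else 0) f $ i = (c \<cdot>\<^sub>v f r) $ i" using i assms by simp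
qed (use assms in simp)

lemma comb_coeff_add: "comb q N (\<lambda>s. a s + b s) f = comb q N a f + comb q N b f"
  by (intro eq_vecI) (auto simp: sum.distrib algebra_simps)

lemma comb_coeff_diff: "comb q N (\<lambda>s. a s - b s) f = comb q N a f - comb q N b f"
  by (intro eq_vecI) (auto simp: sum_subtractf algebra_simps)

lemma comb_add:
  assumes "\<And>s. s < N \<Longrightarrow> f s \<in> carrier_vec q" "\<And>s. s < N \<Longrightarrow> g s \<in> carrier_vec q"
  shows "comb q N a (\<lambda>s. f s + g s) = comb q N a f + comb q N a g"
proof (rule eq_vecI)
  fix i assume "i < dim_vec (comb q N a f + comb q N a g)"
  hence i: "i < q" by simp
  have "(\<Sum>s<N. a s * (f s + g s) $ i) = (\<Sum>s<N. a s * f s $ i + a s * g s $ i)"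
  proof (rule sum.cong[OF refl])
    fix s assume "s \<in> {..<N}"
    hence "(f s + g s) $ i = f s $ i + g s $ i" using assms(2)[of s] i by simp
    thus "a s * (f s + g s) $ i = a s * f s $ i + a s * g s $ i" by (simp add: algebra_simps)
  qed
  thus "comb q N a (\<lambda>s. f s + g s) $ i = (comb q N a f + comb q N a g) $ i" using i by (simp add: sum.distrib)
qed simp

lemma comb_diff:
  assumes "\<And>s. s < N \<Longrightarrow> f s \<in> carrier_vec q" "\<And>s. s < N \<Longrightarrow> g s \<in> carrier_vec q"
  shows "comb q N a (\<lambda>s. f s - g s) = comb q N a f - comb q N a g"
proof (rule eq_vecI)
  fix i assume "i < dim_vec (comb q N a f - comb q N a g)"
  hence i: "i < q" by simp
  have "(\<Sum>s<N. a s * (f s - g s) $ i) = (\<Sum>s<N. a s * f s $ i - a s * g s $ i)"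
  proof (rule sum.cong[OF refl])
    fix s assume "s \<in> {..<N}"
    hence "(f s - g s) $ i = f s $ i - g s $ i" using assms(2)[of s] i by simp
    thus "a s * (f s - g s) $ i = a s * f s $ i - a s * g s $ i" by (simp only: right_diff_distrib)
  qed
  thus "comb q N a (\<lambda>s. f s - g s) $ i = (comb q N a f - comb q N a g) $ i" using i by (simp add: sum_subtractf)
qed simp

lemma comb_comb: "comb q K c (\<lambda>r. comb q N (b r) f) = comb q N (\<lambda>s. \<Sum>r<K. c r * b r s) f"
proof (rule eq_vecI)
  fix i assume "i < dim_vec (comb q N (\<lambda>s. \<Sum>r<K. c r * b r s) f)"
  hence i: "i < q" by simp
  have "(\<Sum>r<K. c r * (\<Sum>s<N. b r s * f s $ i)) = (\<Sum>s<N. (\<Sum>r<K. c r * b r s) * f s $ i)"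
    unfolding sum_distrib_left sum_distrib_right by (subst sum.swap) (simp add: mult.assoc)
  thus "comb q K c (\<lambda>r. comb q N (b r) f) $ i = comb q N (\<lambda>s. \<Sum>r<K. c r * b r s) f $ i" using i by simp
qed simp

lemma comb_mono:
  assumes "M \<le> N" "\<And>s. M \<le> s \<Longrightarrow> s < N \<Longrightarrow> a s = 0"
  shows "comb q N a f = comb q M a f"
proof (rule eq_vecI)
  fix i assume "i < dim_vec (comb q M a f)"
  moreover have "(\<Sum>s<N. a s * f s $ i) = (\<Sum>s<M. a s * f s $ i)"
    using assms by (intro sum.mono_neutral_right) auto
  ultimately show "comb q N a f $ i = comb q M a f $ i" by simp
qed simp

lemma comb_shift:
  "comb q N a (\<lambda>s. f (Suc s)) = comb q (Suc N) (case_nat 0 a) f"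
  by (intro eq_vecI) (auto simp del: sum.lessThan_Suc simp: sum.lessThan_Suc_shift)

lemma mult_comb:
  assumes A: "A \<in> carrier_mat a b" and f: "\<And>s. s < N \<Longrightarrow> f s \<in> carrier_vec b"
  shows "A *\<^sub>v comb b N c f = comb a N c (\<lambda>s. A *\<^sub>v f s)"
proof (rule eq_vecI)
  fix i assume "i < dim_vec (comb a N c (\<lambda>s. A *\<^sub>v f s))"
  hence i: "i < a" by simp
  have "(A *\<^sub>v comb b N c f) $ i = (\<Sum>l<b. A $$ (i, l) * (\<Sum>s<N. c s * f s $ l))"
    using A i by (simp add: scalar_prod_def lessThan_atLeast0)
  also have "\<dots> = (\<Sum>s<N. c s * (\<Sum>l<b. A $$ (i, l) * f s $ l))"
    unfolding sum_distrib_left by (subst sum.swap) (simp add: algebra_simps)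
  also have "\<dots> = (\<Sum>s<N. c s * (A *\<^sub>v f s) $ i)"
  proof (rule sum.cong[OF refl])
    fix s assume "s \<in> {..<N}"
    hence "dim_vec (f s) = b" using f[of s] by simp
    thus "c s * (\<Sum>l<b. A $$ (i, l) * f s $ l) = c s * (A *\<^sub>v f s) $ i"
      using A i by (simp add: scalar_prod_def lessThan_atLeast0)
  qed
  finally show "(A *\<^sub>v comb b N c f) $ i = comb a N c (\<lambda>s. A *\<^sub>v f s) $ i" using i by simp
qed (use A in simp)

lemma mat_of_signal_mult:
  "mat q N (\<lambda>(i, s). f s $ i) *\<^sub>v vec N a = comb q N a f"
  by (intro eq_vecI) (auto simp: scalar_prod_def lessThan_atLeast0 mult.commute)

lemma vec_eta: "v \<in> carrier_vec N \<Longrightarrow> \<exists>a. v = vec N a"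
  by (intro exI[of _ "\<lambda>i. v $ i"]) (auto intro!: eq_vecI)

text \<open>A linear map taking one signal to another exists as soon as no relation between values of the first
is broken by the second.\<close>

lemma signal_factor:
  assumes f: "\<And>s. s < N \<Longrightarrow> f s \<in> carrier_vec a" and g: "\<And>s. s < N \<Longrightarrow> g s \<in> carrier_vec b"
    and ker: "\<And>c. comb a N c f = 0\<^sub>v a \<Longrightarrow> comb b N c g = 0\<^sub>v b"
  shows "\<exists>K\<in>carrier_mat b a. \<forall>s<N. g s = K *\<^sub>v f s"
proof -
  let ?F = "mat a N (\<lambda>(i, s). f s $ i)" and ?G = "mat b N (\<lambda>(i, s). g s $ i)"
  have "\<exists>K\<in>carrier_mat b a. \<forall>v\<in>carrier_vec N. ?G *\<^sub>v v = K *\<^sub>v (?F *\<^sub>v v)"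
  proof (rule factor_through_kernel(1))
    fix v :: "real vec" assume "v \<in> carrier_vec N" "?F *\<^sub>v v = 0\<^sub>v a"
    thus "?G *\<^sub>v v = 0\<^sub>v b" using vec_eta[of v N] ker by (auto simp: mat_of_signal_mult)
  qed auto
  then obtain K where K: "K \<in> carrier_mat b a" "\<And>v. v \<in> carrier_vec N \<Longrightarrow> ?G *\<^sub>v v = K *\<^sub>v (?F *\<^sub>v v)"
    by blast
  have "g s = K *\<^sub>v f s" if s: "s < N" for s
  proof -
    let ?e = "\<lambda>r. if r = s then 1 else (0::real)"
    have "comb b N ?e g = K *\<^sub>v comb a N ?e f" using K(2)[of "vec N ?e"] by (simp add: mat_of_signal_mult)
    thus ?thesis using comb_unit[of s N f a 1] comb_unit[of s N g b 1] s f[OF s] g[OF s] by simp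
  qed
  with K(1) show ?thesis by blast
qed

lemma signal_factor2:
  assumes f: "\<And>s. s < N \<Longrightarrow> f s \<in> carrier_vec a" and h: "\<And>s. s < N \<Longrightarrow> h s \<in> carrier_vec d"
    and g: "\<And>s. s < N \<Longrightarrow> g s \<in> carrier_vec b"
    and ker: "\<And>c. comb a N c f = 0\<^sub>v a \<Longrightarrow> comb d N c h = 0\<^sub>v d \<Longrightarrow> comb b N c g = 0\<^sub>v b"
  shows "\<exists>K\<in>carrier_mat b a. \<exists>K'\<in>carrier_mat b d. \<forall>s<N. g s = K *\<^sub>v f s + K' *\<^sub>v h s"
proof -
  have app: "comb (a + d) N c (\<lambda>s. f s @\<^sub>v h s) = comb a N c f @\<^sub>v comb d N c h" for c
  proof (rule eq_vecI)
    fix i assume "i < dim_vec (comb a N c f @\<^sub>v comb d N c h)"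
    hence i: "i < a + d" by simp
    have "(f s @\<^sub>v h s) $ i = (if i < a then f s $ i else h s $ (i - a))" if "s < N" for s
      using f[OF that] h[OF that] i by auto
    thus "comb (a + d) N c (\<lambda>s. f s @\<^sub>v h s) $ i = (comb a N c f @\<^sub>v comb d N c h) $ i"
      using i by (auto intro!: sum.cong)
  qed simp
  have "\<exists>K\<in>carrier_mat b (a + d). \<forall>s<N. g s = K *\<^sub>v (f s @\<^sub>v h s)"
  proof (rule signal_factor)
    fix c assume "comb (a + d) N c (\<lambda>s. f s @\<^sub>v h s) = 0\<^sub>v (a + d)"
    hence eq: "comb a N c f @\<^sub>v comb d N c h = 0\<^sub>v (a + d)" unfolding app .
    have "comb a N c f $ i = 0" if "i < a" for i
      using arg_cong[OF eq, of "\<lambda>v. v $ i"] that by simp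
    hence 1: "comb a N c f = 0\<^sub>v a" by (intro eq_vecI) auto
    have "comb d N c h $ i = 0" if "i < d" for i
      using arg_cong[OF eq, of "\<lambda>v. v $ (a + i)"] that by simp
    hence "comb d N c h = 0\<^sub>v d" by (intro eq_vecI) auto
    with 1 show "comb b N c g = 0\<^sub>v b" by (rule ker)
  qed (use f h g in auto)
  then obtain K where K: "K \<in> carrier_mat b (a + d)" "\<And>s. s < N \<Longrightarrow> g s = K *\<^sub>v (f s @\<^sub>v h s)" by blast
  define K1 where "K1 = mat b a (\<lambda>(i, j). K $$ (i, j))"
  define K2 where "K2 = mat b d (\<lambda>(i, j). K $$ (i, a + j))"
  have "K *\<^sub>v (x @\<^sub>v y) = K1 *\<^sub>v x + K2 *\<^sub>v y" if "x \<in> carrier_vec a" "y \<in> carrier_vec d" for x y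
  proof (rule eq_vecI)
    fix i assume "i < dim_vec (K1 *\<^sub>v x + K2 *\<^sub>v y)"
    hence i: "i < b" by (simp add: K2_def)
    have "(K *\<^sub>v (x @\<^sub>v y)) $ i = (\<Sum>l = 0..<a + d. K $$ (i, l) * (x @\<^sub>v y) $ l)"
      using K(1) i that by (simp add: scalar_prod_def)
    also have "\<dots> = (\<Sum>l = 0..<a. K $$ (i, l) * (x @\<^sub>v y) $ l) + (\<Sum>l = a..<a + d. K $$ (i, l) * (x @\<^sub>v y) $ l)"
      by (simp add: sum.atLeastLessThan_concat)
    also have "(\<Sum>l = a..<a + d. K $$ (i, l) * (x @\<^sub>v y) $ l) = (\<Sum>l = 0..<d. K $$ (i, l + a) * (x @\<^sub>v y) $ (l + a))"
      using sum.shift_bounds_nat_ivl[of "\<lambda>l. K $$ (i, l) * (x @\<^sub>v y) $ l" 0 a d] by (simp add: add.commute)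
    also have "(\<Sum>l = 0..<a. K $$ (i, l) * (x @\<^sub>v y) $ l) + \<dots> = (K1 *\<^sub>v x + K2 *\<^sub>v y) $ i"
      using that i by (auto simp: K1_def K2_def scalar_prod_def add.commute intro!: arg_cong2[of _ _ _ _ "(+)"] sum.cong)
    finally show "(K *\<^sub>v (x @\<^sub>v y)) $ i = (K1 *\<^sub>v x + K2 *\<^sub>v y) $ i" .
  qed (use K(1) in \<open>simp add: K2_def\<close>)
  thus ?thesis using K(2) f h
    by (intro bexI[of _ K1] bexI[of _ K2]) (auto simp: K1_def K2_def)
qed

text \<open>Entry \<open>j\<close> of the superposition of the windows of \<open>f\<close> that start at the times \<open>0, \<dots>, N - 1\<close>. As \<open>j\<close> varies for fixed
\<open>a\<close>, these entries form a trajectory piece of every system of which \<open>f\<close> is a signal.\<close>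

definition wcomb :: "nat \<Rightarrow> (nat \<Rightarrow> real vec) \<Rightarrow> nat \<Rightarrow> (nat \<Rightarrow> real) \<Rightarrow> nat \<Rightarrow> real vec" where
  "wcomb q f N a j = comb q N a (\<lambda>s. f (s + j))"

lemma wcomb_carrier [simp]: "wcomb q f N a j \<in> carrier_vec q"
  and wcomb_dim [simp]: "dim_vec (wcomb q f N a j) = q"
  by (simp_all add: wcomb_def)

lemma wcomb_cong:
  assumes "\<And>s. s < N \<Longrightarrow> a s = b s" "\<And>s. s < N \<Longrightarrow> f (s + j) = g (s + j)"
  shows "wcomb q f N a j = wcomb q g N b j"
  unfolding wcomb_def using assms by (intro comb_cong)

lemma wcomb_zero: "wcomb q f N (\<lambda>_. 0) j = 0\<^sub>v q"
  unfolding wcomb_def by (rule comb_zero) simp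

text \<open>Dropping the first entry of a superposed window again gives a superposed window, with
coefficients moved by one time step.\<close>

lemma wcomb_shift: "wcomb q f (Suc N) (case_nat 0 a) j = wcomb q f N a (Suc j)"
  unfolding wcomb_def by (subst comb_shift[symmetric]) (simp add: add.commute)

lemma wcomb_diff: "wcomb q f N (\<lambda>s. a s - b s) j = wcomb q f N a j - wcomb q f N b j"
  unfolding wcomb_def by (rule comb_coeff_diff)

lemma wcomb_add: "wcomb q f N (\<lambda>s. a s + b s) j = wcomb q f N a j + wcomb q f N b j"
  unfolding wcomb_def by (rule comb_coeff_add)

lemma wcomb_mono:
  assumes "M \<le> N" "\<And>s. M \<le> s \<Longrightarrow> s < N \<Longrightarrow> a s = 0"
  shows "wcomb q f N a j = wcomb q f M a j"
  unfolding wcomb_def using assms by (rule comb_mono)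

lemma wcomb_unit: "r < N \<Longrightarrow> f (r + j) \<in> carrier_vec q \<Longrightarrow> wcomb q f N (\<lambda>s. if s = r then c else 0) j = c \<cdot>\<^sub>v f (r + j)"
  unfolding wcomb_def using comb_unit[of r N "\<lambda>s. f (s + j)" q c] by simp

subsection \<open>Hankel matrices\<close>

definition stack :: "nat \<Rightarrow> nat \<Rightarrow> (nat \<Rightarrow> real vec) \<Rightarrow> real vec" where
  "stack q k w = vec (k * q) (\<lambda>r. w (r div q) $ (r mod q))"

lemma stack_carrier [simp]: "stack q k w \<in> carrier_vec (k * q)"
  and stack_dim [simp]: "dim_vec (stack q k w) = k * q"
  by (simp_all add: stack_def)

lemma block_index: "j < k \<Longrightarrow> i < q \<Longrightarrow> j * q + i < k * (q :: nat)"
proof -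
  assume j: "j < k" and i: "i < q"
  have "j * q + i < Suc j * q" using i by simp
  also have "\<dots> \<le> k * q" using j by (intro mult_le_mono1) simp
  finally show ?thesis .
qed

lemma stack_eq_iff:
  assumes "\<And>j. j < k \<Longrightarrow> w j \<in> carrier_vec q" "\<And>j. j < k \<Longrightarrow> w' j \<in> carrier_vec q"
  shows "stack q k w = stack q k w' \<longleftrightarrow> (\<forall>j<k. w j = w' j)"
proof
  assume eq: "stack q k w = stack q k w'"
  show "\<forall>j<k. w j = w' j"
  proof (intro allI impI eq_vecI)
    fix j i assume j: "j < k" and "i < dim_vec (w' j)"
    hence i: "i < q" using assms(2)[OF j] by simp
    show "w j $ i = w' j $ i"
      using arg_cong[OF eq, of "\<lambda>v. v $ (j * q + i)"] block_index[OF j i] i by (simp add: stack_def)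
  next
    fix j assume "j < k"
    thus "dim_vec (w j) = dim_vec (w' j)" using assms by (metis carrier_vecD)
  qed
next
  assume eq: "\<forall>j<k. w j = w' j"
  show "stack q k w = stack q k w'"
  proof (rule eq_vecI)
    fix r assume "r < dim_vec (stack q k w')"
    hence r: "r < k * q" by simp
    hence "r div q < k" by (simp add: less_mult_imp_div_less)
    thus "stack q k w $ r = stack q k w' $ r" using eq r by (simp add: stack_def)
  qed simp
qed

lemma stack_zero: "stack q k (\<lambda>_. 0\<^sub>v q) = 0\<^sub>v (k * q)"
proof (rule eq_vecI)
  fix r assume "r < dim_vec (0\<^sub>v (k * q) :: real vec)"
  hence r: "r < k * q" by simp
  hence "r mod q < q" by (intro mod_less_divisor gr0I) auto
  thus "stack q k (\<lambda>_. 0\<^sub>v q) $ r = 0\<^sub>v (k * q) $ r" using r by (simp add: stack_def)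
qed simp

lemma stack_eq_zero_iff:
  assumes "\<And>j. j < k \<Longrightarrow> w j \<in> carrier_vec q"
  shows "stack q k w = 0\<^sub>v (k * q) \<longleftrightarrow> (\<forall>j<k. w j = 0\<^sub>v q)"
  using stack_eq_iff[of k w q "\<lambda>_. 0\<^sub>v q"] assms by (simp add: stack_zero)

lemma stack_Suc: "stack q (Suc k) w = stack q k w @\<^sub>v w k" if "w k \<in> carrier_vec q"
proof (rule eq_vecI)
  fix r assume "r < dim_vec (stack q k w @\<^sub>v w k)"
  hence r: "r < k * q + q" using that by simp
  show "stack q (Suc k) w $ r = (stack q k w @\<^sub>v w k) $ r"
  proof (cases "r < k * q")
    case False
    hence "r div q = k" using r by (intro div_nat_eqI) (auto simp: algebra_simps)
    moreover have "r mod q = r - k * q" using calculation by (simp add: modulo_nat_def mult.commute)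
    ultimately show ?thesis using r that False by (simp add: stack_def algebra_simps)
  qed (use r in \<open>simp add: stack_def algebra_simps\<close>)
qed (use that in simp)

lemma hankel_mult:
  assumes "N = e - k + 1"
  shows "hankel q k f 0 e *\<^sub>v vec N a = stack q (k + 1) (wcomb q f N a)"
proof (rule eq_vecI)
  fix r assume "r < dim_vec (stack q (k + 1) (wcomb q f N a))"
  hence r: "r < (k + 1) * q" by simp
  hence q: "r mod q < q" by (intro mod_less_divisor gr0I) auto
  show "(hankel q k f 0 e *\<^sub>v vec N a) $ r = stack q (k + 1) (wcomb q f N a) $ r"
    using r q assms unfolding hankel_def stack_def wcomb_def
    by (simp add: scalar_prod_def lessThan_atLeast0 mult.commute[of "f _ $ _"] add.commute[of "r div q"])
qed (simp add: hankel_def)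

lemma hankel_carrier: "N = e - k + 1 \<Longrightarrow> hankel q k f 0 e \<in> carrier_mat ((k + 1) * q) N"
  by (simp add: hankel_def)

lemma H_mat_carrier:
  assumes "k < length us"
  shows "H_mat m p k us ys \<in> carrier_mat ((k + 1) * p + (k + 1) * m) (length us - k)"
  unfolding H_mat_def Let_def using assms by (intro carrier_append_rows hankel_carrier) auto

lemma H_mat_mult:
  assumes "k < length us"
  shows "H_mat m p k us ys *\<^sub>v vec (length us - k) a =
    stack p (k + 1) (wcomb p ((!) ys) (length us - k) a) @\<^sub>v stack m (k + 1) (wcomb m ((!) us) (length us - k) a)"
proof -
  have N: "length us - k = length us - 1 - k + 1" using assms by simp
  show ?thesis unfolding H_mat_def Let_def
    by (subst mat_mult_append[OF hankel_carrier[OF N] hankel_carrier[OF N]]) (simp_all only: hankel_mult[OF N] vec_carrier)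
qed

lemma G_mat_carrier:
  assumes "1 \<le> k" "k < length us"
  shows "G_mat m p k us ys \<in> carrier_mat (k * p + (k + 1) * m) (length us - k)"
proof -
  have N: "length us - k = length us - 1 - k + 1" "length us - k = length us - 2 - (k - 1) + 1" using assms by simp_all
  have "hankel p (k - 1) ((!) ys) 0 (length us - 2) \<in> carrier_mat (k * p) (length us - k)"
    using hankel_carrier[OF N(2), of p "(!) ys"] assms by simp
  thus ?thesis unfolding G_mat_def Let_def using hankel_carrier[OF N(1)] by (intro carrier_append_rows)
qed

lemma G_mat_mult:
  assumes "1 \<le> k" "k < length us"
  shows "G_mat m p k us ys *\<^sub>v vec (length us - k) a =
    stack p k (wcomb p ((!) ys) (length us - k) a) @\<^sub>v stack m (k + 1) (wcomb m ((!) us) (length us - k) a)"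
proof -
  have N: "length us - k = length us - 1 - k + 1" "length us - k = length us - 2 - (k - 1) + 1" using assms by simp_all
  have k: "k - 1 + 1 = k" using assms by simp
  show ?thesis unfolding G_mat_def Let_def
    by (subst mat_mult_append[OF hankel_carrier[OF N(2)] hankel_carrier[OF N(1)]])
      (simp_all only: hankel_mult[OF N(1)] hankel_mult[OF N(2)] vec_carrier k)
qed

lemma append_vec_eq_zero_iff:
  "v \<in> carrier_vec a \<Longrightarrow> w \<in> carrier_vec b \<Longrightarrow> v @\<^sub>v w = 0\<^sub>v (a + b) \<longleftrightarrow> v = 0\<^sub>v a \<and> w = (0\<^sub>v b :: real vec)"
proof -
  assume v: "v \<in> carrier_vec a" and w: "w \<in> carrier_vec b"
  have "0\<^sub>v (a + b) = 0\<^sub>v a @\<^sub>v (0\<^sub>v b :: real vec)" by (intro eq_vecI) auto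
  thus ?thesis using append_vec_eq[OF v, of "0\<^sub>v a" w "0\<^sub>v b"] by auto
qed

lemma H_mat_kernel_iff:
  assumes "k < length us"
  shows "H_mat m p k us ys *\<^sub>v vec (length us - k) a = 0\<^sub>v ((k + 1) * p + (k + 1) * m) \<longleftrightarrow>
    (\<forall>j\<le>k. wcomb p ((!) ys) (length us - k) a j = 0\<^sub>v p \<and> wcomb m ((!) us) (length us - k) a j = 0\<^sub>v m)"
proof -
  have "(\<forall>j\<le>k. P j) \<longleftrightarrow> (\<forall>j<k + 1. P j)" for P :: "nat \<Rightarrow> bool" by (simp add: less_Suc_eq_le)
  thus ?thesis unfolding H_mat_mult[OF assms]
    by (subst append_vec_eq_zero_iff) (auto simp del: mult_Suc simp: stack_eq_zero_iff)
qed

text \<open>Linear independence of the columns of the Hankel matrix of depth \<open>k\<close> with \<open>N\<close> columns, in terms of superpositions.\<close>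

definition full_column_rank :: "nat \<Rightarrow> nat \<Rightarrow> nat \<Rightarrow> (nat \<Rightarrow> real vec) \<Rightarrow> (nat \<Rightarrow> real vec) \<Rightarrow> nat \<Rightarrow> bool" where
  "full_column_rank m p k u y N \<longleftrightarrow>
     (\<forall>a. (\<forall>j\<le>k. wcomb p y N a j = 0\<^sub>v p \<and> wcomb m u N a j = 0\<^sub>v m) \<longrightarrow> (\<forall>s<N. a s = 0))"

lemma mat_rank_H_mat_iff:
  assumes "k < length us"
  shows "mat_rank (H_mat m p k us ys) = length us - k \<longleftrightarrow>
    full_column_rank m p k ((!) us) ((!) ys) (length us - k)"
proof -
  have inj: "vec N a = 0\<^sub>v N \<longleftrightarrow> (\<forall>s<N. a s = (0 :: real))" for N a
    by (auto simp: vec_eq_iff)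
  let ?N = "length us - k" and ?q = "(k + 1) * p + (k + 1) * m"
  have "(\<forall>v\<in>carrier_vec ?N. H_mat m p k us ys *\<^sub>v v = 0\<^sub>v ?q \<longrightarrow> v = 0\<^sub>v ?N) \<longleftrightarrow>
    (\<forall>a. H_mat m p k us ys *\<^sub>v vec ?N a = 0\<^sub>v ?q \<longrightarrow> vec ?N a = 0\<^sub>v ?N)" (is "?l \<longleftrightarrow> ?r")
  proof
    assume r: ?r
    show ?l
    proof
      fix v :: "real vec" assume "v \<in> carrier_vec ?N"
      then obtain a where "v = vec ?N a" using vec_eta by blast
      thus "H_mat m p k us ys *\<^sub>v v = 0\<^sub>v ?q \<longrightarrow> v = 0\<^sub>v ?N" using r by blast
    qed
  qed simp
  thus ?thesis
    unfolding mat_rank_eq_cols_iff_injective[OF H_mat_carrier[OF assms]] full_column_rank_def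
      H_mat_kernel_iff[OF assms] inj .
qed

section \<open>Observability, lag and controllability\<close>

lemma mult_vec_carrier: "(M :: real mat) \<in> carrier_mat a b \<Longrightarrow> M *\<^sub>v v \<in> carrier_vec a"
  by (intro carrier_vecI) simp

lemma pow_mat_dim_square:
  assumes "(A :: real mat) \<in> carrier_mat n n"
  shows "dim_row (A ^\<^sub>m k) = n" "dim_col (A ^\<^sub>m k) = n"
  using pow_carrier_mat[OF assms, of k] by auto

lemma obs_mat_carrier:
  assumes "A \<in> carrier_mat n n" "C \<in> carrier_mat p n"
  shows "obs_mat C A k \<in> carrier_mat (k * p) n"
proof (induction k)
  case (Suc k)
  have "C * (A ^\<^sub>m k) \<in> carrier_mat p n" by (rule mult_carrier_mat[OF assms(2) pow_carrier_mat[OF assms(1)]])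
  thus ?case using carrier_append_rows[OF Suc] by (simp add: add.commute)
qed (use assms in simp)

lemma obs_mat_Suc_mult:
  assumes "A \<in> carrier_mat n n" "C \<in> carrier_mat p n" "x \<in> carrier_vec n"
  shows "obs_mat C A (Suc k) *\<^sub>v x = (obs_mat C A k *\<^sub>v x) @\<^sub>v (C *\<^sub>v (A ^\<^sub>m k *\<^sub>v x))"
proof -
  have CA: "C * (A ^\<^sub>m k) \<in> carrier_mat p n" by (rule mult_carrier_mat[OF assms(2) pow_carrier_mat[OF assms(1)]])
  have "C * (A ^\<^sub>m k) *\<^sub>v x = C *\<^sub>v (A ^\<^sub>m k *\<^sub>v x)"
    using assms by (intro mult_mat_vec_assoc) (auto simp: pow_mat_dim_square[OF assms(1)])
  thus ?thesis
    using mat_mult_append[OF obs_mat_carrier[OF assms(1,2), of k] CA assms(3)] by simp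
qed

lemma obs_mat_mult_eq:
  assumes "A \<in> carrier_mat n n" "C \<in> carrier_mat p n" "x \<in> carrier_vec n"
    and "A' \<in> carrier_mat n' n'" "C' \<in> carrier_mat p n'" "x' \<in> carrier_vec n'"
    and "\<And>j. j < k \<Longrightarrow> C *\<^sub>v (A ^\<^sub>m j *\<^sub>v x) = C' *\<^sub>v (A' ^\<^sub>m j *\<^sub>v x')"
  shows "obs_mat C A k *\<^sub>v x = obs_mat C' A' k *\<^sub>v x'"
  using assms(7)
proof (induction k)
  case 0
  show ?case by (intro eq_vecI) simp_all
next
  case (Suc k)
  have "obs_mat C A k *\<^sub>v x = obs_mat C' A' k *\<^sub>v x'" by (rule Suc.IH) (rule Suc.prems, simp)
  moreover have "C *\<^sub>v (A ^\<^sub>m k *\<^sub>v x) = C' *\<^sub>v (A' ^\<^sub>m k *\<^sub>v x')" by (rule Suc.prems) simp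
  ultimately show ?case by (simp only: obs_mat_Suc_mult[OF assms(1-3)] obs_mat_Suc_mult[OF assms(4-6)])
qed

lemma obs_mat_kernel_iff:
  assumes "A \<in> carrier_mat n n" "C \<in> carrier_mat p n" "x \<in> carrier_vec n"
  shows "obs_mat C A k *\<^sub>v x = 0\<^sub>v (k * p) \<longleftrightarrow> (\<forall>j<k. C *\<^sub>v (A ^\<^sub>m j *\<^sub>v x) = 0\<^sub>v p)"
proof (induction k)
  case 0
  show ?case using assms by (auto intro!: eq_vecI)
next
  case (Suc k)
  have "obs_mat C A (Suc k) *\<^sub>v x = 0\<^sub>v (Suc k * p) \<longleftrightarrow>
      (obs_mat C A k *\<^sub>v x) @\<^sub>v (C *\<^sub>v (A ^\<^sub>m k *\<^sub>v x)) = 0\<^sub>v (k * p + p)"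
    by (simp only: obs_mat_Suc_mult[OF assms] mult_Suc add.commute)
  also have "\<dots> \<longleftrightarrow> obs_mat C A k *\<^sub>v x = 0\<^sub>v (k * p) \<and> C *\<^sub>v (A ^\<^sub>m k *\<^sub>v x) = 0\<^sub>v p"
    by (intro append_vec_eq_zero_iff mult_vec_carrier[OF assms(2)] mult_vec_carrier[OF obs_mat_carrier[OF assms(1,2)]])
  also have "\<dots> \<longleftrightarrow> (\<forall>j<Suc k. C *\<^sub>v (A ^\<^sub>m j *\<^sub>v x) = 0\<^sub>v p)"
    unfolding Suc by (auto simp: less_Suc_eq)
  finally show ?case .
qed

lemma pow_mat_mult_vec_Suc:
  assumes "A \<in> carrier_mat n n" "x \<in> carrier_vec n"
  shows "A ^\<^sub>m Suc k *\<^sub>v x = A ^\<^sub>m k *\<^sub>v (A *\<^sub>v (x :: real vec))"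
  using assms by (simp add: mult_mat_vec_assoc)

lemma pow_mat_mult_vec_commute:
  assumes "A \<in> carrier_mat n n" "x \<in> carrier_vec n"
  shows "A *\<^sub>v (A ^\<^sub>m k *\<^sub>v x) = A ^\<^sub>m k *\<^sub>v (A *\<^sub>v (x :: real vec))"
  using assms(2)
proof (induction k arbitrary: x)
  case (Suc k)
  have "A *\<^sub>v x \<in> carrier_vec n" by (rule mult_vec_carrier[OF assms(1)])
  thus ?case using Suc.IH[of "A *\<^sub>v x"] assms(1) Suc.prems by (simp only: pow_mat_mult_vec_Suc[OF assms(1)])
qed (use assms(1) in simp)

context
  fixes A C :: "real mat" and n p :: nat
  assumes A: "A \<in> carrier_mat n n" and C: "C \<in> carrier_mat p n"
begin

lemma obs_rank_mono_Suc: "mat_rank (obs_mat C A k) \<le> mat_rank (obs_mat C A (Suc k))"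
proof (rule factor_through_kernel(2)[OF obs_mat_carrier[OF A C] obs_mat_carrier[OF A C]])
  fix x :: "real vec" assume x: "x \<in> carrier_vec n" "obs_mat C A (Suc k) *\<^sub>v x = 0\<^sub>v (Suc k * p)"
  show "obs_mat C A k *\<^sub>v x = 0\<^sub>v (k * p)"
    using x(2) unfolding obs_mat_kernel_iff[OF A C x(1)] by simp
qed

lemma obs_rank_le: "mat_rank (obs_mat C A k) \<le> n"
  using mat_rank_le_cols[OF obs_mat_carrier[OF A C]] .

lemma obs_rank_growth_aux:
  assumes "\<And>l. i \<le> l \<Longrightarrow> l < i + d \<Longrightarrow> mat_rank (obs_mat C A (Suc l)) \<noteq> mat_rank (obs_mat C A l)"
  shows "mat_rank (obs_mat C A i) + d \<le> mat_rank (obs_mat C A (i + d))"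
  using assms
proof (induction d)
  case (Suc d)
  have "mat_rank (obs_mat C A (Suc (i + d))) \<noteq> mat_rank (obs_mat C A (i + d))"
    using Suc.prems[of "i + d"] by simp
  hence "mat_rank (obs_mat C A (i + d)) < mat_rank (obs_mat C A (Suc (i + d)))"
    using obs_rank_mono_Suc[of "i + d"] by simp
  moreover have "mat_rank (obs_mat C A i) + d \<le> mat_rank (obs_mat C A (i + d))"
    using Suc by simp
  ultimately show ?case by (simp del: obs_mat.simps)
qed simp

lemma lag_rank_eq: "mat_rank (obs_mat C A (Suc (lag C A))) = mat_rank (obs_mat C A (lag C A))"
proof -
  have "\<exists>k. mat_rank (obs_mat C A (Suc k)) = mat_rank (obs_mat C A k)"
  proof (rule ccontr)
    assume "\<not> ?thesis"
    hence "mat_rank (obs_mat C A 0) + Suc n \<le> mat_rank (obs_mat C A (0 + Suc n))"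
      by (intro obs_rank_growth_aux) auto
    thus False using obs_rank_le[of "0 + Suc n"] by (simp del: obs_mat.simps)
  qed
  thus ?thesis unfolding lag_def by (rule LeastI_ex)
qed

lemma obs_rank_growth:
  assumes "i \<le> j" "j \<le> lag C A"
  shows "mat_rank (obs_mat C A i) + (j - i) \<le> mat_rank (obs_mat C A j)"
proof -
  have "mat_rank (obs_mat C A (Suc l)) \<noteq> mat_rank (obs_mat C A l)" if "l < lag C A" for l
    using not_less_Least[of l "\<lambda>k. mat_rank (obs_mat C A (Suc k)) = mat_rank (obs_mat C A k)"] that
    unfolding lag_def by blast
  hence "mat_rank (obs_mat C A i) + (j - i) \<le> mat_rank (obs_mat C A (i + (j - i)))"
    using assms by (intro obs_rank_growth_aux) auto
  thus ?thesis using assms by simp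
qed

lemma lag_le: "lag C A \<le> n"
  using obs_rank_growth[of 0 "lag C A"] obs_rank_le[of "lag C A"] by (simp del: obs_mat.simps)

text \<open>At the lag the kernel of the observability matrix does not shrink any more, so it is invariant under
\<open>A\<close>, and outputs that vanish up to the lag vanish forever.\<close>

lemma obs_kernel_lag:
  assumes x: "x \<in> carrier_vec n" and z: "\<And>j. j < lag C A \<Longrightarrow> C *\<^sub>v (A ^\<^sub>m j *\<^sub>v x) = 0\<^sub>v p"
  shows "C *\<^sub>v (A ^\<^sub>m k *\<^sub>v x) = 0\<^sub>v p"
proof -
  have next_zero: "\<forall>j<Suc (lag C A). C *\<^sub>v (A ^\<^sub>m j *\<^sub>v x) = 0\<^sub>v p"
    if x: "x \<in> carrier_vec n" and z: "\<forall>j<lag C A. C *\<^sub>v (A ^\<^sub>m j *\<^sub>v x) = 0\<^sub>v p" for x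
  proof -
    have "obs_mat C A (Suc (lag C A)) *\<^sub>v x = 0\<^sub>v (Suc (lag C A) * p)"
    proof (rule kernel_eq_if_rank_le[OF obs_mat_carrier[OF A C] obs_mat_carrier[OF A C] _ _ x])
      show "mat_rank (obs_mat C A (Suc (lag C A))) \<le> mat_rank (obs_mat C A (lag C A))"
        using lag_rank_eq by simp
      show "obs_mat C A (lag C A) *\<^sub>v x = 0\<^sub>v (lag C A * p)"
        using z unfolding obs_mat_kernel_iff[OF A C x] .
      fix v :: "real vec" assume v: "v \<in> carrier_vec n" "obs_mat C A (Suc (lag C A)) *\<^sub>v v = 0\<^sub>v (Suc (lag C A) * p)"
      show "obs_mat C A (lag C A) *\<^sub>v v = 0\<^sub>v (lag C A * p)"
        using v(2) unfolding obs_mat_kernel_iff[OF A C v(1)] by simp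
    qed
    thus ?thesis unfolding obs_mat_kernel_iff[OF A C x] .
  qed
  have "\<forall>j<lag C A. C *\<^sub>v (A ^\<^sub>m j *\<^sub>v x) = 0\<^sub>v p" using z by simp
  with x show ?thesis
  proof (induction k arbitrary: x)
    case 0
    thus ?case using next_zero[OF 0] by blast
  next
    case (Suc k)
    have Ax: "A *\<^sub>v x \<in> carrier_vec n" by (rule mult_vec_carrier[OF A])
    have "\<forall>j<lag C A. C *\<^sub>v (A ^\<^sub>m j *\<^sub>v (A *\<^sub>v x)) = 0\<^sub>v p"
    proof (intro allI impI)
      fix j assume "j < lag C A"
      hence "Suc j < Suc (lag C A)" by simp
      hence "C *\<^sub>v (A ^\<^sub>m Suc j *\<^sub>v x) = 0\<^sub>v p" using next_zero[OF Suc.prems] by blast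
      thus "C *\<^sub>v (A ^\<^sub>m j *\<^sub>v (A *\<^sub>v x)) = 0\<^sub>v p"
        unfolding pow_mat_mult_vec_Suc[OF A Suc.prems(1), of j] .
    qed
    from Suc.IH[OF Ax this] show ?case
      unfolding pow_mat_mult_vec_Suc[OF A Suc.prems(1), of k] .
  qed
qed

lemma observable_zero_state:
  assumes "observable C A" and x: "x \<in> carrier_vec n" and z: "\<And>j. j < lag C A \<Longrightarrow> C *\<^sub>v (A ^\<^sub>m j *\<^sub>v x) = 0\<^sub>v p"
  shows "x = 0\<^sub>v n"
proof -
  have "obs_mat C A n *\<^sub>v x = 0\<^sub>v (n * p)"
    unfolding obs_mat_kernel_iff[OF A C x] using obs_kernel_lag[OF x z] by blast
  moreover have "mat_rank (obs_mat C A n) = n" using assms(1) A unfolding observable_def by simp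
  ultimately show ?thesis using mat_rank_eq_cols_iff_injective[OF obs_mat_carrier[OF A C]] x by blast
qed

lemma observable_rank_lag:
  assumes "observable C A"
  shows "mat_rank (obs_mat C A (lag C A)) = n"
  unfolding mat_rank_eq_cols_iff_injective[OF obs_mat_carrier[OF A C]]
proof (intro ballI impI)
  fix x :: "real vec" assume x: "x \<in> carrier_vec n" "obs_mat C A (lag C A) *\<^sub>v x = 0\<^sub>v (lag C A * p)"
  thus "x = 0\<^sub>v n" unfolding obs_mat_kernel_iff[OF A C x(1)] by (intro observable_zero_state[OF assms]) auto
qed

end

text \<open>The state at time \<open>i\<close> when the inputs \<open>V\<close> are applied from rest.\<close>

primrec reach :: "nat \<Rightarrow> real mat \<Rightarrow> real mat \<Rightarrow> (nat \<Rightarrow> real vec) \<Rightarrow> nat \<Rightarrow> real vec" where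
  "reach n A B V 0 = 0\<^sub>v n"
| "reach n A B V (Suc i) = A *\<^sub>v reach n A B V i + B *\<^sub>v V i"

context
  fixes A B :: "real mat" and n m :: nat
  assumes A: "A \<in> carrier_mat n n" and B: "B \<in> carrier_mat n m"
begin

lemma reach_carrier [simp]: "reach n A B V i \<in> carrier_vec n"
  by (induction i) (simp_all only: reach.simps zero_carrier_vec, intro add_carrier_vec mult_vec_carrier[OF A] mult_vec_carrier[OF B])

lemma reach_prepend:
  assumes "v \<in> carrier_vec m"
  shows "reach n A B (case_nat v V) (Suc k) = A ^\<^sub>m k *\<^sub>v (B *\<^sub>v v) + reach n A B V k"
proof (induction k)
  case 0
  show ?case using A B assms mult_zero_vec[of A n] by simp
next
  case (Suc k)
  have Bv: "B *\<^sub>v v \<in> carrier_vec n" by (rule mult_vec_carrier[OF B])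
  have "reach n A B (case_nat v V) (Suc (Suc k)) = A *\<^sub>v (A ^\<^sub>m k *\<^sub>v (B *\<^sub>v v) + reach n A B V k) + B *\<^sub>v V k"
    using Suc by simp
  also have "A *\<^sub>v (A ^\<^sub>m k *\<^sub>v (B *\<^sub>v v) + reach n A B V k) = A *\<^sub>v (A ^\<^sub>m k *\<^sub>v (B *\<^sub>v v)) + A *\<^sub>v reach n A B V k"
    by (intro mult_add_distrib_mat_vec[OF A] mult_vec_carrier[OF pow_carrier_mat[OF A]] reach_carrier)
  also have "A *\<^sub>v (A ^\<^sub>m k *\<^sub>v (B *\<^sub>v v)) = A ^\<^sub>m Suc k *\<^sub>v (B *\<^sub>v v)"
    using pow_mat_mult_vec_commute[OF A Bv] pow_mat_mult_vec_Suc[OF A Bv] by simp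
  also have "A ^\<^sub>m Suc k *\<^sub>v (B *\<^sub>v v) + A *\<^sub>v reach n A B V k + B *\<^sub>v V k =
      A ^\<^sub>m Suc k *\<^sub>v (B *\<^sub>v v) + reach n A B V (Suc k)"
    unfolding reach.simps
    by (intro assoc_add_vec[of _ n] mult_vec_carrier[OF pow_carrier_mat[OF A]] mult_vec_carrier[OF A] mult_vec_carrier[OF B])
  finally show ?case .
qed

lemma ctrb_mat_carrier: "ctrb_mat A B k \<in> carrier_mat n (k * m)"
proof (induction k)
  case (Suc k)
  have "A ^\<^sub>m k * B \<in> carrier_mat n m" by (rule mult_carrier_mat[OF pow_carrier_mat[OF A] B])
  thus ?case using Suc B by (auto simp: add.commute intro!: carrier_matI)
qed (use B in simp)

text \<open>The last block of the controllability matrix carries the highest power of \<open>A\<close> and so multiplies the earliest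
input; this is why inputs are prepended in \<open>reach_prepend\<close>.\<close>

lemma ctrb_mat_Suc_mult:
  assumes "w \<in> carrier_vec (k * m)" "v \<in> carrier_vec m"
  shows "ctrb_mat A B (Suc k) *\<^sub>v (w @\<^sub>v v) = ctrb_mat A B k *\<^sub>v w + A ^\<^sub>m k *\<^sub>v (B *\<^sub>v v)"
proof -
  have AB: "A ^\<^sub>m k * B \<in> carrier_mat n m" by (rule mult_carrier_mat[OF pow_carrier_mat[OF A] B])
  have dims: "dim_col (ctrb_mat A B k) = k * m" "dim_col B = m" using ctrb_mat_carrier[of k] B by auto
  have "ctrb_mat A B (Suc k) *\<^sub>v (w @\<^sub>v v) =
      (ctrb_mat A B k *\<^sub>v w + (A ^\<^sub>m k * B) *\<^sub>v v) @\<^sub>v (0\<^sub>m 0 (k * m) *\<^sub>v w + 0\<^sub>m 0 m *\<^sub>v v)"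
    unfolding ctrb_mat.simps dims
    by (rule four_block_mat_mult_vec[OF ctrb_mat_carrier AB _ _ assms]) auto
  also have "\<dots> = ctrb_mat A B k *\<^sub>v w + (A ^\<^sub>m k * B) *\<^sub>v v"
    by (intro eq_vecI) auto
  also have "(A ^\<^sub>m k * B) *\<^sub>v v = A ^\<^sub>m k *\<^sub>v (B *\<^sub>v v)"
    using A B assms by (intro mult_mat_vec_assoc) (auto simp: pow_mat_dim_square[OF A])
  finally show ?thesis .
qed

lemma reach_ctrb:
  assumes "w \<in> carrier_vec (k * m)"
  shows "\<exists>V. (\<forall>i. V i \<in> carrier_vec m) \<and> reach n A B V k = ctrb_mat A B k *\<^sub>v w"
  using assms
proof (induction k arbitrary: w)
  case 0
  thus ?case using B by (intro exI[of _ "\<lambda>_. 0\<^sub>v m"]) (auto intro!: eq_vecI simp: scalar_prod_def)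
next
  case (Suc k)
  let ?w = "vec_first w (k * m)" and ?v = "vec_last w m"
  have w: "w = ?w @\<^sub>v ?v" using Suc.prems vec_first_last_append[of w "k * m" m] by (simp add: add.commute)
  have wc: "?w \<in> carrier_vec (k * m)" "?v \<in> carrier_vec m" by auto
  from Suc.IH[OF wc(1)] obtain V where V: "\<forall>i. V i \<in> carrier_vec m" "reach n A B V k = ctrb_mat A B k *\<^sub>v ?w"
    by blast
  have "reach n A B (case_nat ?v V) (Suc k) = A ^\<^sub>m k *\<^sub>v (B *\<^sub>v ?v) + ctrb_mat A B k *\<^sub>v ?w"
    using reach_prepend[OF wc(2)] V(2) by simp
  also have "\<dots> = ctrb_mat A B k *\<^sub>v ?w + A ^\<^sub>m k *\<^sub>v (B *\<^sub>v ?v)"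
    by (intro comm_add_vec[of _ n] mult_vec_carrier[OF pow_carrier_mat[OF A]] mult_vec_carrier[OF ctrb_mat_carrier])
  also have "\<dots> = ctrb_mat A B (Suc k) *\<^sub>v w" using ctrb_mat_Suc_mult[OF wc] w by simp
  finally have "reach n A B (case_nat ?v V) (Suc k) = ctrb_mat A B (Suc k) *\<^sub>v w" .
  moreover have "\<forall>i. case_nat ?v V i \<in> carrier_vec m" using V(1) wc(2) by (auto split: nat.split)
  ultimately show ?case by blast
qed

lemma controllable_reach:
  assumes "controllable A B" "x \<in> carrier_vec n"
  shows "\<exists>V. (\<forall>i. V i \<in> carrier_vec m) \<and> reach n A B V n = x"
proof -
  have "mat_rank (ctrb_mat A B n) = n" using assms(1) A unfolding controllable_def by simp
  then obtain w where "w \<in> carrier_vec (n * m)" "ctrb_mat A B n *\<^sub>v w = x"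
    using surjective_if_mat_rank_eq_rows[OF ctrb_mat_carrier _ assms(2)] by blast
  thus ?thesis using reach_ctrb[of w n] by blast
qed

lemma reach_zero:
  assumes "\<And>i. i < k \<Longrightarrow> V i = 0\<^sub>v m"
  shows "i \<le> k \<Longrightarrow> reach n A B V i = 0\<^sub>v n"
  using assms A B mult_zero_vec[of A n] mult_zero_vec[of B m] by (induction i) auto

lemma reach_cong: "(\<And>j. j < i \<Longrightarrow> V j = W j) \<Longrightarrow> reach n A B V i = reach n A B W i"
  by (induction i) auto

lemma reach_delay:
  assumes "\<And>i. i < k \<Longrightarrow> V i = 0\<^sub>v m"
  shows "reach n A B V (k + j) = reach n A B (\<lambda>i. V (k + i)) j"
proof -
  have "reach n A B V k = 0\<^sub>v n" by (rule reach_zero[OF assms]) auto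
  thus ?thesis by (induction j) auto
qed

end

section \<open>Superposed trajectories and saturation\<close>

locale trajectory =
  fixes m p n :: nat and A B C D :: "real mat" and u y x :: "nat \<Rightarrow> real vec" and t :: nat
  assumes A: "A \<in> carrier_mat n n" and B: "B \<in> carrier_mat n m"
    and C: "C \<in> carrier_mat p n" and D: "D \<in> carrier_mat p m"
    and u_carrier: "\<And>s. s < t \<Longrightarrow> u s \<in> carrier_vec m"
    and x_carrier: "\<And>s. s \<le> t \<Longrightarrow> x s \<in> carrier_vec n"
    and state_eq: "\<And>s. s < t \<Longrightarrow> x (Suc s) = A *\<^sub>v x s + B *\<^sub>v u s"
    and output_eq: "\<And>s. s < t \<Longrightarrow> y s = C *\<^sub>v x s + D *\<^sub>v u s"
begin

lemma wcomb_state: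
  assumes "N + j \<le> t"
  shows "wcomb n x N a (Suc j) = A *\<^sub>v wcomb n x N a j + B *\<^sub>v wcomb m u N a j"
proof -
  have c: "x (s + j) \<in> carrier_vec n" "u (s + j) \<in> carrier_vec m" if "s < N" for s
    using that assms x_carrier[of "s + j"] u_carrier[of "s + j"] by auto
  have "wcomb n x N a (Suc j) = comb n N a (\<lambda>s. A *\<^sub>v x (s + j) + B *\<^sub>v u (s + j))"
    unfolding wcomb_def using assms state_eq by (intro comb_cong) auto
  also have "\<dots> = comb n N a (\<lambda>s. A *\<^sub>v x (s + j)) + comb n N a (\<lambda>s. B *\<^sub>v u (s + j))"
    by (intro comb_add mult_vec_carrier[OF A] mult_vec_carrier[OF B])
  finally show ?thesis unfolding wcomb_def using c by (simp only: mult_comb[OF A] mult_comb[OF B])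
qed

lemma wcomb_output:
  assumes "N + j \<le> t"
  shows "wcomb p y N a j = C *\<^sub>v wcomb n x N a j + D *\<^sub>v wcomb m u N a j"
proof -
  have c: "x (s + j) \<in> carrier_vec n" "u (s + j) \<in> carrier_vec m" if "s < N" for s
    using that assms x_carrier[of "s + j"] u_carrier[of "s + j"] by auto
  have "wcomb p y N a j = comb p N a (\<lambda>s. C *\<^sub>v x (s + j) + D *\<^sub>v u (s + j))"
    unfolding wcomb_def using assms output_eq by (intro comb_cong) auto
  also have "\<dots> = comb p N a (\<lambda>s. C *\<^sub>v x (s + j)) + comb p N a (\<lambda>s. D *\<^sub>v u (s + j))"
    by (intro comb_add mult_vec_carrier[OF C] mult_vec_carrier[OF D])
  finally show ?thesis unfolding wcomb_def using c by (simp only: mult_comb[OF C] mult_comb[OF D])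
qed

lemma y_carrier: "s < t \<Longrightarrow> y s \<in> carrier_vec p"
  by (simp only: output_eq) (intro add_carrier_vec mult_vec_carrier[OF C] mult_vec_carrier[OF D])

lemma free_state:
  assumes "N + k \<le> t + 1" "\<And>j. j < k \<Longrightarrow> wcomb m u N a j = 0\<^sub>v m"
  shows "j \<le> k \<Longrightarrow> wcomb n x N a j = A ^\<^sub>m j *\<^sub>v wcomb n x N a 0"
proof (induction j)
  case 0
  show ?case using A by simp
next
  case (Suc j)
  have "wcomb n x N a (Suc j) = A *\<^sub>v wcomb n x N a j + B *\<^sub>v wcomb m u N a j"
    using Suc.prems assms(1) by (intro wcomb_state) simp
  also have "B *\<^sub>v wcomb m u N a j = 0\<^sub>v n" using Suc.prems assms(2)[of j] B mult_zero_vec[of B m] by simp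
  also have "A *\<^sub>v wcomb n x N a j + 0\<^sub>v n = A *\<^sub>v wcomb n x N a j"
    by (intro right_zero_vec mult_vec_carrier[OF A])
  also have "\<dots> = A *\<^sub>v (A ^\<^sub>m j *\<^sub>v wcomb n x N a 0)" using Suc by simp
  also have "\<dots> = A ^\<^sub>m Suc j *\<^sub>v wcomb n x N a 0"
    using pow_mat_mult_vec_commute[OF A wcomb_carrier] pow_mat_mult_vec_Suc[OF A wcomb_carrier] by simp
  finally show ?case .
qed

lemma free_output:
  assumes "N + k \<le> t + 1" "\<And>j. j < k \<Longrightarrow> wcomb m u N a j = 0\<^sub>v m" "j < k"
  shows "wcomb p y N a j = C *\<^sub>v (A ^\<^sub>m j *\<^sub>v wcomb n x N a 0)"
proof -
  have "wcomb p y N a j = C *\<^sub>v wcomb n x N a j + D *\<^sub>v wcomb m u N a j"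
    using assms(1,3) by (intro wcomb_output) simp
  also have "D *\<^sub>v wcomb m u N a j = 0\<^sub>v p" using assms(2,3) D mult_zero_vec[of D m] by simp
  also have "C *\<^sub>v wcomb n x N a j + 0\<^sub>v p = C *\<^sub>v wcomb n x N a j"
    by (intro right_zero_vec mult_vec_carrier[OF C])
  finally show ?thesis using free_state[OF assms(1,2), of j] assms(3) by simp
qed

lemma zero_window_unobservable:
  assumes "N + k \<le> t + 1" "lag C A \<le> k"
    and "\<And>j. j < k \<Longrightarrow> wcomb p y N a j = 0\<^sub>v p \<and> wcomb m u N a j = 0\<^sub>v m"
  shows "C *\<^sub>v (A ^\<^sub>m j *\<^sub>v wcomb n x N a 0) = 0\<^sub>v p"
proof (rule obs_kernel_lag[OF A C wcomb_carrier])
  fix j assume "j < lag C A"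
  hence j: "j < k" using assms(2) by simp
  have "wcomb p y N a j = C *\<^sub>v (A ^\<^sub>m j *\<^sub>v wcomb n x N a 0)"
    by (rule free_output[OF assms(1) _ j]) (use assms(3) in blast)
  thus "C *\<^sub>v (A ^\<^sub>m j *\<^sub>v wcomb n x N a 0) = 0\<^sub>v p" using assms(3)[OF j] by simp
qed

text \<open>A superposed window with zero inputs and outputs starts in the unobservable subspace as soon as it is at
least as long as the lag. Consequently, a nonzero output after a zero window forces every explaining system
to have greater lag.\<close>

lemma zero_window_next_output:
  assumes "N + k \<le> t" "lag C A \<le> k"
    and "\<And>j. j < k \<Longrightarrow> wcomb p y N a j = 0\<^sub>v p \<and> wcomb m u N a j = 0\<^sub>v m" "wcomb m u N a k = 0\<^sub>v m"
  shows "wcomb p y N a k = 0\<^sub>v p"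
proof -
  have "wcomb p y N a k = C *\<^sub>v (A ^\<^sub>m k *\<^sub>v wcomb n x N a 0)"
    by (rule free_output[of N "Suc k"]) (use assms in \<open>auto simp: less_Suc_eq\<close>)
  also have "\<dots> = 0\<^sub>v p" using assms(1,2,3) by (intro zero_window_unobservable[of N k]) auto
  finally show ?thesis .
qed

lemma zero_window_zero_state:
  assumes "observable C A" "N + k \<le> t + 1" "lag C A \<le> k"
    and "\<And>j. j < k \<Longrightarrow> wcomb p y N a j = 0\<^sub>v p \<and> wcomb m u N a j = 0\<^sub>v m"
  shows "wcomb n x N a 0 = 0\<^sub>v n"
  by (rule observable_zero_state[OF A C assms(1) wcomb_carrier]) (rule zero_window_unobservable[OF assms(2-)])

text \<open>The superpositions may use different numbers of columns, because the data contain fewer windows of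
greater length.\<close>

lemma state_determined:
  assumes "observable C A" "N + k \<le> t + 1" "lag C A \<le> k" "M \<le> N"
    and "\<And>j. j < k \<Longrightarrow> wcomb p y M b j = wcomb p y N a j \<and> wcomb m u M b j = wcomb m u N a j"
  shows "wcomb n x M b 0 = wcomb n x N a 0"
proof -
  \<comment> \<open>Extension by zero puts both superpositions on the same columns.\<close>
  define b' where "b' s = (if s < M then b s else 0)" for s
  have b': "wcomb q f N b' j = wcomb q f M b j" for q f j
    using wcomb_mono[OF assms(4), of b' q f j] wcomb_cong[of M b' b f j f q] by (simp add: b'_def)
  have "wcomb n x N (\<lambda>s. b' s - a s) 0 = 0\<^sub>v n"
    using assms(5) by (intro zero_window_zero_state[OF assms(1-3)]) (simp_all add: wcomb_diff b')
  hence "wcomb n x M b 0 - wcomb n x N a 0 = 0\<^sub>v n" by (simp add: wcomb_diff b')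
  thus ?thesis by (rule eq_if_minus_eq_zero[rotated 2]) simp_all
qed

end

text \<open>Every superposed window of length \<open>k\<close> can be prolonged by any input to a superposed window of length
\<open>k + 1\<close>. The data contain \<open>t - k + 1\<close> windows of the former length and \<open>t - k\<close> of the latter.\<close>

definition saturated :: "nat \<Rightarrow> nat \<Rightarrow> (nat \<Rightarrow> real vec) \<Rightarrow> (nat \<Rightarrow> real vec) \<Rightarrow> nat \<Rightarrow> nat \<Rightarrow> bool" where
  "saturated m p u y t k \<longleftrightarrow> (\<forall>a. \<forall>v\<in>carrier_vec m. \<exists>b.
     (\<forall>j<k. wcomb p y (t - k) b j = wcomb p y (t - k + 1) a j \<and> wcomb m u (t - k) b j = wcomb m u (t - k + 1) a j) \<and>
     wcomb m u (t - k) b k = v)"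

lemma saturatedD:
  assumes "saturated m p u y t k" "v \<in> carrier_vec m"
  shows "\<exists>b. (\<forall>j<k. wcomb p y (t - k) b j = wcomb p y (t - k + 1) a j \<and> wcomb m u (t - k) b j = wcomb m u (t - k + 1) a j) \<and>
     wcomb m u (t - k) b k = v"
  using assms unfolding saturated_def by blast

text \<open>Write a window as a superposition of all but the last column plus a multiple of the last one. The last column is the
shift of the last column of the longer windows, so saturation at depth \<open>k + 1\<close> applies to it with a
correction of the prescribed input.\<close>

lemma saturated_Suc:
  assumes sat: "saturated m p u y t (Suc k)" and k: "Suc k < t"
    and u: "\<And>s. s < t \<Longrightarrow> u s \<in> carrier_vec m" and y: "\<And>s. s < t \<Longrightarrow> y s \<in> carrier_vec p"
  shows "saturated m p u y t k"
  unfolding saturated_def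
proof (intro allI ballI)
  fix a :: "nat \<Rightarrow> real" and v :: "real vec" assume v: "v \<in> carrier_vec m"
  define N where "N = t - Suc k"
  have N: "t - Suc k = N" "t - k = Suc N" "N + k < t" "0 < N" using k by (simp_all add: N_def)
  \<comment> \<open>The last window is treated separately, with its coefficient moved to the preceding start time.\<close>
  define a' :: "nat \<Rightarrow> real" where "a' s = (if s = Suc N then 0 else a s)" for s
  define e :: "nat \<Rightarrow> real" where "e s = (if s = N then a (Suc N) else 0)" for s
  have vc: "v - wcomb m u (Suc N) a' k \<in> carrier_vec m" using v by simp
  obtain b where b': "\<And>j. j < Suc k \<Longrightarrow> wcomb p y (t - Suc k) b j = wcomb p y (t - Suc k + 1) e j \<and>
      wcomb m u (t - Suc k) b j = wcomb m u (t - Suc k + 1) e j"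
    "wcomb m u (t - Suc k) b (Suc k) = v - wcomb m u (Suc N) a' k"
    using saturatedD[OF sat vc, of e] by blast
  have b: "\<forall>j<Suc k. wcomb p y N b j = wcomb p y (Suc N) e j \<and> wcomb m u N b j = wcomb m u (Suc N) e j"
    "wcomb m u N b (Suc k) = v - wcomb m u (Suc N) a' k"
    using b' unfolding N(1) by simp_all
  \<comment> \<open>\<open>case_nat 0 b\<close> is the prolongation of the last window with its first entry dropped.\<close>
  let ?b = "\<lambda>s. a' s + case_nat 0 b s"
  have split: "wcomb q f (Suc (Suc N)) a j = wcomb q f (Suc N) a' j + wcomb q f (Suc N) e (Suc j)"
    if "\<And>s. s < t \<Longrightarrow> f s \<in> carrier_vec q" "j < k" for q f j
  proof -
    have fc: "f (N + Suc j) \<in> carrier_vec q" using that N(3) by simp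
    have "wcomb q f (Suc (Suc N)) a j = wcomb q f (Suc (Suc N)) (\<lambda>s. a' s + (if s = Suc N then a (Suc N) else 0)) j"
      by (rule wcomb_cong) (auto simp: a'_def)
    also have "\<dots> = wcomb q f (Suc (Suc N)) a' j + a (Suc N) \<cdot>\<^sub>v f (Suc N + j)"
      using fc by (subst wcomb_add, subst wcomb_unit) auto
    also have "wcomb q f (Suc (Suc N)) a' j = wcomb q f (Suc N) a' j" by (rule wcomb_mono) (auto simp: a'_def)
    also have "a (Suc N) \<cdot>\<^sub>v f (Suc N + j) = wcomb q f (Suc N) e (Suc j)"
      unfolding e_def using fc by (subst wcomb_unit) auto
    finally show ?thesis .
  qed
  show "\<exists>b. (\<forall>j<k. wcomb p y (t - k) b j = wcomb p y (t - k + 1) a j \<and> wcomb m u (t - k) b j = wcomb m u (t - k + 1) a j) \<and>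
      wcomb m u (t - k) b k = v"
  proof (intro exI conjI allI impI)
    fix j assume j: "j < k"
    show "wcomb p y (t - k) ?b j = wcomb p y (t - k + 1) a j"
      unfolding N(2) wcomb_add wcomb_shift using b(1) j split[OF y j] by simp
    show "wcomb m u (t - k) ?b j = wcomb m u (t - k + 1) a j"
      unfolding N(2) wcomb_add wcomb_shift using b(1) j split[OF u j] by simp
  next
    show "wcomb m u (t - k) ?b k = v"
      unfolding N(2) wcomb_add wcomb_shift b(2) using v by (intro eq_vecI) auto
  qed
qed

lemma saturated_mono:
  assumes "saturated m p u y t k" "j \<le> k" "k < t"
    and "\<And>s. s < t \<Longrightarrow> u s \<in> carrier_vec m" "\<And>s. s < t \<Longrightarrow> y s \<in> carrier_vec p"
  shows "saturated m p u y t j"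
  using assms(2,1,3)
proof (induction k rule: dec_induct)
  case (step k)
  thus ?case using saturated_Suc[OF _ _ assms(4,5)] by simp
qed

text \<open>Starting from the zero window, prolong by the next input and drop the first entry, over and over. The
initial \<open>k\<close> zeros in \<open>V\<close> make the zero window the first one. The same coefficients serve all observable
explaining systems at once, which is what makes their states comparable.\<close>

lemma saturated_follow:
  assumes sat: "saturated m p u y t k" and k: "k < t"
    and V: "\<And>i. V i \<in> carrier_vec m" "\<forall>i<k. V i = 0\<^sub>v m"
  shows "\<exists>a. (\<forall>j<k. wcomb m u (t - k + 1) a j = V (i + j)) \<and>
    (\<forall>n A B C D x. trajectory m p n A B C D u y x t \<longrightarrow> observable C A \<longrightarrow> lag C A \<le> k \<longrightarrow>
       wcomb n x (t - k + 1) a 0 = reach n A B V i)"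
proof (induction i)
  case 0
  show ?case using V(2) by (intro exI[of _ "\<lambda>_. 0"]) (simp add: wcomb_zero)
next
  case (Suc i)
  then obtain a where a: "\<And>j. j < k \<Longrightarrow> wcomb m u (t - k + 1) a j = V (i + j)"
    "\<And>n A B C D x. trajectory m p n A B C D u y x t \<Longrightarrow> observable C A \<Longrightarrow> lag C A \<le> k \<Longrightarrow>
       wcomb n x (t - k + 1) a 0 = reach n A B V i" by blast
  obtain b where b: "\<And>j. j < k \<Longrightarrow> wcomb p y (t - k) b j = wcomb p y (t - k + 1) a j \<and> wcomb m u (t - k) b j = wcomb m u (t - k + 1) a j"
    "wcomb m u (t - k) b k = V (i + k)"
    using saturatedD[OF sat V(1)[of "i + k"], of a] by blast
  have bu: "wcomb m u (t - k) b j = V (i + j)" if "j \<le> k" for j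
    using that a(1)[of j] b by (cases "j = k") auto
  show ?case
  proof (intro exI[of _ "case_nat 0 b"] conjI allI impI)
    fix j assume "j < k"
    thus "wcomb m u (t - k + 1) (case_nat 0 b) j = V (Suc i + j)"
      using bu[of "Suc j"] by (simp add: wcomb_shift)
  next
    fix n A B C D x assume tr: "trajectory m p n A B C D u y x t" and ob: "observable C A" "lag C A \<le> k"
    interpret trajectory m p n A B C D u y x t by (rule tr)
    have "wcomb n x (t - k) b 0 = wcomb n x (t - k + 1) a 0"
      using k b(1) by (intro state_determined[OF ob(1) _ ob(2)]) auto
    hence "wcomb n x (t - k) b 0 = reach n A B V i" using a(2)[OF tr ob] by simp
    moreover have "wcomb n x (t - k + 1) (case_nat 0 b) 0 = A *\<^sub>v wcomb n x (t - k) b 0 + B *\<^sub>v wcomb m u (t - k) b 0"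
      using wcomb_state[of "t - k" 0 b] by (simp add: wcomb_shift)
    ultimately show "wcomb n x (t - k + 1) (case_nat 0 b) 0 = reach n A B V (Suc i)"
      using bu[of 0] by simp
  qed
qed

lemma saturated_zero_state_any_input:
  assumes sat: "saturated m p u y t k" and k: "k < t" and z: "\<And>j. z j \<in> carrier_vec m"
  shows "\<exists>a. (\<forall>j<k. wcomb m u (t - k + 1) a j = z j) \<and>
    (\<forall>n A B C D x. trajectory m p n A B C D u y x t \<longrightarrow> observable C A \<longrightarrow> lag C A \<le> k \<longrightarrow>
       wcomb n x (t - k + 1) a 0 = 0\<^sub>v n)"
proof -
  define V where "V i = (if i < k then 0\<^sub>v m else z (i - k))" for i
  have Vc: "V i \<in> carrier_vec m" for i using z by (simp add: V_def)
  have V0: "\<forall>i<k. V i = 0\<^sub>v m" by (simp add: V_def)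
  obtain a where a: "\<forall>j<k. wcomb m u (t - k + 1) a j = V (k + j)"
    "\<forall>n A B C D x. trajectory m p n A B C D u y x t \<longrightarrow> observable C A \<longrightarrow> lag C A \<le> k \<longrightarrow>
       wcomb n x (t - k + 1) a 0 = reach n A B V k"
    using saturated_follow[where V = V and i = k, OF sat k Vc V0] by blast
  have r: "reach n A B V k = 0\<^sub>v n" if tr: "trajectory m p n A B C D u y x t" for n A B C D x
    by (rule reach_zero[OF trajectory.A[OF tr] trajectory.B[OF tr], of k]) (auto simp: V0)
  show ?thesis
  proof (intro exI[of _ a] conjI allI impI)
    show "wcomb m u (t - k + 1) a j = z j" if "j < k" for j using a(1) that by (simp add: V_def)
    show "wcomb n x (t - k + 1) a 0 = 0\<^sub>v n"
      if "trajectory m p n A B C D u y x t" "observable C A" "lag C A \<le> k" for n A B C D x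
      using a(2) that r[OF that(1)] by metis
  qed
qed

text \<open>Apply \<open>k\<close> zero inputs, then inputs that steer from rest to \<open>\<xi>\<close>, then the inputs \<open>z\<close>: the window at the end of the
second phase is the desired one.\<close>

lemma (in trajectory) saturated_full:
  assumes sat: "saturated m p u y t k" and k: "k < t"
    and min: "controllable A B" "observable C A" "lag C A \<le> k"
    and xi: "\<xi> \<in> carrier_vec n" and z: "\<And>j. z j \<in> carrier_vec m"
  shows "\<exists>a. wcomb n x (t - k + 1) a 0 = \<xi> \<and> (\<forall>j<k. wcomb m u (t - k + 1) a j = z j)"
proof -
  obtain W where W: "\<And>i. W i \<in> carrier_vec m" "reach n A B W n = \<xi>"
    using controllable_reach[OF A B min(1) xi] by blast
  \<comment> \<open>The second phase takes \<open>n\<close> steps, which suffice to reach any state.\<close>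
  define V where "V i = (if i < k then 0\<^sub>v m else if i < k + n then W (i - k) else z (i - (k + n)))" for i
  have Vc: "V i \<in> carrier_vec m" for i using W z by (simp add: V_def)
  have V0: "\<forall>i<k. V i = 0\<^sub>v m" by (simp add: V_def)
  have "reach n A B V (k + n) = reach n A B (\<lambda>i. V (k + i)) n"
    by (rule reach_delay[OF A B]) (use V0 in blast)
  also have "\<dots> = reach n A B W n" by (rule reach_cong[OF A B]) (simp add: V_def)
  finally have r: "reach n A B V (k + n) = \<xi>" using W(2) by simp
  from saturated_follow[where V = V and i = "k + n", OF sat k Vc V0] obtain a
    where a1: "\<forall>j<k. wcomb m u (t - k + 1) a j = V (k + n + j)"
    and a2: "\<forall>n' A B C D x. trajectory m p n' A B C D u y x t \<longrightarrow> observable C A \<longrightarrow> lag C A \<le> k \<longrightarrow>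
       wcomb n' x (t - k + 1) a 0 = reach n' A B V (k + n)" by (elim exE conjE) (rule that)
  note a = a1 a2[rule_format, OF trajectory_axioms min(2,3)]
  have "wcomb m u (t - k + 1) a j = z j" if "j < k" for j using a(1) that by (simp add: V_def)
  thus ?thesis using a(2) r by (intro exI[of _ a]) simp
qed

lemma (in trajectory) saturated_full_Suc:
  assumes sat: "saturated m p u y t k" and k: "k < t"
    and min: "controllable A B" "observable C A" "lag C A \<le> k"
    and xi: "\<xi> \<in> carrier_vec n" and z: "\<And>j. z j \<in> carrier_vec m"
  shows "\<exists>b. wcomb n x (t - k) b 0 = \<xi> \<and> (\<forall>j\<le>k. wcomb m u (t - k) b j = z j)"
proof -
  from saturated_full[where z = z, OF sat k min xi z]
  obtain a where a1: "wcomb n x (t - k + 1) a 0 = \<xi>" and a2: "\<forall>j<k. wcomb m u (t - k + 1) a j = z j"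
    by (elim exE conjE) (rule that)
  from saturatedD[OF sat z[of k], of a]
  obtain b where b1: "\<forall>j<k. wcomb p y (t - k) b j = wcomb p y (t - k + 1) a j \<and> wcomb m u (t - k) b j = wcomb m u (t - k + 1) a j"
    and b2: "wcomb m u (t - k) b k = z k"
    by (elim exE conjE) (rule that)
  note a = a1 a2[rule_format] and b = b1[rule_format] b2
  have "wcomb n x (t - k) b 0 = wcomb n x (t - k + 1) a 0"
    using k b(1) by (intro state_determined[OF min(2) _ min(3)]) auto
  hence "wcomb n x (t - k) b 0 = \<xi>" using a(1) by simp
  moreover have "wcomb m u (t - k) b j = z j" if "j \<le> k" for j
    using that a(2)[of j] b(1)[of j] b(2) by (cases "j = k") simp_all
  ultimately show ?thesis by (intro exI[of _ b]) simp
qed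

section \<open>Saturation in terms of ranks\<close>

text \<open>Block-diagonal matrix whose column space consists of all superposed windows of length \<open>k\<close> followed by an
arbitrary input. It contains the column space of \<open>G_mat\<close>, and the exit test of the inner loop says that the two ranks agree.\<close>

definition GH_mat :: "nat \<Rightarrow> nat \<Rightarrow> nat \<Rightarrow> real vec list \<Rightarrow> real vec list \<Rightarrow> real mat" where
  "GH_mat m p k us ys = four_block_mat (H_mat m p (k - 1) us ys) (0\<^sub>m (k * p + k * m) m)
     (0\<^sub>m m (length us - k + 1)) (1\<^sub>m m)"

context
  fixes m p k t :: nat and us ys :: "real vec list"
  assumes k: "1 \<le> k" "k < t" and t: "length us = t"
begin

lemma H_prev_carrier: "H_mat m p (k - 1) us ys \<in> carrier_mat (k * p + k * m) (t - k + 1)"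
proof -
  have "k - 1 < length us" "length us - (k - 1) = t - k + 1" "k - 1 + 1 = k" using k t by simp_all
  thus ?thesis using H_mat_carrier[of "k - 1" us m p ys] by (simp only:)
qed

lemma H_prev_mult:
  "H_mat m p (k - 1) us ys *\<^sub>v vec (t - k + 1) a =
    stack p k (wcomb p ((!) ys) (t - k + 1) a) @\<^sub>v stack m k (wcomb m ((!) us) (t - k + 1) a)"
proof -
  have "k - 1 < length us" "length us - (k - 1) = t - k + 1" "k - 1 + 1 = k" using k t by simp_all
  thus ?thesis using H_mat_mult[of "k - 1" us m p ys a] by (simp only:)
qed

lemma GH_carrier: "GH_mat m p k us ys \<in> carrier_mat (k * p + k * m + m) (t - k + 1 + m)"
  unfolding GH_mat_def t by (intro four_block_carrier_mat H_prev_carrier) simp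

lemma GH_mult:
  assumes "v \<in> carrier_vec m"
  shows "GH_mat m p k us ys *\<^sub>v (vec (t - k + 1) a @\<^sub>v v) =
    (stack p k (wcomb p ((!) ys) (t - k + 1) a) @\<^sub>v stack m k (wcomb m ((!) us) (t - k + 1) a)) @\<^sub>v v"
proof -
  have "GH_mat m p k us ys *\<^sub>v (vec (t - k + 1) a @\<^sub>v v) =
     (H_mat m p (k - 1) us ys *\<^sub>v vec (t - k + 1) a + 0\<^sub>m (k * p + k * m) m *\<^sub>v v) @\<^sub>v
     (0\<^sub>m m (t - k + 1) *\<^sub>v vec (t - k + 1) a + 1\<^sub>m m *\<^sub>v v)"
    unfolding GH_mat_def t
    by (rule four_block_mat_mult_vec[OF H_prev_carrier]) (use assms in auto)
  also have "H_mat m p (k - 1) us ys *\<^sub>v vec (t - k + 1) a + 0\<^sub>m (k * p + k * m) m *\<^sub>v v =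
     H_mat m p (k - 1) us ys *\<^sub>v vec (t - k + 1) a"
    unfolding H_prev_mult using assms by (intro eq_vecI) auto
  also have "0\<^sub>m m (t - k + 1) *\<^sub>v vec (t - k + 1) a + 1\<^sub>m m *\<^sub>v v = v"
    using assms by (intro eq_vecI) auto
  finally show ?thesis unfolding H_prev_mult .
qed

lemma G_carrier: "G_mat m p k us ys \<in> carrier_mat (k * p + k * m + m) (t - k)"
  using G_mat_carrier[of k us m p ys] k t by (simp add: algebra_simps)

lemma G_mult:
  "G_mat m p k us ys *\<^sub>v vec (t - k) b =
    (stack p k (wcomb p ((!) ys) (t - k) b) @\<^sub>v stack m k (wcomb m ((!) us) (t - k) b)) @\<^sub>v wcomb m ((!) us) (t - k) b k"
proof -
  have "G_mat m p k us ys *\<^sub>v vec (t - k) b =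
     stack p k (wcomb p ((!) ys) (t - k) b) @\<^sub>v (stack m k (wcomb m ((!) us) (t - k) b) @\<^sub>v wcomb m ((!) us) (t - k) b k)"
    using G_mat_mult[of k us m p ys b] k t by (simp add: stack_Suc)
  also have "\<dots> = (stack p k (wcomb p ((!) ys) (t - k) b) @\<^sub>v stack m k (wcomb m ((!) us) (t - k) b)) @\<^sub>v wcomb m ((!) us) (t - k) b k"
    by (rule eq_vecI) auto
  finally show ?thesis .
qed

lemma stacked_eq_iff:
  "stack p k (wcomb p ((!) ys) N a) @\<^sub>v stack m k (wcomb m ((!) us) N a) = stack p k (wcomb p ((!) ys) M b) @\<^sub>v stack m k (wcomb m ((!) us) M b) \<longleftrightarrow>
    (\<forall>j<k. wcomb p ((!) ys) N a j = wcomb p ((!) ys) M b j \<and> wcomb m ((!) us) N a j = wcomb m ((!) us) M b j)"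
  by (subst append_vec_eq[of _ "k * p"]) (auto simp: stack_eq_iff)

lemma GH_eq_G_iff:
  assumes "v \<in> carrier_vec m"
  shows "G_mat m p k us ys *\<^sub>v vec (t - k) b = GH_mat m p k us ys *\<^sub>v (vec (t - k + 1) a @\<^sub>v v) \<longleftrightarrow>
    (\<forall>j<k. wcomb p ((!) ys) (t - k) b j = wcomb p ((!) ys) (t - k + 1) a j \<and> wcomb m ((!) us) (t - k) b j = wcomb m ((!) us) (t - k + 1) a j) \<and>
    wcomb m ((!) us) (t - k) b k = v"
proof -
  have "stack p k (wcomb p ((!) ys) (t - k) b) @\<^sub>v stack m k (wcomb m ((!) us) (t - k) b) \<in> carrier_vec (k * p + k * m)"
    "stack p k (wcomb p ((!) ys) (t - k + 1) a) @\<^sub>v stack m k (wcomb m ((!) us) (t - k + 1) a) \<in> carrier_vec (k * p + k * m)"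
    by (intro append_carrier_vec stack_carrier)+
  from append_vec_eq[OF this] show ?thesis unfolding G_mult GH_mult[OF assms] stacked_eq_iff .
qed

lemma mat_rank_GH: "mat_rank (GH_mat m p k us ys) = m + mat_rank (H_mat m p (k - 1) us ys)"
  unfolding GH_mat_def t using mat_rank_diag_one[OF H_prev_carrier] by simp

lemma saturated_if_rank:
  assumes rk: "\<not> mat_rank (G_mat m p k us ys) < m + mat_rank (H_mat m p (k - 1) us ys)"
  shows "saturated m p ((!) us) ((!) ys) t k"
  unfolding saturated_def
proof (intro allI ballI)
  fix a and v :: "real vec" assume v: "v \<in> carrier_vec m"
  have "\<exists>b\<in>carrier_vec (t - k). G_mat m p k us ys *\<^sub>v b = GH_mat m p k us ys *\<^sub>v (vec (t - k + 1) a @\<^sub>v v)"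
  proof (rule image_eq_if_rank_le[OF GH_carrier G_carrier])
    show "mat_rank (GH_mat m p k us ys) \<le> mat_rank (G_mat m p k us ys)"
      using rk unfolding mat_rank_GH by simp
    show "vec (t - k + 1) a @\<^sub>v v \<in> carrier_vec (t - k + 1 + m)"
      using v by (intro append_carrier_vec) auto
    fix w :: "real vec" assume "w \<in> carrier_vec (t - k)"
    then obtain b where b: "w = vec (t - k) b" using vec_eta by blast
    let ?b = "\<lambda>s. if s < t - k then b s else 0"
    have ext: "wcomb q f (t - k) b j = wcomb q f (t - k + 1) ?b j" for q f j
      using wcomb_mono[of "t - k" "t - k + 1" ?b q f j] wcomb_cong[of "t - k" b ?b f j f q] by simp
    have "G_mat m p k us ys *\<^sub>v w = GH_mat m p k us ys *\<^sub>v (vec (t - k + 1) ?b @\<^sub>v wcomb m ((!) us) (t - k) b k)"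
      unfolding b by (subst GH_eq_G_iff) (simp_all add: ext)
    moreover have "vec (t - k + 1) ?b @\<^sub>v wcomb m ((!) us) (t - k) b k \<in> carrier_vec (t - k + 1 + m)"
      by (intro append_carrier_vec) auto
    ultimately show "\<exists>x\<in>carrier_vec (t - k + 1 + m). GH_mat m p k us ys *\<^sub>v x = G_mat m p k us ys *\<^sub>v w"
      by metis
  qed
  then obtain b where "G_mat m p k us ys *\<^sub>v vec (t - k) b = GH_mat m p k us ys *\<^sub>v (vec (t - k + 1) a @\<^sub>v v)"
    using vec_eta by metis
  thus "\<exists>b. (\<forall>j<k. wcomb p ((!) ys) (t - k) b j = wcomb p ((!) ys) (t - k + 1) a j \<and> wcomb m ((!) us) (t - k) b j = wcomb m ((!) us) (t - k + 1) a j) \<and>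
     wcomb m ((!) us) (t - k) b k = v"
    unfolding GH_eq_G_iff[OF v] by blast
qed

text \<open>If the ranks differ, some functional vanishes on the columns of \<open>G_mat\<close> but not on all windows followed by arbitrary
inputs. Here \<open>g\<close> is its part on the last input and \<open>h s\<close> the value of the remaining part on the
window starting at \<open>s\<close>. The last window is the only one without a known next input, which explains the final
disjunction: if \<open>g\<close> vanishes, it is this window that violates the relation.\<close>

lemma violated_relation:
  assumes rk: "mat_rank (G_mat m p k us ys) < m + mat_rank (H_mat m p (k - 1) us ys)"
    and uc: "\<And>s. s < t \<Longrightarrow> us ! s \<in> carrier_vec m"
  obtains g h where "g \<in> carrier_vec m"
    "\<And>a. (\<forall>j<k. wcomb p ((!) ys) (t - k + 1) a j = 0\<^sub>v p \<and> wcomb m ((!) us) (t - k + 1) a j = 0\<^sub>v m) \<Longrightarrow> (\<Sum>s<t - k + 1. a s * h s) = 0"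
    "\<And>s. s < t - k \<Longrightarrow> h s + g \<bullet> us ! (s + k) = 0"
    "g \<noteq> 0\<^sub>v m \<or> h (t - k) \<noteq> 0"
proof -
  let ?G = "G_mat m p k us ys" and ?M = "GH_mat m p k us ys" and ?H = "H_mat m p (k - 1) us ys"
  let ?r = "k * p + k * m"
  obtain f where f: "f \<in> carrier_vec (?r + m)" "\<forall>v\<in>carrier_vec (t - k). f \<bullet> (?G *\<^sub>v v) = 0"
    "\<exists>w\<in>carrier_vec (t - k + 1 + m). f \<bullet> (?M *\<^sub>v w) \<noteq> 0"
    using separating_functional[OF GH_carrier G_carrier] rk unfolding mat_rank_GH by blast
  define f1 g where "f1 = vec_first f ?r" and "g = vec_last f m"
  have fg: "f = f1 @\<^sub>v g" "f1 \<in> carrier_vec ?r" "g \<in> carrier_vec m"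
    using f(1) by (auto simp: f1_def g_def)
  define h where "h s = (transpose_mat ?H *\<^sub>v f1) $ s" for s
  have lin: "f1 \<bullet> (?H *\<^sub>v vec (t - k + 1) a) = (\<Sum>s<t - k + 1. a s * h s)" for a
  proof -
    have "f1 \<bullet> (?H *\<^sub>v vec (t - k + 1) a) = (transpose_mat ?H *\<^sub>v f1) \<bullet> vec (t - k + 1) a"
      using transpose_vec_mult_scalar[OF H_prev_carrier _ fg(2), of "vec (t - k + 1) a"] by simp
    also have "\<dots> = (\<Sum>s<t - k + 1. a s * h s)"
      unfolding h_def scalar_prod_def lessThan_atLeast0 by (auto intro!: sum.cong)
    finally show ?thesis .
  qed
  have dec: "f \<bullet> (X @\<^sub>v v) = f1 \<bullet> X + g \<bullet> v" if "X \<in> carrier_vec ?r" "v \<in> carrier_vec m" for X v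
    unfolding fg(1) using scalar_prod_append[OF fg(2,3) that] .
  have Xc: "stack p k (wcomb p ((!) ys) N a) @\<^sub>v stack m k (wcomb m ((!) us) N a) \<in> carrier_vec ?r" for N a
    by (intro append_carrier_vec stack_carrier)
  have hs: "h s + g \<bullet> us ! (s + k) = 0" if s: "s < t - k" for s
  proof -
    let ?e = "\<lambda>r. if r = s then 1 else (0 :: real)"
    have ext: "wcomb q f (t - k) ?e j = wcomb q f (t - k + 1) ?e j" for q f j
      using s by (intro wcomb_mono[symmetric]) auto
    have uk: "wcomb m ((!) us) (t - k) ?e k = us ! (s + k)"
      using s uc[of "s + k"] by (subst wcomb_unit) auto
    have "0 = f \<bullet> (?G *\<^sub>v vec (t - k) ?e)" using f(2) by simp
    also have "\<dots> = f1 \<bullet> (stack p k (wcomb p ((!) ys) (t - k) ?e) @\<^sub>v stack m k (wcomb m ((!) us) (t - k) ?e)) + g \<bullet> us ! (s + k)"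
      unfolding G_mult uk using s uc[of "s + k"] by (intro dec Xc) auto
    also have "stack p k (wcomb p ((!) ys) (t - k) ?e) @\<^sub>v stack m k (wcomb m ((!) us) (t - k) ?e) = ?H *\<^sub>v vec (t - k + 1) ?e"
      unfolding H_prev_mult stacked_eq_iff by (simp add: ext)
    also have "f1 \<bullet> \<dots> = h s"
    proof -
      have "(\<Sum>r<t - k + 1. ?e r * h r) = (\<Sum>r<t - k + 1. if r = s then h r else 0)"
        by (intro sum.cong) auto
      also have "\<dots> = h s" using s by simp
      finally show ?thesis unfolding lin .
    qed
    finally show ?thesis by simp
  qed
  have "g \<noteq> 0\<^sub>v m \<or> h (t - k) \<noteq> 0"
  proof (rule ccontr)
    assume "\<not> ?thesis"
    hence g0: "g = 0\<^sub>v m" and ht: "h (t - k) = 0" by auto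
    have h0: "h s = 0" if "s < t - k + 1" for s
    proof (cases "s = t - k")
      case False
      hence "s < t - k" using that by simp
      thus ?thesis using hs[of s] uc[of "s + k"] g0 by simp
    qed (use ht in simp)
    obtain w where w: "w \<in> carrier_vec (t - k + 1 + m)" "f \<bullet> (?M *\<^sub>v w) \<noteq> 0" using f(3) by blast
    obtain a where a: "vec_first w (t - k + 1) = vec (t - k + 1) a" using vec_eta[of "vec_first w (t - k + 1)" "t - k + 1"] by auto
    have v: "vec_last w m \<in> carrier_vec m" by simp
    have "w = vec (t - k + 1) a @\<^sub>v vec_last w m" using w(1) a by (metis vec_first_last_append)
    hence "f \<bullet> (?M *\<^sub>v w) = f1 \<bullet> (?H *\<^sub>v vec (t - k + 1) a) + g \<bullet> vec_last w m"
      using GH_mult[OF v, of a] dec[OF Xc v] H_prev_mult by metis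
    also have "\<dots> = 0" unfolding lin using h0 g0 v by simp
    finally show False using w(2) by simp
  qed
  moreover have "(\<Sum>s<t - k + 1. a s * h s) = 0"
    if "\<forall>j<k. wcomb p ((!) ys) (t - k + 1) a j = 0\<^sub>v p \<and> wcomb m ((!) us) (t - k + 1) a j = 0\<^sub>v m" for a
  proof -
    have "?H *\<^sub>v vec (t - k + 1) a = 0\<^sub>v ?r"
      unfolding H_prev_mult using that by (subst append_vec_eq_zero_iff) (auto simp: stack_eq_zero_iff)
    thus ?thesis using lin[of a] fg(2) by simp
  qed
  ultimately show thesis using that[OF fg(3)] hs by blast
qed

end

text \<open>The direction space is the kernel of a nonzero one-row matrix. Gauss elimination keeps the kernel and leaves one
nonzero row, so the dimension is \<open>m - 1\<close>.\<close>

lemma hyperplane_affine: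
  assumes f: "f \<in> carrier_vec m" "f \<noteq> 0\<^sub>v m"
  shows "affine_of_dim m (m - 1) {v \<in> carrier_vec m. f \<bullet> v = c}"
proof -
  define F where "F = mat_of_row f"
  have F: "F \<in> carrier_mat 1 m" using f by (simp add: F_def)
  have Fv: "F *\<^sub>v v = 0\<^sub>v 1 \<longleftrightarrow> f \<bullet> v = 0" if "v \<in> carrier_vec m" for v
    using f by (auto simp: F_def vec_eq_iff)
  interpret K: kernel 1 m F by unfold_locales (rule F)
  obtain P Q G where G: "gauss_jordan_single F = G" "G = P * F" "Q * P = 1\<^sub>m 1" "P \<in> carrier_mat 1 1" "Q \<in> carrier_mat 1 1"
    "G \<in> carrier_mat 1 m" "row_echelon_form G"
    using gauss_jordan_single[OF F refl] by blast
  have ker: "mat_kernel G = mat_kernel F" unfolding G(2) by (rule mat_kernel_mult_eq[OF F G(4,5,3)])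
  have "row G 0 \<noteq> 0\<^sub>v m"
  proof
    assume "row G 0 = 0\<^sub>v m"
    hence "f = 0\<^sub>v m"
    proof -
      assume r: "row G 0 = 0\<^sub>v m"
      have "v \<in> mat_kernel F" if v: "v \<in> carrier_vec m" for v
      proof -
        have "G *\<^sub>v v = 0\<^sub>v 1" using r G(6) v by (intro eq_vecI) auto
        thus ?thesis using v G(6) unfolding ker[symmetric] by (intro mat_kernelI)
      qed
      hence "f \<bullet> v = 0" if "v \<in> carrier_vec m" for v
        using that mat_kernelD[OF F] Fv by blast
      hence "f \<bullet> unit_vec m i = 0" for i by simp
      hence "f $ i = 0" if "i < m" for i using scalar_prod_right_unit[OF that, of f] by metis
      thus ?thesis using f(1) by (intro eq_vecI) auto
    qed
    thus False using f by simp
  qed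
  hence "{i. i < 1 \<and> row G i \<noteq> 0\<^sub>v m} = {0}" by auto
  hence dim: "K.dim = m - 1" using find_base_vectors(6)[OF G(7,6)] unfolding ker by simp
  have sub: "subspace class_ring (mat_kernel F) (module_vec TYPE(real) m)"
  proof -
    have "submodule class_ring (mat_kernel F) (module_vec TYPE(real) m)"
      by (unfold_locales)
        (insert mult_add_distrib_mat_vec[OF F] mult_mat_vec[OF F] mat_kernel[OF F], auto simp: class_ring_simps)
    thus ?thesis using K.NC.vectorspace_axioms by (simp add: subspace_def)
  qed
  obtain i where i: "i < m" "f $ i \<noteq> 0" using f by (auto simp: vec_eq_iff)
  let ?x = "(c / f $ i) \<cdot>\<^sub>v unit_vec m i"
  have x: "?x \<in> carrier_vec m" "f \<bullet> ?x = c" using i f by (auto simp: scalar_prod_right_unit)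
  have "{v \<in> carrier_vec m. f \<bullet> v = c} = {?x + w |w. w \<in> mat_kernel F}"
  proof (rule Set.equalityI; rule Set.subsetI)
    fix v assume "v \<in> {v \<in> carrier_vec m. f \<bullet> v = c}"
    hence v: "v \<in> carrier_vec m" "f \<bullet> v = c" by auto
    have "f \<bullet> (v - ?x) = 0" using scalar_prod_minus_distrib[OF f(1) v(1) x(1)] v x by simp
    hence "v - ?x \<in> mat_kernel F" using v x F Fv by (intro mat_kernelI[OF F]) auto
    moreover have "v = ?x + (v - ?x)" using v x by (intro eq_vecI) auto
    ultimately show "v \<in> {?x + w |w. w \<in> mat_kernel F}" by blast
  next
    fix v assume "v \<in> {?x + w |w. w \<in> mat_kernel F}"
    then obtain w where w: "v = ?x + w" "w \<in> mat_kernel F" by blast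
    have wc: "w \<in> carrier_vec m" "f \<bullet> w = 0" using mat_kernelD[OF F w(2)] Fv by auto
    thus "v \<in> {v \<in> carrier_vec m. f \<bullet> v = c}"
      using w(1) x scalar_prod_add_distrib[OF f(1) x(1) wc(1)] by simp
  qed
  thus ?thesis unfolding affine_of_dim_def using x(1) sub dim by blast
qed

section \<open>Explaining systems\<close>

lemma systems_lag_iff:
  "(A, B, C, D) \<in> systems_lag m p l n \<longleftrightarrow>
     A \<in> carrier_mat n n \<and> B \<in> carrier_mat n m \<and> C \<in> carrier_mat p n \<and> D \<in> carrier_mat p m \<and> lag C A = l"
  by (simp add: systems_lag_def)

lemma systems_iff:
  "(A, B, C, D) \<in> systems m p n \<longleftrightarrow>
     A \<in> carrier_mat n n \<and> B \<in> carrier_mat n m \<and> C \<in> carrier_mat p n \<and> D \<in> carrier_mat p m"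
  unfolding systems_def by (auto simp: systems_lag_iff intro: lag_le)

text \<open>Links the explaining systems to the locale \<open>trajectory\<close>. The number of states is visible only in the
dimensions of the matrices, hence the conjunct on \<open>systems\<close>.\<close>

lemma explaining_iff:
  assumes us: "set us \<subseteq> carrier_vec m"
  shows "(A, B, C, D) \<in> explaining m p us ys \<and> (A, B, C, D) \<in> systems m p n \<longleftrightarrow>
    (\<exists>x. trajectory m p n A B C D ((!) us) ((!) ys) x (length us))"
proof
  assume "(A, B, C, D) \<in> explaining m p us ys \<and> (A, B, C, D) \<in> systems m p n"
  then obtain n' x where S: "(A, B, C, D) \<in> systems m p n" "(A, B, C, D) \<in> systems m p n'"
    and x: "\<forall>s\<le>length us. x s \<in> carrier_vec n'"
      "\<forall>s<length us. x (Suc s) = A *\<^sub>v x s + B *\<^sub>v (us ! s) \<and> ys ! s = C *\<^sub>v x s + D *\<^sub>v (us ! s)"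
    unfolding explaining_def by blast
  have "n' = n" using S by (auto simp: systems_iff)
  with S x us show "\<exists>x. trajectory m p n A B C D ((!) us) ((!) ys) x (length us)"
    by (intro exI[of _ x]) (auto simp: trajectory_def systems_iff)
next
  assume "\<exists>x. trajectory m p n A B C D ((!) us) ((!) ys) x (length us)"
  then obtain x where tr: "trajectory m p n A B C D ((!) us) ((!) ys) x (length us)" by blast
  hence "(A, B, C, D) \<in> systems m p n" by (simp add: trajectory_def systems_iff)
  moreover have "(A, B, C, D) \<in> explaining m p us ys"
    using calculation tr unfolding explaining_def trajectory_def by blast
  ultimately show "(A, B, C, D) \<in> explaining m p us ys \<and> (A, B, C, D) \<in> systems m p n" by simp
qed

lemma nonempty_system_set_iff:
  "(X :: lin_system set) \<noteq> {} \<longleftrightarrow> (\<exists>A B C D. (A, B, C, D) \<in> X)"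
  unfolding ex_in_conv[symmetric] split_paired_Ex ..

lemma n_min_eq:
  assumes us: "set us \<subseteq> carrier_vec m"
  shows "n_min m p us ys = (LEAST n. \<exists>A B C D x. trajectory m p n A B C D ((!) us) ((!) ys) x (length us))"
  unfolding n_min_def
proof (rule arg_cong[of _ _ Least], intro ext)
  fix n
  show "(explaining m p us ys \<inter> systems m p n \<noteq> {}) =
    (\<exists>A B C D x. trajectory m p n A B C D ((!) us) ((!) ys) x (length us))"
    unfolding nonempty_system_set_iff Int_iff explaining_iff[OF us] ..
qed

lemma l_min_eq:
  assumes us: "set us \<subseteq> carrier_vec m"
  shows "l_min m p us ys = (LEAST l. \<exists>n A B C D x. trajectory m p n A B C D ((!) us) ((!) ys) x (length us) \<and> lag C A = l)"
  unfolding l_min_def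
proof (rule arg_cong[of _ _ Least], intro ext)
  fix l
  have "(A, B, C, D) \<in> explaining m p us ys \<and> (A, B, C, D) \<in> systems_lag m p l n \<longleftrightarrow>
    ((A, B, C, D) \<in> explaining m p us ys \<and> (A, B, C, D) \<in> systems m p n) \<and> lag C A = l" for n A B C D
    by (simp add: systems_iff systems_lag_iff)
  thus "(\<exists>n. explaining m p us ys \<inter> systems_lag m p l n \<noteq> {}) =
    (\<exists>n A B C D x. trajectory m p n A B C D ((!) us) ((!) ys) x (length us) \<and> lag C A = l)"
    unfolding nonempty_system_set_iff Int_iff explaining_iff[OF us] by simp
qed

lemma n_min_le:
  assumes "set us \<subseteq> carrier_vec m" "trajectory m p n A B C D ((!) us) ((!) ys) x (length us)"
  shows "n_min m p us ys \<le> n"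
  unfolding n_min_eq[OF assms(1)] by (rule Least_le) (use assms(2) in blast)

lemma l_min_le:
  assumes "set us \<subseteq> carrier_vec m" "trajectory m p n A B C D ((!) us) ((!) ys) x (length us)"
  shows "l_min m p us ys \<le> lag C A"
  unfolding l_min_eq[OF assms(1)] by (rule Least_le) (use assms(2) in blast)

lemma n_min_ge:
  assumes "set us \<subseteq> carrier_vec m" "trajectory m p n A B C D ((!) us) ((!) ys) x (length us)"
    and "\<And>n A B C D x. trajectory m p n A B C D ((!) us) ((!) ys) x (length us) \<Longrightarrow> c \<le> n"
  shows "c \<le> n_min m p us ys"
proof -
  have "\<exists>A B C D x. trajectory m p (n_min m p us ys) A B C D ((!) us) ((!) ys) x (length us)"
    unfolding n_min_eq[OF assms(1)] by (rule LeastI_ex) (use assms(2) in blast)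
  thus ?thesis using assms(3) by blast
qed

lemma l_min_ge:
  assumes "set us \<subseteq> carrier_vec m" "trajectory m p n A B C D ((!) us) ((!) ys) x (length us)"
    and "\<And>n A B C D x. trajectory m p n A B C D ((!) us) ((!) ys) x (length us) \<Longrightarrow> c \<le> lag C A"
  shows "c \<le> l_min m p us ys"
proof -
  have "\<exists>n A B C D x. trajectory m p n A B C D ((!) us) ((!) ys) x (length us) \<and> lag C A = l_min m p us ys"
    unfolding l_min_eq[OF assms(1)] by (rule LeastI_ex) (use assms(2) in blast)
  thus ?thesis using assms(3) by metis
qed

subsection \<open>Rank of the Hankel matrix\<close>

text \<open>The columns are the state at the start of a window together with the inputs in the window; the system
maps them linearly onto the columns of the Hankel matrix.\<close>

definition state_input_mat :: "nat \<Rightarrow> nat \<Rightarrow> nat \<Rightarrow> nat \<Rightarrow> (nat \<Rightarrow> real vec) \<Rightarrow> (nat \<Rightarrow> real vec) \<Rightarrow> real mat" where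
  "state_input_mat m n k N x u = mat n N (\<lambda>(i, s). x s $ i) @\<^sub>r hankel m k u 0 (N + k - 1)"

lemma state_input_mat_carrier:
  "0 < N \<Longrightarrow> state_input_mat m n k N x u \<in> carrier_mat (n + (k + 1) * m) N"
  unfolding state_input_mat_def by (intro carrier_append_rows hankel_carrier) auto

lemma state_input_mat_mult:
  assumes "0 < N"
  shows "state_input_mat m n k N x u *\<^sub>v vec N a = wcomb n x N a 0 @\<^sub>v stack m (k + 1) (wcomb m u N a)"
proof -
  have N: "N = N + k - 1 - k + 1" using assms by simp
  show ?thesis unfolding state_input_mat_def
    by (subst mat_mult_append[OF mat_carrier hankel_carrier[OF N]])
      (simp_all only: hankel_mult[OF N] vec_carrier mat_of_signal_mult wcomb_def add_0_right)
qed

lemma state_input_mat_zero_iff: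
  assumes "0 < N"
  shows "state_input_mat m n k N x u *\<^sub>v vec N a = 0\<^sub>v (n + (k + 1) * m) \<longleftrightarrow>
    wcomb n x N a 0 = 0\<^sub>v n \<and> (\<forall>j\<le>k. wcomb m u N a j = 0\<^sub>v m)"
proof -
  have "(\<forall>j\<le>k. P j) \<longleftrightarrow> (\<forall>j<k + 1. P j)" for P :: "nat \<Rightarrow> bool" by (simp add: less_Suc_eq_le)
  thus ?thesis
    unfolding state_input_mat_mult[OF assms] append_vec_eq_zero_iff[OF wcomb_carrier stack_carrier]
    by (subst stack_eq_zero_iff) simp_all
qed

lemma stack_surjective:
  assumes "v \<in> carrier_vec (k * q)"
  shows "\<exists>z. (\<forall>j. z j \<in> carrier_vec q) \<and> v = stack q k z"
proof (intro exI conjI allI)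
  show "vec q (\<lambda>i. v $ (j * q + i)) \<in> carrier_vec q" for j by simp
  show "v = stack q k (\<lambda>j. vec q (\<lambda>i. v $ (j * q + i)))"
  proof (rule eq_vecI)
    fix r assume "r < dim_vec (stack q k (\<lambda>j. vec q (\<lambda>i. v $ (j * q + i))))"
    hence r: "r < k * q" by simp
    hence "r mod q < q" by (intro mod_less_divisor gr0I) auto
    thus "v $ r = stack q k (\<lambda>j. vec q (\<lambda>i. v $ (j * q + i))) $ r" using r by (simp add: stack_def)
  qed (use assms in simp)
qed

lemma (in trajectory) rank_H_mat_le:
  assumes u: "u = (!) us" and y: "y = (!) ys" and t: "length us = t" and k: "k < t"
  shows "mat_rank (H_mat m p k us ys) \<le> (k + 1) * m + n"
proof -
  let ?Q = "state_input_mat m n k (t - k) x u"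
  have Q: "?Q \<in> carrier_mat (n + (k + 1) * m) (t - k)" using k by (intro state_input_mat_carrier) simp
  have "mat_rank (H_mat m p k us ys) \<le> mat_rank ?Q"
  proof (rule factor_through_kernel(2)[OF H_mat_carrier[of k us m p ys, unfolded t, OF k] Q])
    fix v :: "real vec" assume "v \<in> carrier_vec (t - k)" "?Q *\<^sub>v v = 0\<^sub>v (n + (k + 1) * m)"
    then obtain a where v: "v = vec (t - k) a" and z: "?Q *\<^sub>v vec (t - k) a = 0\<^sub>v (n + (k + 1) * m)"
      using vec_eta by blast
    have "0 < t - k" using k by simp
    from z[unfolded state_input_mat_zero_iff[OF this]]
    have x0: "wcomb n x (t - k) a 0 = 0\<^sub>v n" and u0: "\<And>j. j \<le> k \<Longrightarrow> wcomb m u (t - k) a j = 0\<^sub>v m"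
      by blast+
    have "wcomb p y (t - k) a j = 0\<^sub>v p" if j: "j \<le> k" for j
    proof -
      have "wcomb p y (t - k) a j = C *\<^sub>v (A ^\<^sub>m j *\<^sub>v wcomb n x (t - k) a 0)"
        by (rule free_output[of _ "Suc k"]) (use k j u0 in auto)
      thus ?thesis using mult_zero_vec[of "A ^\<^sub>m j" n] mult_zero_vec[of C n] x0 A C pow_mat_dim_square[OF A] by simp
    qed
    thus "H_mat m p k us ys *\<^sub>v v = 0\<^sub>v ((k + 1) * p + (k + 1) * m)"
      unfolding v using H_mat_kernel_iff[of k us m p ys a] k u0 by (simp only: t u y) blast
  qed
  thus ?thesis using mat_rank_le_rows[OF Q] by simp
qed

lemma (in trajectory) rank_H_mat_eq:
  assumes u: "u = (!) us" and y: "y = (!) ys" and t: "length us = t" and k: "k < t"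
    and sat: "saturated m p u y t k" and min: "controllable A B" "observable C A" "lag C A \<le> k"
  shows "mat_rank (H_mat m p k us ys) = (k + 1) * m + n"
proof -
  let ?Q = "state_input_mat m n k (t - k) x u"
  have Q: "?Q \<in> carrier_mat (n + (k + 1) * m) (t - k)" using k by (intro state_input_mat_carrier) simp
  have "mat_rank ?Q = n + (k + 1) * m"
  proof (rule mat_rank_eq_rows_if_surjective[OF Q])
    fix w :: "real vec" assume w: "w \<in> carrier_vec (n + (k + 1) * m)"
    obtain z where z: "\<And>j. z j \<in> carrier_vec m" "vec_last w ((k + 1) * m) = stack m (k + 1) z"
      using stack_surjective[of "vec_last w ((k + 1) * m)" "k + 1" m] by auto
    obtain b where b: "wcomb n x (t - k) b 0 = vec_first w n" "\<forall>j\<le>k. wcomb m u (t - k) b j = z j"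
      using saturated_full_Suc[OF sat k min, of "vec_first w n" z] z(1) by auto
    have "stack m (k + 1) (wcomb m u (t - k) b) = stack m (k + 1) z"
      using b(2) z(1) by (subst stack_eq_iff) (auto simp: less_Suc_eq_le)
    moreover have "0 < t - k" using k by simp
    ultimately have "?Q *\<^sub>v vec (t - k) b = vec_first w n @\<^sub>v vec_last w ((k + 1) * m)"
      unfolding z(2) by (simp only: state_input_mat_mult b(1))
    also have "\<dots> = w" by (rule vec_first_last_append[OF w])
    finally have "?Q *\<^sub>v vec (t - k) b = w" .
    thus "\<exists>v\<in>carrier_vec (t - k). ?Q *\<^sub>v v = w" by (intro bexI[of _ "vec (t - k) b"]) auto
  qed
  moreover have "mat_rank ?Q \<le> mat_rank (H_mat m p k us ys)"
  proof (rule factor_through_kernel(2)[OF Q H_mat_carrier[of k us m p ys, unfolded t, OF k]])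
    fix v :: "real vec" assume "v \<in> carrier_vec (t - k)" "H_mat m p k us ys *\<^sub>v v = 0\<^sub>v ((k + 1) * p + (k + 1) * m)"
    then obtain a where v: "v = vec (t - k) a"
      and z: "H_mat m p k us ys *\<^sub>v vec (t - k) a = 0\<^sub>v ((k + 1) * p + (k + 1) * m)"
      using vec_eta by blast
    have zw: "\<And>j. j \<le> k \<Longrightarrow> wcomb p y (t - k) a j = 0\<^sub>v p \<and> wcomb m u (t - k) a j = 0\<^sub>v m"
      using z H_mat_kernel_iff[of k us m p ys a] k unfolding t u y by blast
    have "wcomb n x (t - k) a 0 = 0\<^sub>v n"
      by (rule zero_window_zero_state[OF min(2) _ min(3)]) (use k zw in auto)
    moreover have "0 < t - k" using k by simp
    ultimately show "?Q *\<^sub>v v = 0\<^sub>v (n + (k + 1) * m)"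
      unfolding v using zw by (subst state_input_mat_zero_iff) blast+
  qed
  ultimately show ?thesis using rank_H_mat_le[OF u y t k] by simp
qed

subsection \<open>Two systems explaining the same saturated data\<close>

text \<open>Saturation provides a superposed window with zero inputs starting in any state of the first system. Both
systems produce its outputs, so every free response of the first system is one of the second.\<close>

lemma free_responses_agree:
  assumes T: "trajectory m p n A B C D u y x t" and T': "trajectory m p n' A' B' C' D' u y x' t"
    and sat: "saturated m p u y t k" and k: "k < t"
    and min: "controllable A B" "observable C A" "lag C A \<le> k" and xi: "\<xi> \<in> carrier_vec n"
  shows "\<exists>b. wcomb n x (t - k) b 0 = \<xi> \<and> (\<forall>j\<le>k. wcomb m u (t - k) b j = 0\<^sub>v m) \<and>
    (\<forall>j\<le>k. C *\<^sub>v (A ^\<^sub>m j *\<^sub>v \<xi>) = wcomb p y (t - k) b j) \<and>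
    (\<forall>j\<le>k. C' *\<^sub>v (A' ^\<^sub>m j *\<^sub>v wcomb n' x' (t - k) b 0) = wcomb p y (t - k) b j)"
proof -
  interpret S: trajectory m p n A B C D u y x t by (rule T)
  interpret S': trajectory m p n' A' B' C' D' u y x' t by (rule T')
  obtain b where b: "wcomb n x (t - k) b 0 = \<xi>" "\<forall>j\<le>k. wcomb m u (t - k) b j = 0\<^sub>v m"
    using S.saturated_full_Suc[OF sat k min xi, of "\<lambda>_. 0\<^sub>v m"] by auto
  have "C *\<^sub>v (A ^\<^sub>m j *\<^sub>v \<xi>) = wcomb p y (t - k) b j" if "j \<le> k" for j
    unfolding b(1)[symmetric] by (rule S.free_output[of _ "Suc k", symmetric]) (use k that b(2) in auto)
  moreover have "C' *\<^sub>v (A' ^\<^sub>m j *\<^sub>v wcomb n' x' (t - k) b 0) = wcomb p y (t - k) b j" if "j \<le> k" for j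
    by (rule S'.free_output[of _ "Suc k", symmetric]) (use k that b(2) in auto)
  ultimately show ?thesis using b by (intro exI[of _ b]) simp
qed

text \<open>If the other system had smaller lag \<open>l\<close>, it would predict a zero output after \<open>l\<close> zeros. By saturation
this prediction holds for all free responses of the first system, whose observability matrix
would then stop growing at \<open>l\<close>.\<close>

lemma lag_ge_true:
  assumes T: "trajectory m p n A B C D u y x t" and T': "trajectory m p n' A' B' C' D' u y x' t"
    and sat: "saturated m p u y t k" and k: "k < t"
    and min: "controllable A B" "observable C A" "lag C A \<le> k"
  shows "lag C A \<le> lag C' A'"
proof (rule ccontr)
  assume "\<not> ?thesis"
  hence l: "lag C' A' < lag C A" by simp
  let ?l = "lag C' A'"
  interpret S: trajectory m p n A B C D u y x t by (rule T)
  interpret S': trajectory m p n' A' B' C' D' u y x' t by (rule T')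
  note oc = obs_mat_carrier[OF S.A S.C]
  have "mat_rank (obs_mat C A (Suc ?l)) \<le> mat_rank (obs_mat C A ?l)"
  proof (rule factor_through_kernel(2)[OF oc oc])
    fix v :: "real vec" assume v: "v \<in> carrier_vec n" "obs_mat C A ?l *\<^sub>v v = 0\<^sub>v (?l * p)"
    have z: "\<forall>j<?l. C *\<^sub>v (A ^\<^sub>m j *\<^sub>v v) = 0\<^sub>v p" using v(2) unfolding obs_mat_kernel_iff[OF S.A S.C v(1)] .
    obtain b where b: "\<forall>j\<le>k. wcomb m u (t - k) b j = 0\<^sub>v m" "\<forall>j\<le>k. C *\<^sub>v (A ^\<^sub>m j *\<^sub>v v) = wcomb p y (t - k) b j"
      using free_responses_agree[OF T T' sat k min v(1)] by blast
    have "wcomb p y (t - k) b ?l = 0\<^sub>v p"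
    proof (rule S'.zero_window_next_output)
      show "t - k + ?l \<le> t" "wcomb m u (t - k) b ?l = 0\<^sub>v m" using l min(3) k b(1) by auto
      show "wcomb p y (t - k) b j = 0\<^sub>v p \<and> wcomb m u (t - k) b j = 0\<^sub>v m" if "j < ?l" for j
        using b z that l min(3) by (metis less_imp_le order.trans)
    qed simp
    hence "C *\<^sub>v (A ^\<^sub>m ?l *\<^sub>v v) = 0\<^sub>v p" using b(2) l min(3) by simp
    thus "obs_mat C A (Suc ?l) *\<^sub>v v = 0\<^sub>v (Suc ?l * p)"
      unfolding obs_mat_kernel_iff[OF S.A S.C v(1)] using z by (auto simp: less_Suc_eq)
  qed
  moreover have "mat_rank (obs_mat C A ?l) + 1 \<le> mat_rank (obs_mat C A (Suc ?l))"
    using obs_rank_growth[OF S.A S.C, of ?l "Suc ?l"] l by simp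
  ultimately show False by simp
qed

text \<open>The observability matrix of the second system has rank at least \<open>n\<close> after \<open>lag C A\<close> block rows, since all free
responses of the first system are responses of the second, and gains at least one per
further block row up to its own lag.\<close>

lemma lag_excess_le:
  assumes T: "trajectory m p n A B C D u y x t" and T': "trajectory m p n' A' B' C' D' u y x' t"
    and sat: "saturated m p u y t k" and k: "k < t"
    and min: "controllable A B" "observable C A" "lag C A \<le> k"
  shows "n + lag C' A' \<le> n' + lag C A"
proof -
  interpret S: trajectory m p n A B C D u y x t by (rule T)
  interpret S': trajectory m p n' A' B' C' D' u y x' t by (rule T')
  let ?l = "lag C A"
  have oc: "obs_mat C A ?l \<in> carrier_mat (?l * p) n" by (rule obs_mat_carrier[OF S.A S.C])
  have oc': "obs_mat C' A' ?l \<in> carrier_mat (?l * p) n'" by (rule obs_mat_carrier[OF S'.A S'.C])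
  have "\<exists>x\<in>carrier_vec n'. obs_mat C' A' ?l *\<^sub>v x = col (obs_mat C A ?l) i" if i: "i < n" for i
  proof -
    have e: "unit_vec n i \<in> carrier_vec n" by simp
    obtain b where b: "\<forall>j\<le>k. C *\<^sub>v (A ^\<^sub>m j *\<^sub>v unit_vec n i) = wcomb p y (t - k) b j"
      "\<forall>j\<le>k. C' *\<^sub>v (A' ^\<^sub>m j *\<^sub>v wcomb n' x' (t - k) b 0) = wcomb p y (t - k) b j"
      using free_responses_agree[OF T T' sat k min e] by blast
    have "obs_mat C' A' ?l *\<^sub>v wcomb n' x' (t - k) b 0 = obs_mat C A ?l *\<^sub>v unit_vec n i"
      by (rule obs_mat_mult_eq[OF S'.A S'.C _ S.A S.C e]) (use b min(3) in auto)
    thus ?thesis using mult_unit_vec[OF oc i] by (intro bexI[of _ "wcomb n' x' (t - k) b 0"]) simp_all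
  qed
  then obtain Y where Y: "Y \<in> carrier_mat n' n" "obs_mat C A ?l = obs_mat C' A' ?l * Y"
    using exists_preimages[OF oc' oc] by blast
  have n: "n \<le> mat_rank (obs_mat C' A' ?l)"
    using mat_rank_mult_le[OF oc' Y(1)] observable_rank_lag[OF S.A S.C min(2)] Y(2) by simp
  have "?l \<le> lag C' A'" by (rule lag_ge_true[OF assms])
  from obs_rank_growth[OF S'.A S'.C this] obs_rank_le[OF S'.A S'.C, of "lag C' A'"] n
  show ?thesis by simp
qed

text \<open>If a superposed state of the first system vanishes, then so does that of the second: compare with the
window that has the same inputs and is at rest in both systems, which saturation provides.\<close>

lemma state_transformation:
  assumes T: "trajectory m p n A B C D u y x t" and T': "trajectory m p n' A' B' C' D' u y x' t"
    and sat: "saturated m p u y t k" and k: "k < t"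
    and min: "observable C A" "lag C A \<le> k" and min': "observable C' A'" "lag C' A' \<le> k"
  shows "\<exists>S\<in>carrier_mat n' n. \<forall>s<t - k + 1. x' s = S *\<^sub>v x s"
proof (rule signal_factor)
  interpret S: trajectory m p n A B C D u y x t by (rule T)
  interpret S': trajectory m p n' A' B' C' D' u y x' t by (rule T')
  show "x s \<in> carrier_vec n" "x' s \<in> carrier_vec n'" if "s < t - k + 1" for s
    using that k S.x_carrier S'.x_carrier by auto
  fix a assume "comb n (t - k + 1) a x = 0\<^sub>v n"
  hence x0: "wcomb n x (t - k + 1) a 0 = 0\<^sub>v n" by (simp add: wcomb_def)
  have uc: "wcomb m u (t - k + 1) a j \<in> carrier_vec m" for j by simp
  from saturated_zero_state_any_input[where z = "wcomb m u (t - k + 1) a", OF sat k uc] obtain b where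
    b1: "\<forall>j<k. wcomb m u (t - k + 1) b j = wcomb m u (t - k + 1) a j" and
    b2: "\<forall>n A B C D x. trajectory m p n A B C D u y x t \<longrightarrow> observable C A \<longrightarrow> lag C A \<le> k \<longrightarrow>
       wcomb n x (t - k + 1) b 0 = 0\<^sub>v n" by (elim exE conjE) (rule that)
  have bx: "wcomb n x (t - k + 1) b 0 = 0\<^sub>v n" by (rule b2[rule_format, OF T min])
  have bx': "wcomb n' x' (t - k + 1) b 0 = 0\<^sub>v n'" by (rule b2[rule_format, OF T' min'])
  have "wcomb p y (t - k + 1) (\<lambda>s. b s - a s) j = 0\<^sub>v p" if j: "j < k" for j
  proof -
    have "wcomb p y (t - k + 1) (\<lambda>s. b s - a s) j = C *\<^sub>v (A ^\<^sub>m j *\<^sub>v wcomb n x (t - k + 1) (\<lambda>s. b s - a s) 0)"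
      by (rule S.free_output[of _ k]) (use k j b1 in \<open>auto simp: wcomb_diff\<close>)
    also have "wcomb n x (t - k + 1) (\<lambda>s. b s - a s) 0 = 0\<^sub>v n" unfolding wcomb_diff bx x0 by simp
    finally show ?thesis
      using mult_zero_vec[of "A ^\<^sub>m j" n] mult_zero_vec[of C n] S.A S.C pow_mat_dim_square[OF S.A] by simp
  qed
  note zero_output = this
  have "wcomb p y (t - k + 1) b j = wcomb p y (t - k + 1) a j" if "j < k" for j
    by (rule eq_if_minus_eq_zero[OF wcomb_carrier wcomb_carrier]) (use zero_output[OF that] in \<open>simp add: wcomb_diff\<close>)
  hence "wcomb n' x' (t - k + 1) b 0 = wcomb n' x' (t - k + 1) a 0"
    using b1 k by (intro S'.state_determined[OF min'(1) _ min'(2)]) auto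
  thus "comb n' (t - k + 1) a x' = 0\<^sub>v n'" using bx' by (simp add: wcomb_def)
qed

text \<open>The matrix \<open>S\<close> transforms the states along the data. As all states and inputs occur as superpositions, the
state and output equations along the data determine the system matrices.\<close>

lemma isomorphic_if_saturated:
  assumes T: "trajectory m p n A B C D u y x t" and T': "trajectory m p n A' B' C' D' u y x' t"
    and sat: "saturated m p u y t k" and k: "k < t"
    and min: "controllable A B" "observable C A" "lag C A \<le> k"
    and min': "controllable A' B'" "observable C' A'" "lag C' A' \<le> k"
  shows "isomorphic_systems n (A, B, C, D) (A', B', C', D')"
proof -
  interpret S: trajectory m p n A B C D u y x t by (rule T)
  interpret S': trajectory m p n A' B' C' D' u y x' t by (rule T')
  obtain S where S: "S \<in> carrier_mat n n" "\<And>s. s < t - k + 1 \<Longrightarrow> x' s = S *\<^sub>v x s"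
    using state_transformation[OF T T' sat k min(2,3) min'(2,3)] by blast
  obtain R where R: "R \<in> carrier_mat n n" "\<And>s. s < t - k + 1 \<Longrightarrow> x s = R *\<^sub>v x' s"
    using state_transformation[OF T' T sat k min'(2,3) min(2,3)] by blast
  have xc: "x s \<in> carrier_vec n" "x' s \<in> carrier_vec n" if "s < t - k + 1" for s
    using that k S.x_carrier S'.x_carrier by auto
  have Sx: "wcomb n x' N a j = S *\<^sub>v wcomb n x N a j" if "N + j \<le> t - k + 1" for N a j
  proof -
    have "wcomb n x' N a j = comb n N a (\<lambda>s. S *\<^sub>v x (s + j))"
      unfolding wcomb_def by (rule comb_cong[OF refl]) (rule S(2), use that in simp)
    also have "\<dots> = S *\<^sub>v wcomb n x N a j"
      unfolding wcomb_def by (rule mult_comb[OF S(1), symmetric]) (rule xc, use that in simp)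
    finally show ?thesis .
  qed
  have Rx: "wcomb n x N a j = R *\<^sub>v wcomb n x' N a j" if "N + j \<le> t - k + 1" for N a j
  proof -
    have "wcomb n x N a j = comb n N a (\<lambda>s. R *\<^sub>v x' (s + j))"
      unfolding wcomb_def by (rule comb_cong[OF refl]) (rule R(2), use that in simp)
    also have "\<dots> = R *\<^sub>v wcomb n x' N a j"
      unfolding wcomb_def by (rule mult_comb[OF R(1), symmetric]) (rule xc, use that in simp)
    finally show ?thesis .
  qed
  have full: "\<exists>b. wcomb n x (t - k) b 0 = \<xi> \<and> wcomb m u (t - k) b 0 = z" if "\<xi> \<in> carrier_vec n" "z \<in> carrier_vec m" for \<xi> z
    using S.saturated_full_Suc[OF sat k min that(1), of "\<lambda>_. z"] that(2) by auto
  have RS: "R * S = 1\<^sub>m n"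
  proof (rule mat_eq_if_vec_eq[of _ n n])
    fix v :: "real vec" assume v: "v \<in> carrier_vec n"
    obtain b where b: "wcomb n x (t - k) b 0 = v" using full[OF v, of "0\<^sub>v m"] by auto
    have "wcomb n x' (t - k) b 0 = S *\<^sub>v v" unfolding b[symmetric] by (rule Sx) simp
    hence "R *\<^sub>v (S *\<^sub>v v) = R *\<^sub>v wcomb n x' (t - k) b 0" by (rule arg_cong[OF sym])
    also have "\<dots> = wcomb n x (t - k) b 0" by (rule Rx[symmetric]) simp
    finally have "R *\<^sub>v (S *\<^sub>v v) = v" unfolding b .
    thus "R * S *\<^sub>v v = 1\<^sub>m n *\<^sub>v v" using R(1) S(1) v by (simp add: mult_mat_vec_assoc)
  qed (use R(1) S(1) in auto)
  have SR: "S * R = 1\<^sub>m n" by (rule mat_mult_left_right_inverse[OF R(1) S(1) RS])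
  have step: "S *\<^sub>v (A *\<^sub>v \<xi> + B *\<^sub>v z) = A' *\<^sub>v (S *\<^sub>v \<xi>) + B' *\<^sub>v z \<and> C *\<^sub>v \<xi> + D *\<^sub>v z = C' *\<^sub>v (S *\<^sub>v \<xi>) + D' *\<^sub>v z"
    if \<xi>z: "\<xi> \<in> carrier_vec n" "z \<in> carrier_vec m" for \<xi> z
  proof -
    obtain b where b: "wcomb n x (t - k) b 0 = \<xi>" "wcomb m u (t - k) b 0 = z" using full[OF \<xi>z] by blast
    have b': "wcomb n x' (t - k) b 0 = S *\<^sub>v \<xi>" using Sx[of "t - k" 0 b] b by simp
    have "wcomb n x' (t - k) b (Suc 0) = S *\<^sub>v wcomb n x (t - k) b (Suc 0)" by (rule Sx) simp
    moreover have "wcomb n x (t - k) b (Suc 0) = A *\<^sub>v \<xi> + B *\<^sub>v z" using S.wcomb_state[of "t - k" 0 b] b by simp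
    moreover have "wcomb n x' (t - k) b (Suc 0) = A' *\<^sub>v (S *\<^sub>v \<xi>) + B' *\<^sub>v z" using S'.wcomb_state[of "t - k" 0 b] b b' by simp
    moreover have "wcomb p y (t - k) b 0 = C *\<^sub>v \<xi> + D *\<^sub>v z" using S.wcomb_output[of "t - k" 0 b] b by simp
    moreover have "wcomb p y (t - k) b 0 = C' *\<^sub>v (S *\<^sub>v \<xi>) + D' *\<^sub>v z" using S'.wcomb_output[of "t - k" 0 b] b b' by simp
    ultimately show ?thesis by simp
  qed
  have zv: "A *\<^sub>v 0\<^sub>v n = 0\<^sub>v n" "A' *\<^sub>v 0\<^sub>v n = 0\<^sub>v n" "S *\<^sub>v 0\<^sub>v n = 0\<^sub>v n" "C *\<^sub>v 0\<^sub>v n = 0\<^sub>v p" "C' *\<^sub>v 0\<^sub>v n = 0\<^sub>v p"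
    "B *\<^sub>v 0\<^sub>v m = 0\<^sub>v n" "B' *\<^sub>v 0\<^sub>v m = 0\<^sub>v n" "D *\<^sub>v 0\<^sub>v m = 0\<^sub>v p" "D' *\<^sub>v 0\<^sub>v m = 0\<^sub>v p"
    using S.A S'.A S(1) S.C S'.C S.B S'.B S.D S'.D by (simp_all add: mult_zero_vec)
  have c: "A *\<^sub>v v \<in> carrier_vec n" "B *\<^sub>v v \<in> carrier_vec n" "C *\<^sub>v v \<in> carrier_vec p" "D *\<^sub>v v \<in> carrier_vec p"
    "A' *\<^sub>v v \<in> carrier_vec n" "B' *\<^sub>v v \<in> carrier_vec n" "C' *\<^sub>v v \<in> carrier_vec p" "D' *\<^sub>v v \<in> carrier_vec p" for v
    by (rule mult_vec_carrier, rule S.A S.B S.C S.D S'.A S'.B S'.C S'.D)+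
  have SA: "S * A = A' * S"
  proof (rule mat_eq_if_vec_eq[of _ n n])
    fix v :: "real vec" assume v: "v \<in> carrier_vec n"
    have "S *\<^sub>v (A *\<^sub>v v) = A' *\<^sub>v (S *\<^sub>v v)" using step[OF v, of "0\<^sub>v m"] c by (simp add: zv)
    thus "S * A *\<^sub>v v = A' * S *\<^sub>v v" using S(1) S.A S'.A v by (simp add: mult_mat_vec_assoc)
  qed (use S(1) S.A S'.A in auto)
  have SB: "S * B = B'"
  proof (rule mat_eq_if_vec_eq[of _ n m])
    fix v :: "real vec" assume v: "v \<in> carrier_vec m"
    have "S *\<^sub>v (B *\<^sub>v v) = B' *\<^sub>v v" using step[of "0\<^sub>v n" v] v c by (simp add: zv)
    thus "S * B *\<^sub>v v = B' *\<^sub>v v" using S(1) S.B v by (simp add: mult_mat_vec_assoc)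
  qed (use S(1) S.B S'.B in auto)
  have CS: "C = C' * S"
  proof (rule mat_eq_if_vec_eq[of _ p n])
    fix v :: "real vec" assume v: "v \<in> carrier_vec n"
    have "C *\<^sub>v v = C' *\<^sub>v (S *\<^sub>v v)" using step[OF v, of "0\<^sub>v m"] c by (simp add: zv)
    thus "C *\<^sub>v v = C' * S *\<^sub>v v" using S(1) S'.C v by (simp add: mult_mat_vec_assoc)
  qed (use S(1) S.C S'.C in auto)
  have DD: "D = D'"
  proof (rule mat_eq_if_vec_eq[OF S.D S'.D])
    fix v :: "real vec" assume v: "v \<in> carrier_vec m"
    show "D *\<^sub>v v = D' *\<^sub>v v" using step[of "0\<^sub>v n" v] v c by (simp add: zv)
  qed
  have "R * A' * S = A"
  proof -
    have "R * A' * S = R * (S * A)" unfolding SA by (rule assoc_mult_mat[OF R(1) S'.A S(1)])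
    also have "\<dots> = (R * S) * A" by (rule assoc_mult_mat[OF R(1) S(1) S.A, symmetric])
    finally show ?thesis using RS S.A by simp
  qed
  moreover have "R * B' = B"
  proof -
    have "R * B' = (R * S) * B" unfolding SB[symmetric] by (rule assoc_mult_mat[OF R(1) S(1) S.B, symmetric])
    thus ?thesis using RS S.B by simp
  qed
  moreover have "inverts_mat S R" "inverts_mat R S" using RS SR R(1) S(1) by (simp_all add: inverts_mat_def)
  ultimately show ?thesis
    unfolding isomorphic_systems.simps using DD CS R(1) S(1) by metis
qed

section \<open>Realising saturated data whose outputs are determined by the past\<close>

text \<open>The next output is a linear function of the past \<open>q\<close> inputs and outputs and the present input. Together with
saturation at the same depth, the superposed windows then are the windows of a system in which
inputs are free.\<close>

definition outputs_determined :: "nat \<Rightarrow> nat \<Rightarrow> (nat \<Rightarrow> real vec) \<Rightarrow> (nat \<Rightarrow> real vec) \<Rightarrow> nat \<Rightarrow> nat \<Rightarrow> bool" where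
  "outputs_determined m p u y t q \<longleftrightarrow> (\<forall>b. (\<forall>j<q. wcomb p y (t - q) b j = 0\<^sub>v p) \<longrightarrow>
     (\<forall>j\<le>q. wcomb m u (t - q) b j = 0\<^sub>v m) \<longrightarrow> wcomb p y (t - q) b q = 0\<^sub>v p)"

text \<open>The state of the realisation at time \<open>s\<close> is the free response from \<open>s\<close> on: the outputs minus what the
inputs alone would produce from rest. Both responses are built as infinite sequences all of whose windows are
superpositions of data windows. A free response is then a free response of the true system for \<open>q\<close> steps, and it is
determined by these, so the states live in a space of dimension at most the rank of \<open>q\<close> block rows of
the true observability matrix.\<close>

locale determined_data =
  fixes m p :: nat and u y :: "nat \<Rightarrow> real vec" and t q :: nat
  assumes u_carrier: "\<And>s. s < t \<Longrightarrow> u s \<in> carrier_vec m"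
    and y_carrier: "\<And>s. s < t \<Longrightarrow> y s \<in> carrier_vec p"
    and sat: "saturated m p u y t q" and det: "outputs_determined m p u y t q" and q_less: "q < t"
begin

definition window :: "(nat \<Rightarrow> real) \<Rightarrow> (nat \<Rightarrow> real vec) \<Rightarrow> (nat \<Rightarrow> real vec) \<Rightarrow> nat \<Rightarrow> bool" where
  "window b V Y i \<longleftrightarrow> (\<forall>j\<le>q. V (i + j) = wcomb m u (t - q) b j \<and> Y (i + j) = wcomb p y (t - q) b j)"

definition admissible :: "(nat \<Rightarrow> real vec) \<Rightarrow> (nat \<Rightarrow> real vec) \<Rightarrow> bool" where
  "admissible V Y \<longleftrightarrow> (\<forall>i. \<exists>b. window b V Y i)"

lemma admissible_carrier:
  assumes "admissible V Y"
  shows "V i \<in> carrier_vec m" "Y i \<in> carrier_vec p"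
proof -
  obtain b where "window b V Y i" using assms unfolding admissible_def by blast
  hence "V (i + 0) = wcomb m u (t - q) b 0 \<and> Y (i + 0) = wcomb p y (t - q) b 0" unfolding window_def by blast
  thus "V i \<in> carrier_vec m" "Y i \<in> carrier_vec p" by simp_all
qed

lemma window_output_unique:
  assumes "window b V Y i" "window b' V' Y' i" "\<And>j. j \<le> q \<Longrightarrow> V (i + j) = V' (i + j)" "\<And>j. j < q \<Longrightarrow> Y (i + j) = Y' (i + j)"
  shows "Y (i + q) = Y' (i + q)"
proof -
  have e: "wcomb m u (t - q) b j = wcomb m u (t - q) b' j" if "j \<le> q" for j
    using assms(1,2,3) that unfolding window_def by metis
  have f: "wcomb p y (t - q) b j = wcomb p y (t - q) b' j" if "j < q" for j
    using assms(1,2,4) that unfolding window_def by (metis less_imp_le)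
  have "wcomb p y (t - q) (\<lambda>s. b s - b' s) q = 0\<^sub>v p"
    using det[unfolded outputs_determined_def, rule_format, of "\<lambda>s. b s - b' s"] e f
    by (simp add: wcomb_diff)
  hence "wcomb p y (t - q) b q = wcomb p y (t - q) b' q"
    unfolding wcomb_diff by (rule eq_if_minus_eq_zero[OF wcomb_carrier wcomb_carrier])
  thus ?thesis using assms(1,2) unfolding window_def by simp
qed

lemma admissible_unique:
  assumes "admissible V Y" "admissible V' Y'" "\<And>i. V i = V' i" "\<And>j. j < q \<Longrightarrow> Y j = Y' j"
  shows "Y i = Y' i"
proof (induction i rule: less_induct)
  case (less i)
  show ?case
  proof (cases "i < q")
    case False
    then obtain s where s: "i = s + q" by (metis add.commute le_Suc_ex not_less)
    obtain b b' where b: "window b V Y s" "window b' V' Y' s"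
      using assms(1,2) unfolding admissible_def by blast
    show ?thesis unfolding s
    proof (rule window_output_unique[OF b assms(3)])
      show "Y (s + j) = Y' (s + j)" if "j < q" for j using less that s by simp
    qed
  qed (use assms(4) in simp)
qed

lemma admissible_shift: "admissible V Y \<Longrightarrow> admissible (\<lambda>i. V (s + i)) (\<lambda>i. Y (s + i))"
  unfolding admissible_def window_def by (metis add.assoc)

lemma admissible_zero: "admissible (\<lambda>_. 0\<^sub>v m) (\<lambda>_. 0\<^sub>v p)"
  unfolding admissible_def window_def by (auto intro!: exI[of _ "\<lambda>_. 0"] simp: wcomb_zero)

lemma admissible_diff:
  assumes "admissible V Y" "admissible V' Y'"
  shows "admissible (\<lambda>i. V i - V' i) (\<lambda>i. Y i - Y' i)"
  unfolding admissible_def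
proof
  fix i
  obtain b b' where "window b V Y i" "window b' V' Y' i" using assms unfolding admissible_def by blast
  hence "window (\<lambda>s. b s - b' s) (\<lambda>i. V i - V' i) (\<lambda>i. Y i - Y' i) i"
    unfolding window_def by (simp add: wcomb_diff)
  thus "\<exists>b. window b (\<lambda>i. V i - V' i) (\<lambda>i. Y i - Y' i) i" by blast
qed

lemma admissible_comb:
  assumes "\<And>s. s < K \<Longrightarrow> admissible (V s) (Y s)"
  shows "admissible (\<lambda>i. comb m K c (\<lambda>s. V s i)) (\<lambda>i. comb p K c (\<lambda>s. Y s i))"
  unfolding admissible_def
proof
  fix i
  have "\<forall>s. \<exists>b. s < K \<longrightarrow> window b (V s) (Y s) i" using assms unfolding admissible_def by blast
  then obtain b where b: "\<And>s. s < K \<Longrightarrow> window (b s) (V s) (Y s) i" by metis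
  have "window (\<lambda>r. \<Sum>s<K. c s * b s r) (\<lambda>i. comb m K c (\<lambda>s. V s i)) (\<lambda>i. comb p K c (\<lambda>s. Y s i)) i"
    unfolding window_def
  proof (intro allI impI conjI)
    fix j assume j: "j \<le> q"
    have w: "V s (i + j) = wcomb m u (t - q) (b s) j" "Y s (i + j) = wcomb p y (t - q) (b s) j" if "s < K" for s
      using b[OF that] j unfolding window_def by auto
    show "comb m K c (\<lambda>s. V s (i + j)) = wcomb m u (t - q) (\<lambda>r. \<Sum>s<K. c s * b s r) j"
      unfolding wcomb_def comb_comb[symmetric] by (rule comb_cong[OF refl]) (simp add: w(1) wcomb_def)
    show "comb p K c (\<lambda>s. Y s (i + j)) = wcomb p y (t - q) (\<lambda>r. \<Sum>s<K. c s * b s r) j"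
      unfolding wcomb_def comb_comb[symmetric] by (rule comb_cong[OF refl]) (simp add: w(2) wcomb_def)
  qed
  thus "\<exists>b. window b (\<lambda>i. comb m K c (\<lambda>s. V s i)) (\<lambda>i. comb p K c (\<lambda>s. Y s i)) i" by blast
qed

text \<open>Saturation prolongs the current window by the next input; its output becomes the next term of the sequence.\<close>

lemma admissible_extension:
  assumes V: "\<And>i. V i \<in> carrier_vec m"
    and start: "\<And>j. j < q \<Longrightarrow> V j = wcomb m u (t - q + 1) a j \<and> Y0 j = wcomb p y (t - q + 1) a j"
  shows "\<exists>Y. (\<forall>j<q. Y j = Y0 j) \<and> admissible V Y"
proof -
  define P where "P n F \<longleftrightarrow> (\<forall>j<q. F j = Y0 j) \<and> (\<forall>i<n. \<exists>b. window b V F i) \<and>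
    (\<exists>a. \<forall>j<q. V (n + j) = wcomb m u (t - q + 1) a j \<and> F (n + j) = wcomb p y (t - q + 1) a j)" for n F
  have "\<exists>F. \<forall>n. P n (F n) \<and> (\<forall>i<n + q. F (Suc n) i = F n i)"
  proof (rule dependent_nat_choice)
    show "\<exists>F. P 0 F" using start by (intro exI[of _ Y0]) (auto simp: P_def)
    fix F n assume F: "P n F"
    then obtain a where a: "\<forall>j<q. V (n + j) = wcomb m u (t - q + 1) a j \<and> F (n + j) = wcomb p y (t - q + 1) a j"
      unfolding P_def by blast
    obtain b where b: "\<forall>j<q. wcomb p y (t - q) b j = wcomb p y (t - q + 1) a j \<and> wcomb m u (t - q) b j = wcomb m u (t - q + 1) a j"
      "wcomb m u (t - q) b q = V (n + q)"
      using saturatedD[OF sat V[of "n + q"], of a] by blast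
    define F' where "F' = F(n + q := wcomb p y (t - q) b q)"
    have F': "F' i = F i" if "i < n + q" for i using that by (simp add: F'_def)
    have new: "window b V F' n"
      unfolding window_def
    proof (intro allI impI)
      fix j assume "j \<le> q"
      thus "V (n + j) = wcomb m u (t - q) b j \<and> F' (n + j) = wcomb p y (t - q) b j"
        using a b F'[of "n + j"] by (cases "j = q") (auto simp: F'_def)
    qed
    have "\<exists>b. window b V F' i" if "i < Suc n" for i
    proof (cases "i = n")
      case False
      hence i: "i < n" using that by simp
      then obtain b where "window b V F i" using F unfolding P_def by blast
      hence "window b V F' i" unfolding window_def using F' i by simp
      thus ?thesis by blast
    qed (use new in blast)
    moreover have "V (Suc n + j) = wcomb m u (t - q + 1) (case_nat 0 b) j \<and> F' (Suc n + j) = wcomb p y (t - q + 1) (case_nat 0 b) j"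
      if "j < q" for j
      using new that unfolding window_def by (auto simp: wcomb_shift dest: spec[of _ "Suc j"])
    moreover have "\<forall>j<q. F' j = Y0 j" using F F' unfolding P_def by simp
    ultimately have "P (Suc n) F'" unfolding P_def by blast
    thus "\<exists>F'. P (Suc n) F' \<and> (\<forall>i<n + q. F' i = F i)" using F' by blast
  qed
  then obtain F where F: "\<And>n. P n (F n)" "\<And>n i. i < n + q \<Longrightarrow> F (Suc n) i = F n i" by blast
  have stable: "F (n + d) i = F n i" if "i < n + q" for n d i
    using that by (induction d) (auto simp: F(2))
  define Y where "Y i = F (Suc i) i" for i
  have Y: "Y i = F n i" if "i < n + q" for n i
    using stable[of i n "Suc i"] stable[of i "Suc i" n] that unfolding Y_def by (simp add: add.commute)
  have "Y j = Y0 j" if "j < q" for j using Y[of j 0] F(1)[of 0] that unfolding P_def by simp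
  moreover have "\<exists>b. window b V Y i" for i
  proof -
    obtain b where b: "window b V (F (Suc i)) i" using F(1)[of "Suc i"] unfolding P_def by blast
    have "Y (i + j) = F (Suc i) (i + j)" if "j \<le> q" for j using that by (intro Y) simp
    hence "window b V Y i" using b unfolding window_def by simp
    thus ?thesis by blast
  qed
  ultimately show ?thesis unfolding admissible_def by blast
qed

definition delay :: "(nat \<Rightarrow> real vec) \<Rightarrow> nat \<Rightarrow> real vec" where
  "delay v i = (if i < q then 0\<^sub>v m else v (i - q))"

text \<open>The response to \<open>v\<close> after \<open>q\<close> zero inputs and outputs; \<open>forced\<close> drops these leading zeros again. The zero
past is what fixes the response uniquely.\<close>

definition from_rest :: "(nat \<Rightarrow> real vec) \<Rightarrow> nat \<Rightarrow> real vec" where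
  "from_rest v = (SOME Y. (\<forall>j<q. Y j = 0\<^sub>v p) \<and> admissible (delay v) Y)"

definition forced :: "(nat \<Rightarrow> real vec) \<Rightarrow> nat \<Rightarrow> real vec" where
  "forced v j = from_rest v (q + j)"

lemma from_rest:
  assumes "\<And>i. v i \<in> carrier_vec m"
  shows "j < q \<Longrightarrow> from_rest v j = 0\<^sub>v p" "admissible (delay v) (from_rest v)"
proof -
  have "\<exists>Y. (\<forall>j<q. Y j = 0\<^sub>v p) \<and> admissible (delay v) Y"
    by (rule admissible_extension[of _ "\<lambda>_. 0"]) (auto simp: delay_def assms wcomb_zero)
  hence "(\<forall>j<q. from_rest v j = 0\<^sub>v p) \<and> admissible (delay v) (from_rest v)"
    unfolding from_rest_def by (rule someI_ex)
  thus "j < q \<Longrightarrow> from_rest v j = 0\<^sub>v p" "admissible (delay v) (from_rest v)" by auto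
qed

lemma from_rest_unique:
  assumes "\<And>i. v i \<in> carrier_vec m" "admissible V Y" "\<And>i. V i = delay v i" "\<And>j. j < q \<Longrightarrow> Y j = 0\<^sub>v p"
  shows "from_rest v i = Y i"
  by (rule admissible_unique[OF from_rest(2)[OF assms(1)] assms(2)])
    (simp_all add: assms from_rest(1)[OF assms(1)])

lemma forced_admissible:
  assumes "\<And>i. v i \<in> carrier_vec m"
  shows "admissible v (forced v)"
proof -
  have "admissible (\<lambda>i. delay v (q + i)) (\<lambda>i. from_rest v (q + i))"
    by (rule admissible_shift[OF from_rest(2)[OF assms]])
  thus ?thesis by (simp add: delay_def forced_def[abs_def])
qed

lemma forced_comb:
  assumes "\<And>s i. s < K \<Longrightarrow> v s i \<in> carrier_vec m"
  shows "forced (\<lambda>i. comb m K c (\<lambda>s. v s i)) j = comb p K c (\<lambda>s. forced (v s) j)"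
  unfolding forced_def
proof (rule from_rest_unique)
  show "admissible (\<lambda>i. comb m K c (\<lambda>s. delay (v s) i)) (\<lambda>i. comb p K c (\<lambda>s. from_rest (v s) i))"
    by (rule admissible_comb) (rule from_rest(2), rule assms)
  show "comb m K c (\<lambda>s. delay (v s) i) = delay (\<lambda>i. comb m K c (\<lambda>s. v s i)) i" for i
    by (simp add: delay_def comb_zero_signal)
  show "comb p K c (\<lambda>s. from_rest (v s) j) = 0\<^sub>v p" if "j < q" for j
    by (rule comb_zero_signal) (rule from_rest(1), rule assms, simp_all add: that)
qed simp

text \<open>An input that starts with zero leaves the system at rest for one more step, so the response is delayed by one.\<close>

lemma forced_causal:
  assumes v: "\<And>i. v i \<in> carrier_vec m" and v0: "v 0 = 0\<^sub>v m"
  shows "forced v 0 = 0\<^sub>v p" "forced v (Suc j) = forced (\<lambda>i. v (Suc i)) j"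
proof -
  let ?w = "\<lambda>i. v (Suc i)"
  let ?Y = "case_nat (0\<^sub>v p) (from_rest ?w)" and ?V = "case_nat (0\<^sub>v m) (delay ?w)"
  note w = from_rest[of ?w, OF v]
  have adm: "admissible ?V ?Y"
    unfolding admissible_def
  proof
    fix i show "\<exists>b. window b ?V ?Y i"
    proof (cases i)
      case 0
      have "window (\<lambda>_. 0) ?V ?Y 0"
        unfolding window_def using w(1) by (auto simp: wcomb_zero delay_def split: nat.split)
      thus ?thesis unfolding 0 by blast
    next
      case (Suc i')
      obtain b where "window b (delay ?w) (from_rest ?w) i'" using w(2) unfolding admissible_def by blast
      hence "window b ?V ?Y i" unfolding window_def Suc by simp
      thus ?thesis by blast
    qed
  qed
  have eq: "from_rest v i = ?Y i" for i
  proof (rule from_rest_unique[OF v adm])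
    show "?V i = delay v i" for i
    proof (cases i)
      case 0 thus ?thesis using v0 by (simp add: delay_def)
    next
      case (Suc i')
      show ?thesis
      proof (cases "i' < q")
        case True thus ?thesis using v0 Suc by (auto simp: delay_def)
      next
        case False thus ?thesis using Suc by (simp add: delay_def Suc_diff_le)
      qed
    qed
    show "?Y j = 0\<^sub>v p" if "j < q" for j using that w(1) by (cases j) auto
  qed
  show "forced v 0 = 0\<^sub>v p" unfolding forced_def eq using w(1) by (cases q) auto
  show "forced v (Suc j) = forced ?w j" unfolding forced_def eq by simp
qed

definition u_ext :: "nat \<Rightarrow> real vec" where
  "u_ext i = (if i < t then u i else 0\<^sub>v m)"

lemma u_ext_carrier: "u_ext i \<in> carrier_vec m"
  using u_carrier by (simp add: u_ext_def)

lemma data_extension: "\<exists>Y. admissible u_ext Y \<and> (\<forall>s<t. Y s = y s)"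
proof -
  let ?e = "\<lambda>r s. if s = r then 1 else (0 :: real)"
  have "\<exists>Y. (\<forall>j<q. Y j = y j) \<and> admissible u_ext Y"
  proof (rule admissible_extension[of _ "?e 0"])
    fix j assume j: "j < q"
    hence "0 + j < t" using q_less by simp
    thus "u_ext j = wcomb m u (t - q + 1) (?e 0) j \<and> y j = wcomb p y (t - q + 1) (?e 0) j"
      using u_carrier[of j] y_carrier[of j] by (subst wcomb_unit, simp, simp, subst wcomb_unit) (simp_all add: u_ext_def)
  qed (rule u_ext_carrier)
  then obtain Y where Y: "\<forall>j<q. Y j = y j" "admissible u_ext Y" by blast
  have "Y s = y s" if "s < t" for s
    using that
  proof (induction s rule: less_induct)
    case (less s)
    show ?case
    proof (cases "s < q")
      case False
      then obtain r where r: "s = r + q" by (metis add.commute le_Suc_ex not_less)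
      obtain b where b: "window b u_ext Y r" using Y(2) unfolding admissible_def by blast
      have rt: "r < t - q" using r less.prems by simp
      have data: "window (?e r) u_ext y r"
        unfolding window_def
      proof (intro allI impI)
        fix j assume "j \<le> q"
        hence "r + j < t" using rt by simp
        thus "u_ext (r + j) = wcomb m u (t - q) (?e r) j \<and> y (r + j) = wcomb p y (t - q) (?e r) j"
          using u_carrier[of "r + j"] y_carrier[of "r + j"] rt
          by (subst wcomb_unit, simp, simp, subst wcomb_unit) (simp_all add: u_ext_def)
      qed
      show ?thesis unfolding r
      proof (rule window_output_unique[OF b data])
        show "Y (r + j) = y (r + j)" if "j < q" for j using less that r by simp
      qed simp
    qed (use Y(1) in simp)
  qed
  with Y(2) show ?thesis by blast
qed

text \<open>System matrices exist by \<open>signal_factor2\<close> once every relation among the present states and inputs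
persists for the next states and the outputs. Given such a relation, the superposed free response vanishes, so the
superposed outputs are the forced response to a superposed input that starts with zero; by causality it
vanishes at first and its shift is again purely forced.\<close>

lemma realization:
  assumes T: "trajectory m p n A B C D u y x t"
  shows "\<exists>A' B' C' D' x'. trajectory m p (mat_rank (obs_mat C A q)) A' B' C' D' u y x' t"
proof -
  interpret S: trajectory m p n A B C D u y x t by (rule T)
  let ?r = "mat_rank (obs_mat C A q)"
  note oc = obs_mat_carrier[OF S.A S.C, of q]
  obtain L where L: "L \<in> carrier_mat ?r n" "\<And>v. v \<in> carrier_vec n \<Longrightarrow> L *\<^sub>v v = 0\<^sub>v ?r \<longleftrightarrow> obs_mat C A q *\<^sub>v v = 0\<^sub>v (q * p)"
    using same_kernel_with_rank_rows[OF oc] by blast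
  obtain Y where Y: "admissible u_ext Y" "\<And>s. s < t \<Longrightarrow> Y s = y s" using data_extension by blast
  define us where "us s i = u_ext (s + i)" for s i
  have usc: "us s i \<in> carrier_vec m" for s i unfolding us_def by (rule u_ext_carrier)
  define f where "f s j = Y (s + j) - forced (us s) j" for s j
  have Yc: "Y i \<in> carrier_vec p" for i by (rule admissible_carrier(2)[OF Y(1)])
  have Zc: "forced (us s) j \<in> carrier_vec p" for s j
    by (rule admissible_carrier(2)[OF forced_admissible]) (rule usc)
  have f_adm: "admissible (\<lambda>_. 0\<^sub>v m) (f s)" for s
  proof -
    have "admissible (\<lambda>i. u_ext (s + i) - us s i) (\<lambda>i. Y (s + i) - forced (us s) i)"
      by (rule admissible_diff[OF admissible_shift[OF Y(1)] forced_admissible]) (rule usc)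
    moreover have "u_ext (s + i) - us s i = 0\<^sub>v m" for i
      unfolding us_def by (rule minus_cancel_vec[OF u_ext_carrier])
    ultimately show ?thesis unfolding f_def[abs_def] by simp
  qed
  have "\<forall>s. \<exists>\<xi>. \<xi> \<in> carrier_vec n \<and> (\<forall>j\<le>q. f s j = C *\<^sub>v (A ^\<^sub>m j *\<^sub>v \<xi>))"
  proof
    fix s
    obtain b where b: "window b (\<lambda>_. 0\<^sub>v m) (f s) 0" using f_adm unfolding admissible_def by blast
    have bu: "wcomb m u (t - q) b j = 0\<^sub>v m" if "j \<le> q" for j
      using b[unfolded window_def, rule_format, OF that] by metis
    have "f s j = C *\<^sub>v (A ^\<^sub>m j *\<^sub>v wcomb n x (t - q) b 0)" if "j \<le> q" for j
    proof -
      have "wcomb p y (t - q) b j = C *\<^sub>v (A ^\<^sub>m j *\<^sub>v wcomb n x (t - q) b 0)"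
        by (rule S.free_output[of _ "Suc q"]) (use bu q_less that in auto)
      thus ?thesis using b that unfolding window_def by simp
    qed
    thus "\<exists>\<xi>. \<xi> \<in> carrier_vec n \<and> (\<forall>j\<le>q. f s j = C *\<^sub>v (A ^\<^sub>m j *\<^sub>v \<xi>))"
      by (intro exI[of _ "wcomb n x (t - q) b 0"]) simp
  qed
  then obtain \<xi> where \<xi>: "\<And>s. \<xi> s \<in> carrier_vec n" "\<And>s j. j \<le> q \<Longrightarrow> f s j = C *\<^sub>v (A ^\<^sub>m j *\<^sub>v \<xi> s)"
    by metis
  define z where "z s = L *\<^sub>v \<xi> s" for s
  have zc: "z s \<in> carrier_vec ?r" for s unfolding z_def by (rule mult_vec_carrier[OF L(1)])
  have comb_f: "comb p t c (\<lambda>s. f (g s) j) = C *\<^sub>v (A ^\<^sub>m j *\<^sub>v comb n t c (\<lambda>s. \<xi> (g s)))" if "j \<le> q" for c g j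
  proof -
    have "A ^\<^sub>m j *\<^sub>v comb n t c (\<lambda>s. \<xi> (g s)) = comb n t c (\<lambda>s. A ^\<^sub>m j *\<^sub>v \<xi> (g s))"
      by (rule mult_comb[OF pow_carrier_mat[OF S.A] \<xi>(1)])
    moreover have "C *\<^sub>v comb n t c (\<lambda>s. A ^\<^sub>m j *\<^sub>v \<xi> (g s)) = comb p t c (\<lambda>s. C *\<^sub>v (A ^\<^sub>m j *\<^sub>v \<xi> (g s)))"
      by (rule mult_comb[OF S.C]) (rule mult_vec_carrier[OF pow_carrier_mat[OF S.A]])
    ultimately show ?thesis using \<xi>(2)[OF that] by simp
  qed
  have comb_z: "comb ?r t c (\<lambda>s. z (g s)) = 0\<^sub>v ?r \<longleftrightarrow> (\<forall>j<q. comb p t c (\<lambda>s. f (g s) j) = 0\<^sub>v p)" for c g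
  proof -
    have "comb ?r t c (\<lambda>s. z (g s)) = L *\<^sub>v comb n t c (\<lambda>s. \<xi> (g s))"
      unfolding z_def by (rule mult_comb[OF L(1) \<xi>(1), symmetric])
    thus ?thesis
      using L(2)[of "comb n t c (\<lambda>s. \<xi> (g s))"] obs_mat_kernel_iff[OF S.A S.C, of "comb n t c (\<lambda>s. \<xi> (g s))" q]
      by (simp add: comb_f)
  qed
  have key: "comb ?r t c (\<lambda>s. z (Suc s)) = 0\<^sub>v ?r \<and> comb p t c y = 0\<^sub>v p"
    if c: "comb ?r t c z = 0\<^sub>v ?r" "comb m t c u = 0\<^sub>v m" for c
  proof -
    define W where "W i = comb m t c (\<lambda>s. us s i)" for i
    have Wc: "W i \<in> carrier_vec m" for i unfolding W_def by simp
    have "W 0 = comb m t c u" unfolding W_def us_def u_ext_def by (rule comb_cong) auto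
    hence W0: "W 0 = 0\<^sub>v m" using c(2) by simp
    have forcedW: "comb p t c (\<lambda>s. forced (us s) j) = forced W j" for j
      unfolding W_def by (rule forced_comb[symmetric]) (rule usc)
    have forcedW': "comb p t c (\<lambda>s. forced (us (Suc s)) j) = forced (\<lambda>i. W (Suc i)) j" for j
    proof -
      have "us (Suc s) i = us s (Suc i)" for s i unfolding us_def by simp
      hence "forced (\<lambda>i. W (Suc i)) j = forced (\<lambda>i. comb m t c (\<lambda>s. us (Suc s) i)) j" unfolding W_def by simp
      also have "\<dots> = comb p t c (\<lambda>s. forced (us (Suc s)) j)" by (rule forced_comb) (rule usc)
      finally show ?thesis by simp
    qed
    have F_adm: "admissible (\<lambda>i. comb m t c (\<lambda>s. 0\<^sub>v m)) (\<lambda>i. comb p t c (\<lambda>s. f s i))"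
      by (rule admissible_comb) (rule f_adm)
    have F0: "comb p t c (\<lambda>s. f s j) = 0\<^sub>v p" for j
    proof (rule admissible_unique[OF F_adm admissible_zero])
      show "comb m t c (\<lambda>s. 0\<^sub>v m) = 0\<^sub>v m" for i :: nat by (simp add: comb_zero_signal)
      show "comb p t c (\<lambda>s. f s j) = 0\<^sub>v p" if "j < q" for j using c(1) comb_z[of c "\<lambda>s. s"] that by simp
    qed
    have Yf: "comb p t c (\<lambda>s. Y (s + j)) = forced W j" for j
    proof (rule eq_if_minus_eq_zero)
      have "comb p t c (\<lambda>s. f s j) = comb p t c (\<lambda>s. Y (s + j)) - comb p t c (\<lambda>s. forced (us s) j)"
        unfolding f_def by (rule comb_diff[OF Yc Zc])
      thus "comb p t c (\<lambda>s. Y (s + j)) - forced W j = 0\<^sub>v p" unfolding forcedW F0 by simp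
      show "forced W j \<in> carrier_vec p" by (rule admissible_carrier(2)[OF forced_admissible]) (rule Wc)
    qed simp
    have "comb p t c y = comb p t c (\<lambda>s. Y (s + 0))" by (rule comb_cong) (simp_all add: Y(2))
    also have "\<dots> = 0\<^sub>v p" unfolding Yf by (rule forced_causal(1)[where v = W, OF Wc W0])
    finally have 1: "comb p t c y = 0\<^sub>v p" .
    have "comb p t c (\<lambda>s. f (Suc s) j) = 0\<^sub>v p" for j
    proof -
      have "comb p t c (\<lambda>s. f (Suc s) j) = comb p t c (\<lambda>s. Y (Suc s + j)) - comb p t c (\<lambda>s. forced (us (Suc s)) j)"
        unfolding f_def by (rule comb_diff[OF Yc Zc])
      also have "comb p t c (\<lambda>s. Y (Suc s + j)) = forced W (Suc j)" using Yf[of "Suc j"] by simp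
      also have "forced W (Suc j) = forced (\<lambda>i. W (Suc i)) j" by (rule forced_causal(2)[where v = W, OF Wc W0])
      also have "comb p t c (\<lambda>s. forced (us (Suc s)) j) = forced (\<lambda>i. W (Suc i)) j" by (rule forcedW')
      also have "forced (\<lambda>i. W (Suc i)) j - forced (\<lambda>i. W (Suc i)) j = 0\<^sub>v p"
        by (rule minus_cancel_vec) (rule admissible_carrier(2)[OF forced_admissible], rule Wc)
      finally show ?thesis .
    qed
    thus ?thesis using 1 comb_z[of c Suc] by simp
  qed
  obtain A' B' where AB: "A' \<in> carrier_mat ?r ?r" "B' \<in> carrier_mat ?r m" "\<forall>s<t. z (Suc s) = A' *\<^sub>v z s + B' *\<^sub>v u s"
    using signal_factor2[of t z ?r u m "\<lambda>s. z (Suc s)" ?r, OF zc u_carrier zc] key by blast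
  obtain C' D' where CD: "C' \<in> carrier_mat p ?r" "D' \<in> carrier_mat p m" "\<forall>s<t. y s = C' *\<^sub>v z s + D' *\<^sub>v u s"
    using signal_factor2[of t z ?r u m y p, OF zc u_carrier y_carrier] key by blast
  have "trajectory m p ?r A' B' C' D' u y z t"
    by unfold_locales (use AB CD u_carrier zc in auto)
  thus ?thesis by blast
qed

end

section \<open>Extending the data\<close>

lemma scalar_prod_comb:
  assumes "g \<in> carrier_vec m" "\<And>s. s < N \<Longrightarrow> f s \<in> carrier_vec m"
  shows "g \<bullet> comb m N a f = (\<Sum>s<N. a s * (g \<bullet> f s))"
proof -
  have "g \<bullet> comb m N a f = (\<Sum>i<m. g $ i * (\<Sum>s<N. a s * f s $ i))"
    by (simp add: scalar_prod_def lessThan_atLeast0)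
  also have "\<dots> = (\<Sum>s<N. a s * (\<Sum>i<m. g $ i * f s $ i))"
    unfolding sum_distrib_left by (subst sum.swap) (simp add: algebra_simps)
  also have "\<dots> = (\<Sum>s<N. a s * (g \<bullet> f s))"
  proof (rule sum.cong[OF refl])
    fix s assume "s \<in> {..<N}"
    hence "dim_vec (f s) = m" using assms(2)[of s] by simp
    thus "a s * (\<Sum>i<m. g $ i * f s $ i) = a s * (g \<bullet> f s)" by (simp add: scalar_prod_def lessThan_atLeast0)
  qed
  finally show ?thesis .
qed

lemma full_column_rank_mono:
  assumes fcr: "full_column_rank m p k u y N" and "N' \<le> N" "k \<le> k'"
    and u: "\<And>i. i < N + k \<Longrightarrow> u' i = u i" and y: "\<And>i. i < N + k \<Longrightarrow> y' i = y i"
  shows "full_column_rank m p k' u' y' N'"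
  unfolding full_column_rank_def
proof (intro allI impI)
  fix a s assume z: "\<forall>j\<le>k'. wcomb p y' N' a j = 0\<^sub>v p \<and> wcomb m u' N' a j = 0\<^sub>v m" and s: "s < N'"
  define b where "b r = (if r < N' then a r else 0)" for r
  have ext: "wcomb q f N b j = wcomb q f' N' a j" if "j \<le> k" "\<And>i. i < N + k \<Longrightarrow> f' i = f i" for q f f' j
  proof -
    have "wcomb q f N b j = wcomb q f N' b j" using assms(2) by (intro wcomb_mono) (auto simp: b_def)
    also have "\<dots> = wcomb q f' N' a j" using assms(2) that by (intro wcomb_cong) (auto simp: b_def)
    finally show ?thesis .
  qed
  have "\<forall>j\<le>k. wcomb p y N b j = 0\<^sub>v p \<and> wcomb m u N b j = 0\<^sub>v m"
  proof (intro allI impI)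
    fix j assume j: "j \<le> k"
    have "wcomb p y N b j = wcomb p y' N' a j" by (rule ext[OF j]) (rule y)
    moreover have "wcomb m u N b j = wcomb m u' N' a j" by (rule ext[OF j]) (rule u)
    ultimately show "wcomb p y N b j = 0\<^sub>v p \<and> wcomb m u N b j = 0\<^sub>v m"
      using z j assms(3) by simp
  qed
  hence "b s = 0" using fcr s assms(2) unfolding full_column_rank_def by (meson less_le_trans)
  thus "a s = 0" using s by (simp add: b_def)
qed

text \<open>The exceptional inputs are those for which the relation of \<open>violated_relation\<close> persists for the
new column, or any hyperplane if the relation is broken independently of the input.\<close>

lemma exceptional_set_exists:
  assumes m: "1 \<le> m" and k: "1 \<le> k" "k < length us" and us: "set us \<subseteq> carrier_vec m" and len: "length ys = length us"
    and fcr: "full_column_rank m p k ((!) us) ((!) ys) (length us - k)"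
    and rk: "mat_rank (G_mat m p k us ys) < m + mat_rank (H_mat m p (k - 1) us ys)"
  shows "\<exists>X v. exceptional_set m p sys x0 k us ys X \<and> v \<in> carrier_vec m \<and> v \<notin> X"
proof -
  define t where "t = length us"
  have uc: "us ! s \<in> carrier_vec m" if "s < t" for s using us that nth_mem unfolding t_def by blast
  obtain g h where g: "g \<in> carrier_vec m"
    and h: "\<And>a. (\<forall>j<k. wcomb p ((!) ys) (t - k + 1) a j = 0\<^sub>v p \<and> wcomb m ((!) us) (t - k + 1) a j = 0\<^sub>v m) \<Longrightarrow> (\<Sum>s<t - k + 1. a s * h s) = 0"
    and rel: "\<And>s. s < t - k \<Longrightarrow> h s + g \<bullet> us ! (s + k) = 0"
    and nz: "g \<noteq> 0\<^sub>v m \<or> h (t - k) \<noteq> 0"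
    using violated_relation[OF k(1) k(2)[folded t_def] t_def[symmetric] rk uc] by blast
  define f where "f = (if g = 0\<^sub>v m then unit_vec m 0 else g)"
  define X where "X = {v \<in> carrier_vec m. f \<bullet> v = - h (t - k)}"
  have f: "f \<in> carrier_vec m" "f \<noteq> 0\<^sub>v m" using g m by (auto simp: f_def)
  obtain i where i: "i < m" "f $ i \<noteq> 0" using f by (auto simp: vec_eq_iff)
  let ?v = "((1 - h (t - k)) / f $ i) \<cdot>\<^sub>v unit_vec m i"
  have "f \<bullet> ?v = 1 - h (t - k)" using i f scalar_prod_right_unit[OF i(1), of f] by simp
  hence v: "?v \<in> carrier_vec m" "?v \<notin> X" by (auto simp: X_def)
  have "mat_rank (H_mat m p k (us @ [v]) (ys @ [w])) = mat_rank (H_mat m p k us ys) + 1"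
    if v: "v \<in> carrier_vec m" "v \<notin> X" for v w
  proof -
    let ?us = "us @ [v]" and ?ys = "ys @ [w]"
    have N: "length ?us - k = t - k + 1" using k by (simp add: t_def Suc_diff_le)
    have old: "?us ! i = us ! i" "?ys ! i = ys ! i" if "i < t" for i
      using that len by (simp_all add: t_def nth_append)
    have nz': "h (t - k) + g \<bullet> v \<noteq> 0" using v nz unfolding X_def f_def by (cases "g = 0\<^sub>v m") auto
    have "full_column_rank m p k ((!) ?us) ((!) ?ys) (t - k + 1)"
      unfolding full_column_rank_def
    proof (intro allI impI)
      fix a s assume z: "\<forall>j\<le>k. wcomb p ((!) ?ys) (t - k + 1) a j = 0\<^sub>v p \<and> wcomb m ((!) ?us) (t - k + 1) a j = 0\<^sub>v m"
        and s: "s < t - k + 1"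
      have "\<forall>j<k. wcomb p ((!) ys) (t - k + 1) a j = 0\<^sub>v p \<and> wcomb m ((!) us) (t - k + 1) a j = 0\<^sub>v m"
      proof (intro allI impI)
        fix j assume j: "j < k"
        have "wcomb p ((!) ys) (t - k + 1) a j = wcomb p ((!) ?ys) (t - k + 1) a j"
          "wcomb m ((!) us) (t - k + 1) a j = wcomb m ((!) ?us) (t - k + 1) a j"
          using j k(2) by (intro wcomb_cong refl old[symmetric], simp add: t_def)+
        thus "wcomb p ((!) ys) (t - k + 1) a j = 0\<^sub>v p \<and> wcomb m ((!) us) (t - k + 1) a j = 0\<^sub>v m"
          using z j by simp
      qed
      hence 1: "(\<Sum>s<t - k + 1. a s * h s) = 0" by (rule h)
      have uc': "?us ! (s + k) \<in> carrier_vec m" if "s < t - k + 1" for s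
        using uc[of "s + k"] v that k(2) by (cases "s = t - k") (auto simp: t_def nth_append)
      have "g \<bullet> wcomb m ((!) ?us) (t - k + 1) a k = (\<Sum>s<t - k + 1. a s * (g \<bullet> ?us ! (s + k)))"
        unfolding wcomb_def by (rule scalar_prod_comb[OF g uc'])
      hence "(\<Sum>s<t - k + 1. a s * (g \<bullet> ?us ! (s + k))) = 0" using z g by simp
      hence "(\<Sum>s<t - k + 1. a s * (h s + g \<bullet> ?us ! (s + k))) = 0"
        using 1 by (simp add: distrib_left sum.distrib)
      moreover have "(\<Sum>s<t - k. a s * (h s + g \<bullet> ?us ! (s + k))) = 0"
        using rel old by (intro sum.neutral) auto
      ultimately have "a (t - k) * (h (t - k) + g \<bullet> ?us ! (t - k + k)) = 0" by simp
      moreover have "?us ! (t - k + k) = v" using k(2) by (simp add: t_def nth_append)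
      ultimately have last: "a (t - k) = 0" using nz' by simp
      have "\<forall>j\<le>k. wcomb p ((!) ys) (t - k) a j = 0\<^sub>v p \<and> wcomb m ((!) us) (t - k) a j = 0\<^sub>v m"
      proof (intro allI impI)
        fix j assume j: "j \<le> k"
        have sw: "wcomb q F (t - k) a j = wcomb q F' (t - k + 1) a j" if "\<And>i. i < t \<Longrightarrow> F' i = F i" for q F F'
        proof -
          have "wcomb q F' (t - k + 1) a j = wcomb q F' (t - k) a j"
          proof (rule wcomb_mono)
            fix s assume "t - k \<le> s" "s < t - k + 1"
            hence "s = t - k" by simp
            thus "a s = 0" using last by simp
          qed simp
          also have "\<dots> = wcomb q F (t - k) a j" using that j by (intro wcomb_cong) auto
          finally show ?thesis by simp
        qed
        have "wcomb p ((!) ys) (t - k) a j = wcomb p ((!) ?ys) (t - k + 1) a j" by (rule sw) (rule old(2))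
        moreover have "wcomb m ((!) us) (t - k) a j = wcomb m ((!) ?us) (t - k + 1) a j" by (rule sw) (rule old(1))
        ultimately show "wcomb p ((!) ys) (t - k) a j = 0\<^sub>v p \<and> wcomb m ((!) us) (t - k) a j = 0\<^sub>v m"
          using z j by simp
      qed
      hence "\<forall>s<t - k. a s = 0" using fcr unfolding full_column_rank_def t_def by blast
      thus "a s = 0" using s last by (cases "s = t - k") auto
    qed
    hence "mat_rank (H_mat m p k ?us ?ys) = t - k + 1"
      using mat_rank_H_mat_iff[of k ?us m p ?ys] k(2) unfolding N by simp
    moreover have "mat_rank (H_mat m p k us ys) = t - k"
      using mat_rank_H_mat_iff[OF k(2), of m p ys] fcr unfolding t_def by simp
    ultimately show ?thesis by simp
  qed
  moreover have "affine_of_dim m (m - 1) X" unfolding X_def by (rule hyperplane_affine[OF f])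
  ultimately have "exceptional_set m p sys x0 k us ys X" unfolding exceptional_set_def by blast
  thus ?thesis using v by blast
qed

section \<open>The experiment\<close>

locale online_experiment =
  fixes m p L N n :: nat and A B C D :: "real mat" and x0 :: "real vec"
  assumes m_pos: "1 \<le> m"
    and carriers: "A \<in> carrier_mat n n" "B \<in> carrier_mat n m" "C \<in> carrier_mat p n" "D \<in> carrier_mat p m"
    and min: "controllable A B" "observable C A"
    and bounds: "lag C A \<le> L" "n \<le> N" and x0: "x0 \<in> carrier_vec n"
begin

abbreviation "sys \<equiv> (A, B, C, D)"

definition final_depth :: nat where "final_depth = min L (N - n + lag C A)"

lemma lag_le_final_depth: "lag C A \<le> final_depth"
  using bounds by (simp add: final_depth_def)

definition data_ok :: "real vec list \<Rightarrow> real vec list \<Rightarrow> bool" where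
  "data_ok us ys \<longleftrightarrow> set us \<subseteq> carrier_vec m \<and> length ys = length us \<and>
     (\<forall>s<length us. ys ! s = output_at sys x0 us s)"

lemma state_at_append: "s \<le> length us \<Longrightarrow> state_at sys x0 (us @ vs) s = state_at sys x0 us s"
  by (induction s) (simp_all add: nth_append)

lemma data_ok_trajectory:
  assumes "data_ok us ys"
  shows "trajectory m p n A B C D ((!) us) ((!) ys) (state_at sys x0 us) (length us)"
proof unfold_locales
  have "state_at sys x0 us s \<in> carrier_vec n" for s
  proof (cases s)
    case (Suc r)
    show ?thesis unfolding Suc state_at.simps
      by (intro add_carrier_vec mult_vec_carrier[OF carriers(1)] mult_vec_carrier[OF carriers(2)])
  qed (simp add: x0)
  thus "state_at sys x0 us s \<in> carrier_vec n" for s .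
qed (use assms carriers in \<open>auto simp: data_ok_def\<close>)

lemma data_ok_extend:
  assumes "data_ok us ys" "v \<in> carrier_vec m"
  shows "data_ok (us @ [v]) (ys @ [measured sys x0 us v])"
  unfolding data_ok_def
proof (intro conjI allI impI)
  fix s assume "s < length (us @ [v])"
  hence "s < length us \<or> s = length us" by auto
  thus "(ys @ [measured sys x0 us v]) ! s = output_at sys x0 (us @ [v]) s"
    using assms(1) by (auto simp: data_ok_def nth_append measured_def state_at_append)
qed (use assms in \<open>auto simp: data_ok_def\<close>)

lemma outputs_determined_lag:
  assumes "trajectory m p n' A' B' C' D' u y x t" "lag C' A' \<le> j" "j \<le> t"
  shows "outputs_determined m p u y t j"
proof -
  interpret S: trajectory m p n' A' B' C' D' u y x t by (rule assms(1))
  show ?thesis unfolding outputs_determined_def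
    using assms(2,3) by (intro allI impI S.zero_window_next_output) auto
qed

context
  fixes us ys k t
  assumes ok: "data_ok us ys" and t: "t = length us" and k: "k < t"
    and sat: "saturated m p ((!) us) ((!) ys) t k"
begin

lemma true_trajectory: "trajectory m p n A B C D ((!) us) ((!) ys) (state_at sys x0 us) t"
  unfolding t by (rule data_ok_trajectory[OF ok])

lemma us_carrier: "set us \<subseteq> carrier_vec m"
  using ok by (simp add: data_ok_def)

text \<open>The order is bounded below by the rank of the Hankel matrix, the lag by \<open>lag_ge_true\<close>; the true system attains both
bounds.\<close>

lemma min_values_if_lag_le:
  assumes l: "lag C A \<le> k"
  shows "n_min m p us ys = n" "l_min m p us ys = lag C A"
proof -
  note T' = true_trajectory[unfolded t]
  have "n \<le> n'" if "trajectory m p n' A' B' C' D' ((!) us) ((!) ys) x (length us)" for n' A' B' C' D' x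
    using trajectory.rank_H_mat_eq[OF true_trajectory refl refl t[symmetric] k sat min l]
      trajectory.rank_H_mat_le[OF that refl refl refl k[unfolded t]] by simp
  hence "n \<le> n_min m p us ys" by (rule n_min_ge[OF us_carrier T'])
  thus "n_min m p us ys = n" using n_min_le[OF us_carrier T'] by simp
  have "lag C A \<le> lag C' A'" if "trajectory m p n' A' B' C' D' ((!) us) ((!) ys) x (length us)" for n' A' B' C' D' x
    by (rule lag_ge_true[OF true_trajectory that[folded t] sat k min l])
  hence "lag C A \<le> l_min m p us ys" by (rule l_min_ge[OF us_carrier T'])
  thus "l_min m p us ys = lag C A" using l_min_le[OF us_carrier T'] by simp
qed

lemma L_act_if_lag_le:
  assumes "lag C A \<le> k"
  shows "L_act m p L N us ys = int final_depth"
  unfolding L_act_def min_values_if_lag_le[OF assms] final_depth_def using bounds(2) by (simp add: of_nat_diff)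

text \<open>The order is bounded from above by a realisation and the lag from below by an output that the past does
not determine.\<close>

lemma L_act_greater_if_less_lag:
  assumes l: "k < lag C A"
  shows "int k < L_act m p L N us ys"
proof -
  note T' = true_trajectory[unfolded t]
  have yc: "ys ! s \<in> carrier_vec p" "us ! s \<in> carrier_vec m" if "s < t" for s
    using trajectory.y_carrier[OF true_trajectory that] trajectory.u_carrier[OF true_trajectory that] by auto
  have "int k < int N - int (n_min m p us ys) + int (l_min m p us ys)"
  proof (cases "outputs_determined m p ((!) us) ((!) ys) t k")
    case False
    have "Suc k \<le> lag C' A'" if "trajectory m p n' A' B' C' D' ((!) us) ((!) ys) x (length us)" for n' A' B' C' D' x
      using outputs_determined_lag[OF that[folded t], of k] False k by (meson less_imp_le not_less_eq_eq)
    hence "Suc k \<le> l_min m p us ys" by (rule l_min_ge[OF us_carrier T'])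
    thus ?thesis using n_min_le[OF us_carrier T'] bounds(2) by simp
  next
    case True
    \<comment> \<open>The least such depth also bounds the minimal lag from below, which compensates the loss in the order.\<close>
    define q where "q = (LEAST j. outputs_determined m p ((!) us) ((!) ys) t j)"
    have q: "outputs_determined m p ((!) us) ((!) ys) t q" "q \<le> k"
      unfolding q_def using True by (auto intro: LeastI Least_le)
    have satq: "saturated m p ((!) us) ((!) ys) t q"
      by (rule saturated_mono[OF sat q(2) k yc(2,1)])
    have dd: "determined_data m p ((!) us) ((!) ys) t q"
      using yc satq q k by unfold_locales auto
    obtain A' B' C' D' x' where R: "trajectory m p (mat_rank (obs_mat C A q)) A' B' C' D' ((!) us) ((!) ys) x' t"
      using determined_data.realization[OF dd true_trajectory] by blast
    have "n_min m p us ys \<le> mat_rank (obs_mat C A q)" by (rule n_min_le[OF us_carrier R[unfolded t]])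
    moreover have "mat_rank (obs_mat C A q) + (lag C A - q) \<le> n"
      using obs_rank_growth[OF carriers(1,3), of q "lag C A"] obs_rank_le[OF carriers(1,3), of "lag C A"] q(2) l by simp
    moreover have "q \<le> l_min m p us ys"
    proof (rule l_min_ge[OF us_carrier T'])
      fix n' A' B' C' D' x assume T'': "trajectory m p n' A' B' C' D' ((!) us) ((!) ys) x (length us)"
      show "q \<le> lag C' A'"
      proof (rule ccontr)
        assume "\<not> q \<le> lag C' A'"
        hence "lag C' A' < q" by simp
        moreover have "outputs_determined m p ((!) us) ((!) ys) t (lag C' A')"
          by (rule outputs_determined_lag[OF T''[folded t]]) (use calculation q(2) k in auto)
        ultimately show False unfolding q_def using not_less_Least by blast
      qed
    qed
    ultimately show ?thesis using bounds(2) q(2) l by linarith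
  qed
  thus ?thesis unfolding L_act_def using bounds(1) l by simp
qed

lemma L_act_eq_iff:
  assumes "k \<le> final_depth"
  shows "int k = L_act m p L N us ys \<longleftrightarrow> k = final_depth"
  using L_act_if_lag_le L_act_greater_if_less_lag lag_le_final_depth assms by (cases "lag C A \<le> k") auto

lemma explaining_minimal_same_order:
  assumes kL: "k = final_depth"
    and s: "(A', B', C', D') \<in> explaining m p us ys \<inter> minimal_systems m p \<inter> bounded_systems m p L N"
  shows "(A', B', C', D') \<in> systems m p n \<and> controllable A' B' \<and> observable C' A' \<and> lag C' A' \<le> k \<and>
    (\<exists>x. trajectory m p n A' B' C' D' ((!) us) ((!) ys) x t)"
proof -
  have l: "lag C A \<le> k" using kL lag_le_final_depth by simp
  obtain l' n' where b: "l' \<le> L" "n' \<le> N" "(A', B', C', D') \<in> systems_lag m p l' n'"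
    using s unfolding bounded_systems_def by auto
  have S': "(A', B', C', D') \<in> systems m p n'" and l': "lag C' A' = l'"
    using b(3) by (auto simp: systems_lag_iff systems_iff)
  have min': "controllable A' B'" "observable C' A'" using s by (auto simp: minimal_systems_def)
  obtain x where x: "trajectory m p n' A' B' C' D' ((!) us) ((!) ys) x t"
    using explaining_iff[OF us_carrier, of A' B' C' D' p ys n'] s S' unfolding t by auto
  have "n + lag C' A' \<le> n' + lag C A" by (rule lag_excess_le[OF true_trajectory x sat k min l])
  hence "lag C' A' \<le> N - n + lag C A" using b(2) bounds(2) by linarith
  hence lk: "lag C' A' \<le> k" unfolding kL final_depth_def using b(1) l' by simp
  have "n' = n"
    using trajectory.rank_H_mat_eq[OF true_trajectory refl refl t[symmetric] k sat min l]
      trajectory.rank_H_mat_eq[OF x refl refl t[symmetric] k sat min' lk] by simp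
  thus ?thesis using S' min' lk x by blast
qed

lemma informative_at_final_depth:
  assumes kL: "k = final_depth"
  shows "informative m p L N n us ys"
proof -
  let ?X = "explaining m p us ys \<inter> minimal_systems m p \<inter> bounded_systems m p L N"
  have sub: "?X \<subseteq> systems m p n"
  proof
    fix s assume s: "s \<in> ?X"
    obtain A' B' C' D' where "s = (A', B', C', D')" by (cases s)
    thus "s \<in> systems m p n" using explaining_minimal_same_order[OF kL] s by simp
  qed
  have "isomorphic_systems n s1 s2" if ss: "s1 \<in> ?X" "s2 \<in> ?X" for s1 s2
  proof -
    obtain A1 B1 C1 D1 where s1: "s1 = (A1, B1, C1, D1)" by (cases s1)
    obtain A2 B2 C2 D2 where s2: "s2 = (A2, B2, C2, D2)" by (cases s2)
    obtain x1 where 1: "controllable A1 B1" "observable C1 A1" "lag C1 A1 \<le> k"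
      "trajectory m p n A1 B1 C1 D1 ((!) us) ((!) ys) x1 t"
      using explaining_minimal_same_order[OF kL ss(1)[unfolded s1]] by blast
    obtain x2 where 2: "controllable A2 B2" "observable C2 A2" "lag C2 A2 \<le> k"
      "trajectory m p n A2 B2 C2 D2 ((!) us) ((!) ys) x2 t"
      using explaining_minimal_same_order[OF kL ss(2)[unfolded s2]] by blast
    show ?thesis unfolding s1 s2 by (rule isomorphic_if_saturated[OF 1(4) 2(4) sat k 1(1-3) 2(1-3)])
  qed
  hence "isomorphism_property m p ?X" unfolding isomorphism_property_def using sub by blast
  moreover have "?X = (explaining m p us ys \<inter> systems m p n) \<inter> minimal_systems m p \<inter> bounded_systems m p L N"
    using sub by blast
  ultimately show ?thesis unfolding informative_def Let_def by simp
qed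

end

definition loop_invariant :: "nat \<Rightarrow> real vec list \<Rightarrow> real vec list \<Rightarrow> bool" where
  "loop_invariant k us ys \<longleftrightarrow> data_ok us ys \<and> k < length us \<and> k \<le> final_depth \<and>
     full_column_rank m p k ((!) us) ((!) ys) (length us - k)"

definition final_length :: nat where "final_length = final_depth + (final_depth + 1) * m + n"

fun invariant :: "config \<Rightarrow> bool" where
  "invariant Start = True"
| "invariant (Outer k us ys) = (loop_invariant k us ys \<and> saturated m p ((!) us) ((!) ys) (length us) k)"
| "invariant (Inner k us ys) = (loop_invariant k us ys \<and> 1 \<le> k)"
| "invariant (Returned us ys) = (informative m p L N n us ys \<and> length us = final_length)"

text \<open>Leaving the inner loop and entering the next depth both decrease the first part by one; while the inner
loop runs, the data get longer, up to \<open>final_length\<close>.\<close>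

fun potential :: "config \<Rightarrow> nat" where
  "potential Start = 2 * final_depth + final_length + 5"
| "potential (Outer k us ys) = 2 * (final_depth - k) + 1 + (final_length + 1 - length us)"
| "potential (Inner k us ys) = 2 * (final_depth - k) + 2 + (final_length + 1 - length us)"
| "potential (Returned us ys) = 0"

text \<open>Independent columns make \<open>length us - k\<close> a rank.\<close>

lemma loop_invariant_length_le:
  assumes "loop_invariant k us ys"
  shows "length us \<le> final_length"
proof -
  have k: "k < length us" "k \<le> final_depth" and ok: "data_ok us ys" using assms by (auto simp: loop_invariant_def)
  have "length us - k = mat_rank (H_mat m p k us ys)"
    using mat_rank_H_mat_iff[OF k(1), of m p ys] assms by (simp add: loop_invariant_def)
  also have "\<dots> \<le> (k + 1) * m + n"
    by (rule trajectory.rank_H_mat_le[OF data_ok_trajectory[OF ok] refl refl refl k(1)])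
  also have "\<dots> \<le> (final_depth + 1) * m + n" using k(2) by (intro add_right_mono mult_right_mono) auto
  finally show ?thesis using k unfolding final_length_def by linarith
qed

lemma loop_invariant_initial:
  assumes us: "length us = m" "set us \<subseteq> carrier_vec m" "invertible_mat (mat_of_cols m us)"
  defines "ys \<equiv> map (output_at sys x0 us) [0..<m]"
  shows "loop_invariant 0 us ys" and "saturated m p ((!) us) ((!) ys) (length us) 0"
proof -
  let ?M = "mat_of_cols m us"
  have M: "?M \<in> carrier_mat m m" using mat_of_cols_carrier(1)[of m us] us(1) by simp
  have mult: "?M *\<^sub>v vec m a = wcomb m ((!) us) m a 0" for a
    unfolding mat_of_cols_def us(1) wcomb_def by (simp add: mat_of_signal_mult)
  obtain R where R: "?M * R = 1\<^sub>m m" "R * ?M = 1\<^sub>m (dim_row R)"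
    using us(3) M unfolding invertible_mat_def inverts_mat_def by auto
  have Rc: "R \<in> carrier_mat m m"
    using arg_cong[OF R(1), of dim_col] arg_cong[OF R(2), of dim_col] M by (intro carrier_matI) auto
  have "a s = 0" if z: "wcomb m ((!) us) m a 0 = 0\<^sub>v m" and s: "s < m" for a s
  proof -
    have "vec m a = (R * ?M) *\<^sub>v vec m a" using R(2) Rc by simp
    also have "\<dots> = R *\<^sub>v (?M *\<^sub>v vec m a)" using Rc M by (intro mult_mat_vec_assoc) auto
    also have "\<dots> = 0\<^sub>v m" unfolding mult z using Rc mult_zero_vec[of R m] by simp
    finally have "vec m a $ s = 0\<^sub>v m $ s" by simp
    thus ?thesis using s by simp
  qed
  hence "full_column_rank m p 0 ((!) us) ((!) ys) m" unfolding full_column_rank_def by simp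
  thus "loop_invariant 0 us ys" using us m_pos by (simp add: loop_invariant_def data_ok_def ys_def)
  show "saturated m p ((!) us) ((!) ys) (length us) 0"
    unfolding saturated_def us(1)
  proof (intro allI ballI)
    fix a and v :: "real vec" assume v: "v \<in> carrier_vec m"
    have "R *\<^sub>v v \<in> carrier_vec m" by (rule mult_vec_carrier[OF Rc])
    then obtain b where b: "R *\<^sub>v v = vec m b" using vec_eta by blast
    have "wcomb m ((!) us) m b 0 = ?M *\<^sub>v (R *\<^sub>v v)" unfolding b mult ..
    also have "\<dots> = (?M * R) *\<^sub>v v" using Rc M v by (intro mult_mat_vec_assoc[symmetric]) auto
    also have "\<dots> = v" using R(1) v by simp
    finally show "\<exists>b. (\<forall>j<0. wcomb p ((!) ys) (m - 0) b j = wcomb p ((!) ys) (m - 0 + 1) a j \<and>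
        wcomb m ((!) us) (m - 0) b j = wcomb m ((!) us) (m - 0 + 1) a j) \<and> wcomb m ((!) us) (m - 0) b 0 = v"
      by (intro exI[of _ b]) simp
  qed
qed

lemma loop_invariant_extend:
  assumes loop_invariant: "loop_invariant k us ys" and v: "v \<in> carrier_vec m"
    and k': "k' \<le> final_depth" "k' < length us + 1"
    and fcr: "full_column_rank m p k' ((!) (us @ [v])) ((!) (ys @ [measured sys x0 us v])) (length us + 1 - k')"
  shows "loop_invariant k' (us @ [v]) (ys @ [measured sys x0 us v])"
  using data_ok_extend[OF _ v, of us ys] loop_invariant k' fcr by (simp add: loop_invariant_def)

lemma step_invariant:
  assumes step: "oe_step m p L N sys x0 c c'" and inv: "invariant c"
  shows "invariant c' \<and> potential c' < potential c"
  using step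
proof cases
  case (init us)
  hence "invariant c'" using loop_invariant_initial by simp
  thus ?thesis using init by simp
next
  case (ret k us ys)
  have loop_invariant: "loop_invariant k us ys" and sat: "saturated m p ((!) us) ((!) ys) (length us) k" using inv ret by auto
  have k: "data_ok us ys" "k < length us" "k \<le> final_depth" using loop_invariant by (auto simp: loop_invariant_def)
  have kL: "k = final_depth" using L_act_eq_iff[OF k(1) refl k(2) sat k(3)] ret by simp
  have "informative m p L N n us ys" by (rule informative_at_final_depth[OF k(1) refl k(2) sat kL])
  moreover have "length us - k = mat_rank (H_mat m p k us ys)"
    using mat_rank_H_mat_iff[OF k(2), of m p ys] loop_invariant by (simp add: loop_invariant_def)
  hence "length us - k = (k + 1) * m + n"
    using trajectory.rank_H_mat_eq[OF data_ok_trajectory[OF k(1)] refl refl refl k(2) sat min] lag_le_final_depth kL by simp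
  hence "length us = final_length" using k(2) unfolding final_length_def kL[symmetric] by linarith
  ultimately show ?thesis using ret by simp
next
  case (enter_extend k us ys v)
  have loop_invariant: "loop_invariant k us ys" and sat: "saturated m p ((!) us) ((!) ys) (length us) k" using inv enter_extend by auto
  have k: "data_ok us ys" "k < length us" "k \<le> final_depth" using loop_invariant by (auto simp: loop_invariant_def)
  have kL: "k < final_depth" using L_act_eq_iff[OF k(1) refl k(2) sat k(3)] enter_extend(3) k(3) by simp
  have len: "length ys = length us" using k(1) by (simp add: data_ok_def)
  have "full_column_rank m p (k + 1) ((!) (us @ [v])) ((!) (ys @ [measured sys x0 us v])) (length us + 1 - (k + 1))"
    by (rule full_column_rank_mono[of m p k "(!) us" "(!) ys" "length us - k"])
      (use loop_invariant len k(2) in \<open>auto simp: loop_invariant_def nth_append\<close>)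
  hence "loop_invariant (k + 1) (us @ [v]) (ys @ [measured sys x0 us v])"
    using kL k(2) enter_extend by (intro loop_invariant_extend[OF loop_invariant]) auto
  thus ?thesis using enter_extend kL loop_invariant_length_le[OF loop_invariant] by simp
next
  case (enter k us ys)
  have loop_invariant: "loop_invariant k us ys" and sat: "saturated m p ((!) us) ((!) ys) (length us) k" using inv enter by auto
  have k: "data_ok us ys" "k < length us" "k \<le> final_depth" using loop_invariant by (auto simp: loop_invariant_def)
  have kL: "k < final_depth" using L_act_eq_iff[OF k(1) refl k(2) sat k(3)] enter(3) k(3) by simp
  have "full_column_rank m p (k + 1) ((!) us) ((!) ys) (length us - (k + 1))"
    by (rule full_column_rank_mono[of m p k "(!) us" "(!) ys" "length us - k"])
      (use loop_invariant in \<open>auto simp: loop_invariant_def\<close>)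
  hence "loop_invariant (k + 1) us ys" using loop_invariant kL k(2) enter(4) by (simp add: loop_invariant_def)
  thus ?thesis using enter kL by simp
next
  case (extend k us ys X v)
  have loop_invariant: "loop_invariant k us ys" and k1: "1 \<le> k" using inv extend by auto
  have k: "data_ok us ys" "k < length us" "k \<le> final_depth" using loop_invariant by (auto simp: loop_invariant_def)
  have "mat_rank (H_mat m p k (us @ [v]) (ys @ [measured sys x0 us v])) = mat_rank (H_mat m p k us ys) + 1"
    using extend unfolding exceptional_set_def by blast
  also have "\<dots> = length (us @ [v]) - k"
    using mat_rank_H_mat_iff[OF k(2), of m p ys] loop_invariant k(2) by (simp add: loop_invariant_def Suc_diff_le)
  finally have "full_column_rank m p k ((!) (us @ [v])) ((!) (ys @ [measured sys x0 us v])) (length us + 1 - k)"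
    using mat_rank_H_mat_iff[of k "us @ [v]" m p "ys @ [measured sys x0 us v]"] k(2) by simp
  hence "loop_invariant k (us @ [v]) (ys @ [measured sys x0 us v])"
    using k extend by (intro loop_invariant_extend[OF loop_invariant]) auto
  thus ?thesis using extend k1 loop_invariant_length_le[OF loop_invariant] by simp
next
  case (leave k us ys)
  have loop_invariant: "loop_invariant k us ys" and k1: "1 \<le> k" using inv leave by auto
  have "k < length us" using loop_invariant by (simp add: loop_invariant_def)
  hence "saturated m p ((!) us) ((!) ys) (length us) k"
    using saturated_if_rank[OF k1 _ refl] leave by blast
  thus ?thesis using leave loop_invariant by simp
qed

lemma reachable_invariant:
  assumes "(oe_step m p L N sys x0)\<^sup>*\<^sup>* Start c"
  shows "invariant c"
  using assms by (induction rule: rtranclp_induct) (auto dest: step_invariant)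

lemma no_infinite_execution:
  "\<not> (\<exists>c. c 0 = Start \<and> (\<forall>i. oe_step m p L N sys x0 (c i) (c (Suc i))))"
proof
  assume "\<exists>c. c 0 = Start \<and> (\<forall>i. oe_step m p L N sys x0 (c i) (c (Suc i)))"
  then obtain c where c: "c 0 = Start" "\<And>i. oe_step m p L N sys x0 (c i) (c (Suc i))" by blast
  have "invariant (c i) \<and> potential (c i) + i \<le> potential (c 0)" for i
  proof (induction i)
    case (Suc i)
    thus ?case using step_invariant[OF c(2)[of i]] by fastforce
  qed (simp add: c(1))
  from this[of "Suc (potential (c 0))"] show False by simp
qed

lemma progress:
  assumes inv: "invariant c" and stuck: "\<nexists>c'. oe_step m p L N sys x0 c c'"
  shows "\<exists>us ys. c = Returned us ys"
proof (cases c)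
  case Start
  let ?us = "map (unit_vec m) [0..<m]"
  have "mat_of_cols m ?us = 1\<^sub>m m" by (intro eq_matI) (auto simp: mat_of_cols_def)
  hence "invertible_mat (mat_of_cols m ?us)"
    unfolding invertible_mat_def inverts_mat_def by (auto intro!: exI[of _ "1\<^sub>m m"])
  hence "oe_step m p L N sys x0 Start (Outer 0 ?us (map (output_at sys x0 ?us) [0..<m]))"
    by (intro oe_step.init) auto
  thus ?thesis using stuck Start by blast
next
  case (Outer k us ys)
  consider "int k = L_act m p L N us ys" | "int k \<noteq> L_act m p L N us ys" "length us = k + 1"
    | "int k \<noteq> L_act m p L N us ys" "length us \<noteq> k + 1" by blast
  thus ?thesis
  proof cases
    case 1
    thus ?thesis using oe_step.ret stuck Outer by blast
  next
    case 2
    thus ?thesis using oe_step.enter_extend[OF 2 zero_carrier_vec] stuck Outer by blast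
  next
    case 3
    thus ?thesis using oe_step.enter[OF 3] stuck Outer by blast
  qed
next
  case (Inner k us ys)
  have loop_invariant: "loop_invariant k us ys" and k1: "1 \<le> k" using inv Inner by auto
  show ?thesis
  proof (cases "mat_rank (G_mat m p k us ys) < m + mat_rank (H_mat m p (k - 1) us ys)")
    case True
    have "\<exists>X v. exceptional_set m p sys x0 k us ys X \<and> v \<in> carrier_vec m \<and> v \<notin> X"
      by (rule exceptional_set_exists[OF m_pos k1 _ _ _ _ True]) (use loop_invariant in \<open>auto simp: loop_invariant_def data_ok_def\<close>)
    thus ?thesis using oe_step.extend[OF True] stuck Inner by blast
  next
    case False
    thus ?thesis using oe_step.leave stuck Inner by blast
  qed
qed simp

end

theorem theorem7:
  fixes m p L N n_true l_true :: nat
    and A B C D :: "real mat"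
    and x0 :: "real vec"
  assumes "m \<ge> 1" and "p \<ge> 1"
    and "(A, B, C, D) \<in> systems_lag m p l_true n_true"
    and "(A, B, C, D) \<in> minimal_systems m p"
    and "l_true \<le> L" and "n_true \<le> N"
    and "x0 \<in> carrier_vec n_true"
  shows
    \<comment> \<open>no execution is infinite\<close>
    "\<not> (\<exists>c. c 0 = Start \<and> (\<forall>i. oe_step m p L N (A, B, C, D) x0 (c i) (c (Suc i)))) \<and>
    \<comment> \<open>every execution that cannot be continued has returned, with the claimed data\<close>
     (\<forall>c. (oe_step m p L N (A, B, C, D) x0)\<^sup>*\<^sup>* Start c \<longrightarrow>
          (\<nexists>c'. oe_step m p L N (A, B, C, D) x0 c c') \<longrightarrow>
          (\<exists>us ys. c = Returned us ys \<and>
             informative m p L N n_true us ys \<and>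
             (let La = min L (N - n_true + l_true)
              in length us = La + (La + 1) * m + n_true)))"
proof -
  have l: "l_true = lag C A" using assms(3) by (simp add: systems_lag_iff)
  interpret E: online_experiment m p L N n_true A B C D x0
    using assms unfolding l by unfold_locales (auto simp: systems_lag_iff minimal_systems_def)
  show ?thesis
  proof (intro conjI allI impI)
    show "\<not> (\<exists>c. c 0 = Start \<and> (\<forall>i. oe_step m p L N (A, B, C, D) x0 (c i) (c (Suc i))))"
      by (rule E.no_infinite_execution)
    fix c assume c: "(oe_step m p L N (A, B, C, D) x0)\<^sup>*\<^sup>* Start c"
      and stuck: "\<nexists>c'. oe_step m p L N (A, B, C, D) x0 c c'"
    have inv: "E.invariant c" by (rule E.reachable_invariant[OF c])
    obtain us ys where R: "c = Returned us ys" using E.progress[OF inv stuck] by blast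
    thus "\<exists>us ys. c = Returned us ys \<and> informative m p L N n_true us ys \<and>
        (let La = min L (N - n_true + l_true) in length us = La + (La + 1) * m + n_true)"
      using inv unfolding l by (simp add: E.final_length_def E.final_depth_def Let_def)
  qed
qed

end
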